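(* Let $(A,\alpha)$, $(B,\beta)$, $(C,\gamma)$ be Lebesgue spaces. For any $\mathfrak P\in\mathrm{Pol}(A,B)$, $\mathfrak Q\in\mathrm{Pol}(B,C)$ and any $u\in\mathbb C$ with $0\le\mathrm{Re}\,u\le 1$, $$T_u(\mathfrak P)\,T_u(\mathfrak Q)=T_u(\mathfrak Q\circ\mathfrak P).$$
   Context: A Lebesgue space $(A,\alpha)$ is a space with a finite positive measure, $\alpha(A)>0$, isomorphic to a disjoint union of a finite (possibly empty) segment with Lebesgue measure and an at most countable collection of atoms. $\mathbb R^\times$ is the multiplicative group of positive reals, with coordinate $t$. $\mathcal M^{\triangledown}$ is the set of positive measures $\mu$ on $\mathbb R^\times$ with $\int d\mu<\infty$ and $\int t\,d\mu(t)<\infty$; it is closed under addition and under the convolution $\int f\,d(\mu*\nu)=\iint f(s_1s_2)\,d\mu(s_1)\,d\nu(s_2)$. A polymorphism from $(A,\alpha)$ to $(B,\beta)$ is a measure $\mathfrak P$ on $A\times B\times\mathbb R^\times$ such that the image of $\mathfrak P$ under the projection to $A$ is $\alpha$ and the image of $t\cdot\mathfrak P$ under the projection to $B$ is $\beta$. $\mathrm{Pol}(A,B)$ is the set of all polymorphisms. For measurable $M\subset A$, $N\subset B$, $\mathfrak p[M\times N]\in\mathcal M^{\triangledown}$ is the image of the restriction of $\mathfrak P$ to $M\times N\times\mathbb R^\times$ under the projection to $\mathbb R^\times$; similarly $\mathfrak q[\cdot]$ for $\mathfrak Q$, etc. Product. Let $\mathfrak P\in\mathrm{Pol}(A,B)$,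 $\mathfrak Q\in\mathrm{Pol}(B,C)$. For measurable $M\subset A$ and $K\subset C$ there are measures $\mathfrak p_{M,b}$, $\mathfrak q_{b,K}\in\mathcal M^{\triangledown}$, defined for $\beta$-almost all $b\in B$, such that for every measurable $N\subset B$ one has $\mathfrak p[M\times N]=\int_N\mathfrak p_{M,b}\,d\beta(b)$ and $\mathfrak q[N\times K]=\int_N\mathfrak q_{b,K}\,d\beta(b)$. The product $\mathfrak R=\mathfrak Q\circ\mathfrak P\in\mathrm{Pol}(A,C)$ is the (well-defined) polymorphism determined by $\mathfrak r[M\times K]=\int_B\mathfrak q_{b,K}*\mathfrak p_{M,b}\,d\beta(b)$ for all measurable $M\subset A$, $K\subset C$. Operators. For $u=v+iw$, $0\le v\le1$, $T_u(\mathfrak P):L^{1/v}(B)\to L^{1/v}(A)$ (with $1/0=\infty$) is the bounded linear operator, of norm $\le1$, defined by $\int_A (T_u(\mathfrak P)g)(a)f(a)\,d\alpha(a)=\iiint_{A\times B\times\mathbb R^\times}f(a)g(b)t^u\,d\mathfrak P(a,b,t)$ for all $g\in L^{1/v}(B)$, $f\in L^{1/(1-v)}(A)$. *)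

theory Defs
  imports "HOL-Probability.Probability"
begin

section \<open>Lebesgue spaces\<close>

definition sum_measure :: "'a measure \<Rightarrow> 'b measure \<Rightarrow> ('a + 'b) measure" where
  "sum_measure M N =
     measure_of (space M <+> space N)
       {E. E \<subseteq> space M <+> space N \<and> Inl -` E \<in> sets M \<and> Inr -` E \<in> sets N}
       (\<lambda>E. emeasure M (Inl -` E) + emeasure N (Inr -` E))"

lemma sigma_algebra_sum_measure: "sigma_algebra (space M <+> space N)
   {E. E \<subseteq> space M <+> space N \<and> Inl -` E \<in> sets M \<and> Inr -` E \<in> sets N}" (is "sigma_algebra ?O ?S")
proof (rule sigma_algebra_iff2[THEN iffD2], intro conjI allI impI ballI)
  show "?S \<subseteq> Pow ?O" by auto
  show "{} \<in> ?S" by auto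
next
  fix s assume s: "s \<in> ?S"
  have "Inl -` (?O - s) = space M - Inl -` s" "Inr -` (?O - s) = space N - Inr -` s" by auto
  with s show "?O - s \<in> ?S" by auto
next
  fix F :: "nat \<Rightarrow> _" assume F: "range F \<subseteq> ?S"
  have "Inl -` (\<Union>i. F i) = (\<Union>i. Inl -` F i)" "Inr -` (\<Union>i. F i) = (\<Union>i. Inr -` F i)" by auto
  with F show "(\<Union>i. F i) \<in> ?S" by (auto simp: subset_iff)
qed

lemma sets_sum_measure: "sets (sum_measure M N) =
  {E. E \<subseteq> space M <+> space N \<and> Inl -` E \<in> sets M \<and> Inr -` E \<in> sets N}"
  unfolding sum_measure_def by (rule sigma_algebra.sets_measure_of_eq[OF sigma_algebra_sum_measure])

lemma emeasure_sum_measure: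
  assumes "E \<in> sets (sum_measure M N)"
  shows "emeasure (sum_measure M N) E = emeasure M (Inl -` E) + emeasure N (Inr -` E)"
proof (rule emeasure_measure_of[OF sum_measure_def])
  show "{E. E \<subseteq> space M <+> space N \<and> Inl -` E \<in> sets M \<and> Inr -` E \<in> sets N} \<subseteq> Pow (space M <+> space N)" by auto
  show "E \<in> sets (sum_measure M N)" by fact
  show "positive (sets (sum_measure M N)) (\<lambda>E. emeasure M (Inl -` E) + emeasure N (Inr -` E))"
    by (simp add: positive_def)
  show "countably_additive (sets (sum_measure M N)) (\<lambda>E. emeasure M (Inl -` E) + emeasure N (Inr -` E))"
  proof (rule countably_additiveI)
    fix F :: "nat \<Rightarrow> ('a+'b) set" assume F: "range F \<subseteq> sets (sum_measure M N)" "disjoint_family F"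
    have "(\<Sum>i. emeasure M (Inl -` F i)) = emeasure M (\<Union>i. Inl -` F i)"
      using F by (intro suminf_emeasure) (auto simp: sets_sum_measure disjoint_family_on_def, blast)
    moreover have "(\<Sum>i. emeasure N (Inr -` F i)) = emeasure N (\<Union>i. Inr -` F i)"
      using F by (intro suminf_emeasure) (auto simp: sets_sum_measure disjoint_family_on_def, blast)
    ultimately show "(\<Sum>i. emeasure M (Inl -` F i) + emeasure N (Inr -` F i)) =
      emeasure M (Inl -` (\<Union>i. F i)) + emeasure N (Inr -` (\<Union>i. F i))"
      by (simp add: suminf_add[symmetric] vimage_UN)
  qed
qed

definition iso_mod_0 :: "'a measure \<Rightarrow> 'b measure \<Rightarrow> bool" where
  "iso_mod_0 M N \<longleftrightarrow>
     (\<exists>X\<in>null_sets M. \<exists>Y\<in>null_sets N. \<exists>f.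
        let M' = restrict_space M (space M - X); N' = restrict_space N (space N - Y) in
          bij_betw f (space M') (space N') \<and>
          f \<in> measurable M' N' \<and>
          the_inv_into (space M') f \<in> measurable N' M' \<and>
          distr M' N' f = N')"

text \<open>The isomorphism is understood modulo null sets and between completed measures, so that a
  Lebesgue space may carry its Borel or its Lebesgue measurable sets. The segment
  \<open>{l..r}\<close> is empty when \<open>r < l\<close>; the atoms are indexed by a set \<open>J\<close> of
  natural numbers and have masses \<open>w\<close>.\<close>

definition lebesgue_space :: "'a measure \<Rightarrow> bool" where
  "lebesgue_space M \<longleftrightarrow>
     finite_measure M \<and> 0 < emeasure M (space M) \<and>
     (\<exists>(l::real) r (J::nat set) w. (\<forall>n\<in>J. 0 < w n) \<and>
        iso_mod_0 (completion M) (sum_measure (lebesgue_on {l..r}) (point_measure J w)))"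


section \<open>Measures on the multiplicative group of positive reals\<close>

definition pos_borel :: "real measure" where
  "pos_borel = restrict_space borel {0<..}"

definition M_tri :: "real measure set" where
  "M_tri = {\<mu>. sets \<mu> = sets pos_borel \<and>
                emeasure \<mu> (space \<mu>) < \<infinity> \<and> (\<integral>\<^sup>+t. ennreal t \<partial>\<mu>) < \<infinity>}"

definition mult_conv :: "real measure \<Rightarrow> real measure \<Rightarrow> real measure" where
  "mult_conv \<mu> \<nu> = distr (\<mu> \<Otimes>\<^sub>M \<nu>) pos_borel (\<lambda>(s\<^sub>1, s\<^sub>2). s\<^sub>1 * s\<^sub>2)"


section \<open>Polymorphisms\<close>

definition Pol :: "'a measure \<Rightarrow> 'b measure \<Rightarrow> ('a \<times> 'b \<times> real) measure set" where
  "Pol A B = {P. sets P = sets (A \<Otimes>\<^sub>M B \<Otimes>\<^sub>M pos_borel) \<and>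
                 distr P A (\<lambda>(a, b, t). a) = A \<and>
                 distr (density P (\<lambda>(a, b, t). ennreal t)) B (\<lambda>(a, b, t). b) = B}"

text \<open>The measure \<open>\<pp>[M \<times> N]\<close>.\<close>

definition pol_block :: "('a \<times> 'b \<times> real) measure \<Rightarrow> 'a set \<Rightarrow> 'b set \<Rightarrow> real measure" where
  "pol_block P M N =
     distr (restrict_space P (M \<times> N \<times> space pos_borel)) pos_borel (\<lambda>(a, b, t). t)"

text \<open>\<open>is_block_density B m k\<close> says that \<open>m N\<close> is the integral of the measures
  \<open>k b\<close> over \<open>b \<in> N\<close> with respect to \<open>B\<close>, evaluated on Borel sets. The values of
  \<open>k\<close> on a null set are immaterial.\<close>

definition is_block_density ::
  "'b measure \<Rightarrow> ('b set \<Rightarrow> real measure) \<Rightarrow> ('b \<Rightarrow> real measure) \<Rightarrow> bool" where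
  "is_block_density B m k \<longleftrightarrow>
     (AE b in B. k b \<in> M_tri) \<and>
     (\<forall>S\<in>sets pos_borel.
        (\<lambda>b. emeasure (k b) S) \<in> borel_measurable B \<and>
        (\<forall>N\<in>sets B. emeasure (m N) S = (\<integral>\<^sup>+b\<in>N. emeasure (k b) S \<partial>B)))"

definition is_pol_comp ::
  "'a measure \<Rightarrow> 'b measure \<Rightarrow> 'c measure \<Rightarrow> ('b \<times> 'c \<times> real) measure \<Rightarrow>
   ('a \<times> 'b \<times> real) measure \<Rightarrow> ('a \<times> 'c \<times> real) measure \<Rightarrow> bool" where
  "is_pol_comp A B C Q P R \<longleftrightarrow>
     R \<in> Pol A C \<and>
     (\<forall>M\<in>sets A. \<forall>K\<in>sets C. \<exists>p q.
        is_block_density B (\<lambda>N. pol_block P M N) p \<and>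
        is_block_density B (\<lambda>N. pol_block Q N K) q \<and>
        (\<forall>S\<in>sets pos_borel.
           emeasure (pol_block R M K) S = (\<integral>\<^sup>+b. emeasure (mult_conv (q b) (p b)) S \<partial>B)))"

definition pol_comp ::
  "'a measure \<Rightarrow> 'b measure \<Rightarrow> 'c measure \<Rightarrow> ('b \<times> 'c \<times> real) measure \<Rightarrow>
   ('a \<times> 'b \<times> real) measure \<Rightarrow> ('a \<times> 'c \<times> real) measure" where
  "pol_comp A B C Q P = (THE R. is_pol_comp A B C Q P R)"


section \<open>Lebesgue function spaces and the operators of a polymorphism\<close>

definition Lp_fun :: "ennreal \<Rightarrow> 'a measure \<Rightarrow> ('a \<Rightarrow> complex) set" where
  "Lp_fun p M = {f \<in> borel_measurable M.
     if p = \<infinity> then \<exists>c. AE x in M. norm (f x) \<le> c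
     else (\<integral>\<^sup>+x. ennreal (norm (f x) powr enn2real p) \<partial>M) < \<infinity>}"

definition Lp_rel :: "ennreal \<Rightarrow> 'a measure \<Rightarrow> (('a \<Rightarrow> complex) \<times> ('a \<Rightarrow> complex)) set" where
  "Lp_rel p M = {(f, g). f \<in> Lp_fun p M \<and> g \<in> Lp_fun p M \<and> (AE x in M. f x = g x)}"

definition Lp_space :: "ennreal \<Rightarrow> 'a measure \<Rightarrow> ('a \<Rightarrow> complex) set set" where
  "Lp_space p M = Lp_fun p M // Lp_rel p M"

text \<open>In \<^typ>\<open>ennreal\<close>, \<open>1 / 0 = \<infinity>\<close>, so \<open>1 / ennreal v\<close> is the exponent \<open>1/v\<close>
  for all \<open>0 \<le> v \<le> 1\<close>.\<close>

definition T_op ::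
  "complex \<Rightarrow> 'a measure \<Rightarrow> 'b measure \<Rightarrow> ('a \<times> 'b \<times> real) measure \<Rightarrow>
   ('b \<Rightarrow> complex) set \<Rightarrow> ('a \<Rightarrow> complex) set" where
  "T_op u A B P =
     (\<lambda>G\<in>Lp_space (1 / ennreal (Re u)) B.
        THE H. H \<in> Lp_space (1 / ennreal (Re u)) A \<and>
          (\<forall>g\<in>G. \<forall>h\<in>H. \<forall>f\<in>Lp_fun (1 / ennreal (1 - Re u)) A.
             (\<integral>a. h a * f a \<partial>A) =
             (\<integral>(a, b, t). f a * g b * (complex_of_real t powr u) \<partial>P)))"

end

theory Submission
  imports Defs
begin

text \<open>
  The first marginal of \<open>Q\<close> is \<open>\<beta>\<close>, so \<open>Q\<close> is an integral over \<open>\<beta>\<close> of probability measures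
  \<open>\<kappa> b\<close> on \<open>C \<times> \<real>\<^sup>\<times>\<close>. Draw \<open>(a, b, t)\<close> from \<open>P\<close> and then \<open>(c, s)\<close> from \<open>\<kappa> b\<close>: the law of
  \<open>(a, c, s t)\<close> is the product of the two polymorphisms, because \<open>(a, t)\<close> and \<open>(c, s)\<close> are
  conditionally independent given \<open>b\<close> and the law of a product of independent variables is a multiplicative
  convolution. In this picture \<open>T\<^sub>u Q g\<close> is the conditional expectation of \<open>g(c) s\<^sup>u\<close> given
  \<open>b\<close>, and since \<open>(s t)\<^sup>u = s\<^sup>u t\<^sup>u\<close>,
  the integral of \<open>f(a) g(c) (s t)\<^sup>u\<close> is that of \<open>f(a) t\<^sup>u (T\<^sub>u Q g)(b)\<close> over \<open>P\<close>, that is,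
  the integral of \<open>f \<cdot> T\<^sub>u P (T\<^sub>u Q g)\<close> over \<open>\<alpha>\<close>. This identity for all \<open>f\<close> is the theorem.

  Three things have to be supplied.

  The kernel \<open>\<kappa>\<close>. Lemma \<open>disintegration_real\<close> builds conditional distributions of a real variable
  from conditional distribution functions at rational points; two applications give a
  pair of real variables. The points of \<open>C\<close> cannot be used directly: if \<open>C\<close> carries its
  Lebesgue measurable sets, there is no reason for measures \<open>\<kappa> b\<close> on all of these sets to exist. Lemma
  \<open>lebesgue_space_coding\<close> therefore encodes \<open>C\<close> by a real number, with a decoding that is
  measurable only for the completion of the law of the code. The kernel lives on codes, the joint
  law is completed, and only then is the code of \<open>c\<close> decoded.

  The identification of the composition. The definite description \<open>pol_comp\<close> denotes this law as soon
  as the law satisfies \<open>is_pol_comp\<close> and nothing else does; the latter holds because block densities are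
  unique almost everywhere and blocks determine a polymorphism (\<open>is_pol_comp_unique\<close>).

  The operators. The definite description \<open>T_op\<close> denotes a class only if some function in
  \<open>L\<^bsup>1/v\<^esup>\<close> satisfies the duality relation. Radon--Nikodym densities give a candidate, and
  \<open>Pol_dual_in_Lv\<close> shows, by testing against its own truncated powers and using Young's
  inequality, that it has the right integrability.
\<close>

section \<open>Kernels and measures determined by rectangles\<close>

lemma borel_eq_rat_atMost: "(borel :: real measure) = sigma UNIV (range (\<lambda>q::rat. {..of_rat q}))"
proof (rule borel_eq_sigmaI1[OF borel_eq_atMost])
  fix Y :: "real set" assume "Y \<in> range (\<lambda>y. {..y})"
  then obtain y where Y: "Y = {..y}" by auto
  have "{..y} = (\<Inter>q\<in>{q. y < of_rat q}. {..of_rat q})"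
  proof (rule equalityI)
    show "(\<Inter>q\<in>{q. y < of_rat q}. {..of_rat q}) \<subseteq> {..y}"
    proof
      fix z assume z: "z \<in> (\<Inter>q\<in>{q. y < of_rat q}. {..of_rat q :: real})"
      show "z \<in> {..y}"
      proof (rule ccontr)
        assume "z \<notin> {..y}"
        then obtain q where "y < of_rat q" "of_rat q < z" using of_rat_dense[of y z] by auto
        with z show False by force
      qed
    qed
  qed auto
  also have "\<dots> \<in> sets (sigma UNIV (range (\<lambda>q::rat. {..of_rat q})))"
  proof (rule sets.countable_INT'')
    show "UNIV \<in> sets (sigma UNIV (range (\<lambda>q::rat. {..of_rat q :: real})))"
      using sets.top[of "sigma UNIV (range (\<lambda>q::rat. {..of_rat q :: real}))"] by simp
  qed auto
  finally show "Y \<in> sets (sigma UNIV (range (\<lambda>q::rat. {..of_rat q :: real})))" unfolding Y .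
qed auto

text \<open>The hypotheses are the properties of a distribution function that involve countably many
inequalities and limits only. For a conditional distribution function each of them holds almost
everywhere, hence all of them hold simultaneously almost everywhere.\<close>

lemma rational_cdf_extends:
  fixes G :: "rat \<Rightarrow> ennreal"
  assumes mono: "\<And>q r. q \<le> r \<Longrightarrow> G q \<le> G r"
    and right: "\<And>q. (INF n::nat. G (q + 1 / of_nat (Suc n))) = G q"
    and top: "(SUP n::nat. G (of_nat n)) = 1"
    and bot: "(INF n::nat. G (- of_nat n)) = 0"
  shows "\<exists>\<nu>::real measure. prob_space \<nu> \<and> sets \<nu> = sets borel \<and> (\<forall>q. emeasure \<nu> {..of_rat q} = G q)"
proof -
  \<comment> \<open>The infimum over larger rationals is right continuous, and right continuity of G makes it
    an extension of G.\<close>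
  define H where "H y = (INF q\<in>{q. y < of_rat q}. G q)" for y :: real
  have G1: "G q \<le> 1" for q
  proof -
    obtain n :: nat where "q \<le> of_nat n" using real_arch_simple by blast
    then have "G q \<le> G (of_nat n)" by (rule mono)
    also have "\<dots> \<le> 1" unfolding top[symmetric] by (rule SUP_upper) simp
    finally show ?thesis .
  qed
  have H_le: "y < of_rat q \<Longrightarrow> H y \<le> G q" for y q
    unfolding H_def by (rule INF_lower) simp
  have H_ge: "G q \<le> H y" if "of_rat q \<le> y" for y q
    unfolding H_def
  proof (rule INF_greatest)
    fix r :: rat assume "r \<in> {r. y < of_rat r}"
    then have "of_rat q < (of_rat r :: real)" using that by simp
    then show "G q \<le> G r" by (intro mono) (simp add: of_rat_less)
  qed
  have H_rat: "H (of_rat q) = G q" for q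
  proof (rule antisym)
    show "H (of_rat q) \<le> G q"
      unfolding right[of q, symmetric] by (rule INF_greatest) (intro H_le, simp add: of_rat_less)
  qed (rule H_ge, simp)
  have H_mono: "H x \<le> H y" if "x \<le> y" for x y
    unfolding H_def by (rule INF_superset_mono) (use that in auto)
  have H1: "H y \<le> 1" for y
  proof -
    obtain q where "y < of_rat q" using of_rat_dense[of y "y+1"] by auto
    then show ?thesis using H_le G1 order_trans by blast
  qed
  have H_fin: "H y < top" for y using H1[of y] by (rule order.strict_trans1) simp
  define F where "F y = enn2real (H y)" for y
  have HF: "H y = ennreal (F y)" for y using H_fin by (simp add: F_def)
  have F0: "0 \<le> F y" for y by (simp add: F_def)
  have F_mono: "F x \<le> F y" if "x \<le> y" for x y
    using H_mono[OF that] by (simp add: HF F0)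
  have F1: "F y \<le> 1" for y using H1[of y] by (simp add: HF F0)
  have F_right: "continuous (at_right a) F" for a
    unfolding continuous_within
  proof (rule order_tendstoI)
    fix c assume "c < F a"
    then show "\<forall>\<^sub>F x in at_right a. c < F x"
      unfolding eventually_at_filter
      by (intro always_eventually) (auto intro: less_le_trans[OF _ F_mono])
  next
    fix c assume c: "F a < c"
    then have "H a < ennreal c" by (simp add: HF F0 ennreal_less_iff)
    then obtain q where q: "a < of_rat q" "G q < ennreal c"
      unfolding H_def INF_less_iff by auto
    have "F x < c" if "a < x" "x < of_rat q" for x
    proof -
      have "ennreal (F x) < ennreal c"
        using H_le[OF that(2)] q(2) HF by (metis order.strict_trans1)
      then show ?thesis by (simp add: ennreal_less_iff F0)
    qed
    then show "\<forall>\<^sub>F x in at_right a. F x < c"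
      using q(1) unfolding eventually_at_right_field by blast
  qed
  have F_bot: "(F \<longlongrightarrow> 0) at_bot"
  proof (rule order_tendstoI)
    fix c :: real assume "c < 0"
    then show "\<forall>\<^sub>F x in at_bot. c < F x" by (intro always_eventually) (auto intro: less_le_trans[OF _ F0])
  next
    fix c :: real assume "0 < c"
    then have "(INF n::nat. G (- of_nat n)) < ennreal c" by (simp add: bot)
    then obtain n :: nat where n: "G (- of_nat n) < ennreal c" unfolding INF_less_iff by auto
    have "F x < c" if "x < - real n" for x
    proof -
      have "ennreal (F x) < ennreal c"
        using H_le[of x "- of_nat n"] n HF[of x] that by (simp add: of_rat_minus)
      then show ?thesis by (simp add: ennreal_less_iff F0)
    qed
    then show "\<forall>\<^sub>F x in at_bot. F x < c" unfolding eventually_at_bot_dense by blast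
  qed
  have F_top: "(F \<longlongrightarrow> 1) at_top"
  proof (rule order_tendstoI)
    fix c :: real assume "1 < c"
    then show "\<forall>\<^sub>F x in at_top. F x < c" by (intro always_eventually) (auto intro: le_less_trans[OF F1])
  next
    fix c :: real assume c: "c < 1"
    then have "ennreal c < (SUP n::nat. G (of_nat n))" by (simp add: top ennreal_less_one_iff)
    then obtain n :: nat where n: "ennreal c < G (of_nat n)" unfolding less_SUP_iff by auto
    have "c < F x" if "real n \<le> x" for x
    proof (cases "c < 0")
      case False
      have "ennreal c < ennreal (F x)"
        using H_ge[of "of_nat n" x] n HF[of x] that by simp
      then show ?thesis using False by (simp add: ennreal_less_iff F0)
    qed (use F0 in \<open>auto intro: less_le_trans\<close>)
    then show "\<forall>\<^sub>F x in at_top. c < F x" unfolding eventually_at_top_linorder by blast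
  qed
  interpret real_distribution "interval_measure F"
    using F_mono F_right F_bot F_top by (rule real_distribution_interval_measure)
  have "emeasure (interval_measure F) {..of_rat q} = G q" for q
    using emeasure_interval_measure_Iic[of F "of_rat q"] F_mono F_right F_bot HF H_rat by simp
  then show ?thesis using prob_space_axioms by (intro exI[of _ "interval_measure F"]) simp
qed

lemma AE_leI_set_integral:
  fixes f g :: "'a \<Rightarrow> ennreal"
  assumes [measurable]: "f \<in> borel_measurable M" "g \<in> borel_measurable M"
    and fin: "(\<integral>\<^sup>+x. g x \<partial>M) < \<infinity>"
    and le: "\<And>X. X \<in> sets M \<Longrightarrow> (\<integral>\<^sup>+x\<in>X. f x \<partial>M) \<le> (\<integral>\<^sup>+x\<in>X. g x \<partial>M)"
  shows "AE x in M. f x \<le> g x"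
proof -
  define X where "X = {x\<in>space M. g x < f x}"
  have X[measurable]: "X \<in> sets M" unfolding X_def by measurable
  have gX: "(\<integral>\<^sup>+x\<in>X. g x \<partial>M) < \<infinity>"
    by (rule le_less_trans[OF nn_integral_mono fin]) (auto split: split_indicator)
  have "(\<integral>\<^sup>+x. f x * indicator X x - g x * indicator X x \<partial>M) = (\<integral>\<^sup>+x\<in>X. f x \<partial>M) - (\<integral>\<^sup>+x\<in>X. g x \<partial>M)"
    using gX by (intro nn_integral_diff) (auto simp: X_def split: split_indicator)
  also have "\<dots> = 0"
    by (rule diff_eq_0_ennreal) (use le[OF X] gX in auto)
  finally have "AE x in M. f x * indicator X x - g x * indicator X x = 0"
    by (subst (asm) nn_integral_0_iff_AE) auto
  with AE_space show ?thesis
  proof eventually_elim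
    case (elim x)
    then show ?case by (cases "x \<in> X") (auto simp: X_def dest: ennreal_minus_eq_0)
  qed
qed


text \<open>Countably many test sets suffice, so two measure-valued functions that agree almost everywhere on
each test set agree almost everywhere.\<close>

lemma finite_measure_eqI_rat_atMost:
  fixes \<mu> \<nu> :: "real measure"
  assumes "finite_measure \<mu>" and [simp]: "sets \<mu> = sets borel" "sets \<nu> = sets borel"
    and eq: "\<And>q::rat. emeasure \<mu> {..of_rat q} = emeasure \<nu> {..of_rat q}"
  shows "\<mu> = \<nu>"
proof (rule measure_eqI_generator_eq[where E="range (\<lambda>q::rat. {..of_rat q})" and \<Omega>=UNIV and A="\<lambda>n. {..of_rat (of_nat n)}"])
  interpret finite_measure \<mu> by fact
  show "Int_stable (range (\<lambda>q::rat. {..of_rat q :: real}))"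
  proof (rule Int_stableI, safe)
    fix q r :: rat
    have "{..of_rat q} \<inter> {..of_rat r} = {..(of_rat (min q r) :: real)}"
      by (auto simp: min_def of_rat_less_eq)
    then show "{..of_rat q} \<inter> {..of_rat r} \<in> range (\<lambda>q::rat. {..of_rat q :: real})" by auto
  qed
  show "sets \<mu> = sigma_sets UNIV (range (\<lambda>q::rat. {..of_rat q}))"
    "sets \<nu> = sigma_sets UNIV (range (\<lambda>q::rat. {..of_rat q}))"
    by (simp_all add: borel_eq_rat_atMost)
  show "(\<Union>n. {..(of_rat (of_nat n) :: real)}) = UNIV"
    by (auto intro: real_arch_simple)
  show "range (\<lambda>n::nat. {..of_rat (of_nat n) :: real}) \<subseteq> range (\<lambda>q::rat. {..of_rat q})"
    by (auto simp del: of_rat_of_nat_eq)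
  show "emeasure \<mu> {..of_rat (of_nat n)} \<noteq> \<infinity>" for n :: nat by simp
qed (use eq in auto)

lemma finite_measure_eqI_rectangles:
  assumes "finite_measure \<mu>" and [simp]: "sets \<mu> = sets (M \<Otimes>\<^sub>M N)" "sets \<nu> = sets (M \<Otimes>\<^sub>M N)"
    and eq: "\<And>X Y. X \<in> sets M \<Longrightarrow> Y \<in> sets N \<Longrightarrow> emeasure \<mu> (X \<times> Y) = emeasure \<nu> (X \<times> Y)"
  shows "\<mu> = \<nu>"
proof (rule measure_eqI_generator_eq[where E="{a \<times> b | a b. a \<in> sets M \<and> b \<in> sets N}"
      and \<Omega>="space M \<times> space N" and A="\<lambda>_. space M \<times> space N"])
  interpret finite_measure \<mu> by fact
  show "Int_stable {a \<times> b | a b. a \<in> sets M \<and> b \<in> sets N}"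
    by (rule Int_stable_pair_measure_generator)
  show "{a \<times> b |a b. a \<in> sets M \<and> b \<in> sets N} \<subseteq> Pow (space M \<times> space N)"
    by (auto dest: sets.sets_into_space)
  show "sets \<mu> = sigma_sets (space M \<times> space N) {a \<times> b |a b. a \<in> sets M \<and> b \<in> sets N}"
    "sets \<nu> = sigma_sets (space M \<times> space N) {a \<times> b |a b. a \<in> sets M \<and> b \<in> sets N}"
    by (simp_all add: sets_pair_measure)
  show "emeasure \<mu> (space M \<times> space N) \<noteq> \<infinity>" by simp
qed (use eq in auto)

lemma Radon_Nikodym_pushforward:
  fixes F :: "'a \<Rightarrow> ennreal"
  assumes "finite_measure A" and [measurable]: "\<pi> \<in> P \<rightarrow>\<^sub>M A" "F \<in> borel_measurable P"
    and ac: "\<And>X. X \<in> null_sets A \<Longrightarrow> AE z in P. \<pi> z \<notin> X"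
  obtains h where "h \<in> borel_measurable A" "density A h = distr (density P F) A \<pi>"
proof -
  interpret finite_measure A by fact
  have "absolutely_continuous A (distr (density P F) A \<pi>)"
    unfolding absolutely_continuous_def
  proof (rule subsetI)
    fix X assume X: "X \<in> null_sets A"
    then have [measurable]: "X \<in> sets A" by auto
    have "(\<integral>\<^sup>+z. F z * indicator (\<pi> -` X \<inter> space P) z \<partial>P) = (\<integral>\<^sup>+z. 0 \<partial>P)"
      using ac[OF X] by (intro nn_integral_cong_AE) (auto simp: indicator_def)
    then show "X \<in> null_sets (distr (density P F) A \<pi>)"
      by (simp add: null_sets_def emeasure_distr emeasure_density)
  qed
  from Radon_Nikodym[OF this] that show ?thesis by auto
qed

text \<open>The joint law of \<open>x\<close> and \<open>y\<close> when \<open>x\<close> has law \<open>M\<close> and \<open>K x\<close> is the conditional law of \<open>y\<close> given \<open>x\<close>.\<close>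

definition kernel_product :: "'a measure \<Rightarrow> 'b measure \<Rightarrow> ('a \<Rightarrow> 'b measure) \<Rightarrow> ('a \<times> 'b) measure" where
  "kernel_product M N K = M \<bind> (\<lambda>x. distr (K x) (M \<Otimes>\<^sub>M N) (Pair x))"

lemma measurable_kernel_section:
  assumes [measurable]: "K \<in> M \<rightarrow>\<^sub>M subprob_algebra N"
  shows "(\<lambda>x. distr (K x) (M \<Otimes>\<^sub>M N) (Pair x)) \<in> M \<rightarrow>\<^sub>M subprob_algebra (M \<Otimes>\<^sub>M N)"
  by (rule measurable_distr2[where M=N]) auto

lemma sets_kernel_product:
  assumes "K \<in> M \<rightarrow>\<^sub>M subprob_algebra N" "space M \<noteq> {}"
  shows "sets (kernel_product M N K) = sets (M \<Otimes>\<^sub>M N)"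
  unfolding kernel_product_def
  by (rule sets_bind[OF sets_kernel[OF measurable_kernel_section[OF assms(1)]] assms(2)])

lemma nn_integral_kernel_product:
  assumes [measurable]: "K \<in> M \<rightarrow>\<^sub>M subprob_algebra N" "f \<in> borel_measurable (M \<Otimes>\<^sub>M N)"
  shows "(\<integral>\<^sup>+z. f z \<partial>kernel_product M N K) = (\<integral>\<^sup>+x. \<integral>\<^sup>+y. f (x, y) \<partial>K x \<partial>M)"
  unfolding kernel_product_def
proof (subst nn_integral_bind[OF assms(2) measurable_kernel_section[OF assms(1)]], rule nn_integral_cong)
  fix x assume x: "x \<in> space M"
  then have "sets (K x) = sets N" using sets_kernel[OF assms(1)] by auto
  have "Pair x \<in> N \<rightarrow>\<^sub>M M \<Otimes>\<^sub>M N" using x by measurable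
  then have [measurable]: "Pair x \<in> K x \<rightarrow>\<^sub>M M \<Otimes>\<^sub>M N"
    by (simp add: measurable_cong_sets[OF \<open>sets (K x) = sets N\<close> refl])
  show "integral\<^sup>N (distr (K x) (M \<Otimes>\<^sub>M N) (Pair x)) f = (\<integral>\<^sup>+y. f (x, y) \<partial>K x)"
    by (rule nn_integral_distr) auto
qed

lemma emeasure_kernel_product_Times:
  assumes [measurable]: "K \<in> M \<rightarrow>\<^sub>M subprob_algebra N" "X \<in> sets M" "Y \<in> sets N" and ne: "space M \<noteq> {}"
  shows "emeasure (kernel_product M N K) (X \<times> Y) = (\<integral>\<^sup>+x\<in>X. emeasure (K x) Y \<partial>M)"
proof -
  have "emeasure (kernel_product M N K) (X \<times> Y) = (\<integral>\<^sup>+z. indicator (X \<times> Y) z \<partial>kernel_product M N K)"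
    by (simp add: sets_kernel_product[OF assms(1) ne])
  also have "\<dots> = (\<integral>\<^sup>+x. \<integral>\<^sup>+y. indicator (X \<times> Y) (x, y) \<partial>K x \<partial>M)"
    by (rule nn_integral_kernel_product) auto
  also have "\<dots> = (\<integral>\<^sup>+x\<in>X. emeasure (K x) Y \<partial>M)"
  proof (rule nn_integral_cong)
    fix x assume "x \<in> space M"
    then have "Y \<in> sets (K x)" using sets_kernel[OF assms(1)] by auto
    then show "(\<integral>\<^sup>+y. indicator (X \<times> Y) (x, y) \<partial>K x) = emeasure (K x) Y * indicator X x"
      by (auto simp: indicator_times split: split_indicator)
  qed
  finally show ?thesis .
qed


section \<open>Disintegration over the first factor\<close>

text \<open>The Radon--Nikodym density \<open>f q\<close> of \<open>X \<mapsto> \<mu> (X \<times> {..q})\<close> is the conditional distribution function at the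
rational point \<open>q\<close>. Outside a null set \<open>Z\<close> these functions of \<open>q\<close> extend to genuine distribution
functions; on \<open>Z\<close> any probability measure will do.\<close>

lemma disintegration_real:
  fixes \<mu> :: "('a \<times> real) measure"
  assumes M: "finite_measure M" and ne: "space M \<noteq> {}"
    and sets_\<mu>[measurable_cong, simp]: "sets \<mu> = sets (M \<Otimes>\<^sub>M borel)" and marg: "distr \<mu> M fst = M"
  obtains K where "K \<in> M \<rightarrow>\<^sub>M prob_algebra borel" "\<mu> = kernel_product M borel K"
proof -
  interpret finite_measure M by fact
  have space_\<mu>: "space \<mu> = space M \<times> UNIV"
    using sets_eq_imp_space_eq[OF sets_\<mu>] by (simp add: space_pair_measure)
  have \<mu>_fst: "emeasure \<mu> (X \<times> UNIV) = emeasure M X" if [measurable]: "X \<in> sets M" for X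
  proof -
    have "emeasure M X = emeasure (distr \<mu> M fst) X" by (simp add: marg)
    also have "\<dots> = emeasure \<mu> (X \<times> UNIV)"
      using sets.sets_into_space[OF that]
      by (subst emeasure_distr) (auto intro!: arg_cong[where f="emeasure \<mu>"] simp: space_\<mu>)
    finally show ?thesis ..
  qed
  have fin_\<mu>: "finite_measure \<mu>"
  proof (rule finite_measureI)
    show "emeasure \<mu> (space \<mu>) \<noteq> \<infinity>" using \<mu>_fst[of "space M"] by (simp add: space_\<mu>)
  qed
  interpret \<mu>: finite_measure \<mu> by fact
  have "\<exists>f. f \<in> borel_measurable M \<and> (\<forall>X\<in>sets M. (\<integral>\<^sup>+x\<in>X. f x \<partial>M) = emeasure \<mu> (X \<times> {..of_rat q}))" for q :: rat
  proof -
    have ac: "AE z in \<mu>. fst z \<notin> X" if X: "X \<in> null_sets M" for X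
    proof (rule AE_I[where N="X \<times> UNIV"])
      show "emeasure \<mu> (X \<times> UNIV) = 0" using X \<mu>_fst[OF null_setsD2[OF X]] by (simp add: null_setsD1)
      show "X \<times> UNIV \<in> sets \<mu>" using X by auto
    qed auto
    have F: "indicator (space M \<times> {..of_rat q :: real}) \<in> borel_measurable \<mu>" by simp
    obtain f where f[measurable]: "f \<in> borel_measurable M"
      and *: "density M f = distr (density \<mu> (\<lambda>z. indicator (space M \<times> {..of_rat q :: real}) z)) M fst"
      by (rule Radon_Nikodym_pushforward[OF M _ F ac]) auto
    have "(\<integral>\<^sup>+x\<in>X. f x \<partial>M) = emeasure \<mu> (X \<times> {..of_rat q})" if [measurable]: "X \<in> sets M" for X
    proof -
      have "(\<integral>\<^sup>+x\<in>X. f x \<partial>M) = emeasure (density M f) X" by (simp add: emeasure_density)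
      also have "\<dots> = (\<integral>\<^sup>+z. indicator (space M \<times> {..of_rat q :: real}) z * indicator (fst -` X \<inter> space \<mu>) z \<partial>\<mu>)"
      proof -
        have "fst -` X \<inter> space \<mu> \<in> sets \<mu>" by measurable
        then show ?thesis unfolding * using F by (simp add: emeasure_distr emeasure_density)
      qed
      also have "\<dots> = (\<integral>\<^sup>+z. indicator (X \<times> {..of_rat q}) z \<partial>\<mu>)"
        using sets.sets_into_space[OF that]
        by (intro nn_integral_cong) (auto simp: space_\<mu> split: split_indicator)
      also have "\<dots> = emeasure \<mu> (X \<times> {..of_rat q})" by simp
      finally show ?thesis .
    qed
    with f show ?thesis by blast
  qed
  then obtain f where f[measurable]: "\<And>q. f q \<in> borel_measurable M"
    and f_int: "\<And>q X. X \<in> sets M \<Longrightarrow> (\<integral>\<^sup>+x\<in>X. f q x \<partial>M) = emeasure \<mu> (X \<times> {..of_rat q})"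
    by metis
  have f_fin: "(\<integral>\<^sup>+x. f q x \<partial>M) < \<infinity>" for q
  proof -
    have "(\<integral>\<^sup>+x. f q x \<partial>M) = (\<integral>\<^sup>+x\<in>space M. f q x \<partial>M)" by (intro nn_integral_cong) auto
    also have "\<dots> < \<infinity>" by (subst f_int) (auto simp: less_top[symmetric])
    finally show ?thesis .
  qed
  have mono: "AE x in M. f q x \<le> f r x" if "q \<le> r" for q r
  proof (rule AE_leI_set_integral)
    have "{..of_rat q :: real} \<subseteq> {..of_rat r}" using that by (simp add: of_rat_less_eq)
    then show "(\<integral>\<^sup>+x\<in>X. f q x \<partial>M) \<le> (\<integral>\<^sup>+x\<in>X. f r x \<partial>M)" if "X \<in> sets M" for X
      using that by (simp add: f_int) (intro emeasure_mono, auto)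
  qed (use f_fin in auto)
  then have mono': "AE x in M. \<forall>q r. q \<le> r \<longrightarrow> f q x \<le> f r x"
    unfolding AE_all_countable by (intro allI AE_impI)
  \<comment> \<open>Continuity of the measure from above, used both for right continuity and for the limit
    at minus infinity.\<close>
  have inf: "AE x in M. (INF n::nat. f (s n) x) = g x"
    if s: "decseq s" and [measurable]: "g \<in> borel_measurable M"
      and g: "\<And>X. X \<in> sets M \<Longrightarrow> (\<integral>\<^sup>+x\<in>X. g x \<partial>M) = emeasure \<mu> (\<Inter>n. X \<times> {..of_rat (s n)})" for s g
  proof (rule density_unique_finite_measure)
    fix X assume [measurable]: "X \<in> sets M"
    have "(\<integral>\<^sup>+x. (INF n. f (s n) x) * indicator X x \<partial>M) = (\<integral>\<^sup>+x. (INF n. f (s n) x * indicator X x) \<partial>M)"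
      by (intro nn_integral_cong) (auto split: split_indicator)
    also have "\<dots> = (INF n. \<integral>\<^sup>+x. f (s n) x * indicator X x \<partial>M)"
    proof (rule nn_integral_monotone_convergence_INF_AE')
      show "AE x in M. f (s (Suc i)) x * indicator X x \<le> f (s i) x * indicator X x" for i
        using mono[of "s (Suc i)" "s i"] decseqD[OF s, of i "Suc i"] by (auto split: split_indicator)
      have "(\<integral>\<^sup>+x. f (s 0) x * indicator X x \<partial>M) \<le> (\<integral>\<^sup>+x. f (s 0) x \<partial>M)"
        by (intro nn_integral_mono) (auto split: split_indicator)
      then show "(\<integral>\<^sup>+x. f (s 0) x * indicator X x \<partial>M) < \<infinity>" using f_fin by (rule le_less_trans)
    qed auto
    also have "\<dots> = (INF n. emeasure \<mu> (X \<times> {..of_rat (s n)}))" by (simp add: f_int)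
    also have "\<dots> = emeasure \<mu> (\<Inter>n. X \<times> {..of_rat (s n)})"
    proof (rule INF_emeasure_decseq)
      have "{..of_rat (s n) :: real} \<subseteq> {..of_rat (s m)}" if "m \<le> n" for m n
        using decseqD[OF s that] by (simp add: of_rat_less_eq)
      then show "decseq (\<lambda>n. X \<times> {..of_rat (s n) :: real})"
        unfolding decseq_def by (intro allI impI Sigma_mono) auto
    qed auto
    also have "\<dots> = (\<integral>\<^sup>+x. g x * indicator X x \<partial>M)" by (simp add: g)
    finally show "(\<integral>\<^sup>+x. (INF n. f (s n) x) * indicator X x \<partial>M) = (\<integral>\<^sup>+x. g x * indicator X x \<partial>M)" .
  qed auto
  have right: "AE x in M. \<forall>q. (INF n::nat. f (q + 1 / of_nat (Suc n)) x) = f q x"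
    unfolding AE_all_countable
  proof
    fix q :: rat
    show "AE x in M. (INF n::nat. f (q + 1 / of_nat (Suc n)) x) = f q x"
    proof (rule inf)
      show "decseq (\<lambda>n::nat. q + 1 / of_nat (Suc n))"
        by (auto simp: decseq_def frac_le)
      have "(\<Inter>n::nat. {..of_rat (q + 1 / of_nat (Suc n))}) = {..of_rat q :: real}"
      proof (rule equalityI; rule subsetI)
        fix y :: real assume y: "y \<in> (\<Inter>n::nat. {..of_rat (q + 1 / of_nat (Suc n))})"
        show "y \<in> {..of_rat q}"
        proof (rule ccontr)
          assume "y \<notin> {..of_rat q}"
          then have "0 < y - of_rat q" by simp
          then obtain n where "1 / real (Suc n) < y - of_rat q" by (rule nat_approx_posE)
          moreover have "y \<le> of_rat q + 1 / real (Suc n)"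
          proof -
            have "y \<in> {..of_rat (q + 1 / of_nat (Suc n))}" using y by blast
            then show ?thesis by (simp only: atMost_iff of_rat_add of_rat_divide of_rat_1 of_rat_of_nat_eq)
          qed
          ultimately show False by simp
        qed
      next
        fix y :: real assume "y \<in> {..of_rat q}"
        then show "y \<in> (\<Inter>n::nat. {..of_rat (q + 1 / of_nat (Suc n))})"
          by (intro INT_I) (simp only: atMost_iff of_rat_add of_rat_divide of_rat_1 of_rat_of_nat_eq, simp add: add_increasing2)
      qed
      then have "(\<Inter>n::nat. X \<times> {..of_rat (q + 1 / of_nat (Suc n))}) = X \<times> {..of_rat q :: real}" for X :: "'a set"
        by blast
      then show "(\<integral>\<^sup>+x\<in>X. f q x \<partial>M) = emeasure \<mu> (\<Inter>n::nat. X \<times> {..of_rat (q + 1 / of_nat (Suc n))})"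
        if "X \<in> sets M" for X using that by (simp add: f_int)
    qed simp
  qed
  have bot: "AE x in M. (INF n::nat. f (- of_nat n) x) = 0"
  proof (rule inf)
    show "decseq (\<lambda>n::nat. - of_nat n :: rat)" by (auto simp: decseq_def)
    have "(\<Inter>n::nat. X \<times> {..of_rat (- of_nat n)}) = ({} :: ('a \<times> real) set)" for X :: "'a set"
    proof -
      have "\<exists>n::nat. \<not> y \<le> of_rat (- of_nat n)" for y :: real
      proof -
        obtain n :: nat where "- y < of_nat n" using reals_Archimedean2 by blast
        then show ?thesis by (intro exI[of _ n]) (simp add: of_rat_minus)
      qed
      then show ?thesis by blast
    qed
    then show "(\<integral>\<^sup>+x\<in>X. 0 \<partial>M) = emeasure \<mu> (\<Inter>n::nat. X \<times> {..of_rat (- of_nat n)})" for X by simp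
  qed simp
  have top: "AE x in M. (SUP n::nat. f (of_nat n) x) = 1"
  proof (rule density_unique_finite_measure)
    fix X assume [measurable]: "X \<in> sets M"
    have "(\<integral>\<^sup>+x. (SUP n::nat. f (of_nat n) x) * indicator X x \<partial>M) = (\<integral>\<^sup>+x. (SUP n::nat. f (of_nat n) x * indicator X x) \<partial>M)"
      by (intro nn_integral_cong) (auto split: split_indicator)
    also have "\<dots> = (SUP n::nat. \<integral>\<^sup>+x. f (of_nat n) x * indicator X x \<partial>M)"
    proof (rule nn_integral_monotone_convergence_SUP_AE)
      show "AE x in M. f (of_nat i) x * indicator X x \<le> f (of_nat (Suc i)) x * indicator X x" for i
        using mono[of "of_nat i" "of_nat (Suc i)"] by (auto split: split_indicator)
    qed auto
    also have "\<dots> = (SUP n::nat. emeasure \<mu> (X \<times> {..of_rat (of_nat n)}))" by (simp add: f_int del: of_rat_of_nat_eq)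
    also have "\<dots> = emeasure \<mu> (\<Union>n::nat. X \<times> {..of_rat (of_nat n)})"
      by (rule SUP_emeasure_incseq) (auto simp: incseq_def)
    also have "(\<Union>n::nat. X \<times> {..of_rat (of_nat n)}) = X \<times> (UNIV :: real set)"
      by (auto intro: real_arch_simple)
    also have "emeasure \<mu> \<dots> = (\<integral>\<^sup>+x. 1 * indicator X x \<partial>M)" by (simp add: \<mu>_fst)
    finally show "(\<integral>\<^sup>+x. (SUP n::nat. f (of_nat n) x) * indicator X x \<partial>M) = (\<integral>\<^sup>+x. 1 * indicator X x \<partial>M)" .
  qed auto
  from mono' right bot top
  have "AE x in M. (\<forall>q r. q \<le> r \<longrightarrow> f q x \<le> f r x) \<and> (\<forall>q. (INF n::nat. f (q + 1 / of_nat (Suc n)) x) = f q x) \<and>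
    (SUP n::nat. f (of_nat n) x) = 1 \<and> (INF n::nat. f (- of_nat n) x) = 0"
    by eventually_elim blast
  then obtain Z where good: "\<And>x. x \<in> space M - Z \<Longrightarrow>
    (\<forall>q r. q \<le> r \<longrightarrow> f q x \<le> f r x) \<and> (\<forall>q. (INF n::nat. f (q + 1 / of_nat (Suc n)) x) = f q x) \<and>
    (SUP n::nat. f (of_nat n) x) = 1 \<and> (INF n::nat. f (- of_nat n) x) = 0" and Z: "Z \<in> null_sets M"
  proof (rule AE_E3, goal_cases)
    case (1 N)
    then show ?case by (intro that[of N]) simp_all
  qed
  have "\<exists>\<nu>::real measure. prob_space \<nu> \<and> sets \<nu> = sets borel \<and> (\<forall>q. emeasure \<nu> {..of_rat q} = f q x)"
    if "x \<in> space M - Z" for x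
    using good[OF that] by (intro rational_cdf_extends) blast+
  then obtain \<nu> :: "'a \<Rightarrow> real measure" where \<nu>: "\<And>x. x \<in> space M - Z \<Longrightarrow> prob_space (\<nu> x)"
    "\<And>x. x \<in> space M - Z \<Longrightarrow> sets (\<nu> x) = sets borel"
    "\<And>x q. x \<in> space M - Z \<Longrightarrow> emeasure (\<nu> x) {..of_rat q} = f q x"
    by metis
  have [measurable]: "Z \<in> sets M" using Z by auto
  define K where "K x = (if x \<in> Z then return borel 0 else \<nu> x)" for x
  have K_rat: "emeasure (K x) {..of_rat q} = (if x \<in> Z then indicator {..of_rat q} (0::real) else f q x)"
    if "x \<in> space M" for x q
    using that \<nu>(3)[of x q] by (auto simp: K_def)
  have K: "K \<in> M \<rightarrow>\<^sub>M prob_algebra borel"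
  proof (rule measurable_prob_algebra_generated[where \<Omega>=UNIV and G="range (\<lambda>q::rat. {..of_rat q})"])
    show "sets borel = sigma_sets UNIV (range (\<lambda>q::rat. {..of_rat q :: real}))"
      by (simp add: borel_eq_rat_atMost)
    show "Int_stable (range (\<lambda>q::rat. {..of_rat q :: real}))"
    proof (rule Int_stableI, safe)
      fix q r :: rat
      have "{..of_rat q} \<inter> {..of_rat r} = {..(of_rat (min q r) :: real)}"
        by (auto simp: min_def of_rat_less_eq)
      then show "{..of_rat q} \<inter> {..of_rat r} \<in> range (\<lambda>q::rat. {..of_rat q :: real})" by auto
    qed
    show "prob_space (K a)" if "a \<in> space M" for a
      using that \<nu>(1)[of a] by (auto simp: K_def intro: prob_space_return)
    show "sets (K a) = sets borel" if "a \<in> space M" for a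
      using that \<nu>(2)[of a] by (auto simp: K_def)
    fix A assume "A \<in> range (\<lambda>q::rat. {..of_rat q :: real})"
    then obtain q :: rat where A: "A = {..of_rat q}" by auto
    show "(\<lambda>a. emeasure (K a) A) \<in> borel_measurable M"
      unfolding A by (subst measurable_cong[OF K_rat]) auto
  qed auto
  then have K'[measurable]: "K \<in> M \<rightarrow>\<^sub>M subprob_algebra borel" by (rule measurable_prob_algebraD)
  have "\<mu> = kernel_product M borel K"
  proof (rule finite_measure_eqI_rectangles[OF fin_\<mu> sets_\<mu> sets_kernel_product[OF K' ne]])
    fix X and Y :: "real set" assume X[measurable]: "X \<in> sets M" and Y[measurable]: "Y \<in> sets borel"
    have X_sub: "X \<subseteq> space M" using X by (rule sets.sets_into_space)
    define \<mu>X where "\<mu>X = distr (restrict_space \<mu> (X \<times> UNIV)) borel snd"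
    define KX where "KX = distr (restrict_space (kernel_product M borel K) (X \<times> UNIV)) borel snd"
    have sets_kp[measurable_cong]: "sets (kernel_product M borel K) = sets (M \<Otimes>\<^sub>M borel)"
      by (rule sets_kernel_product[OF K' ne])
    have e1: "emeasure \<mu>X Y = emeasure \<mu> (X \<times> Y)" if [measurable]: "Y \<in> sets borel" for Y
    proof -
      have "emeasure \<mu>X Y = emeasure (restrict_space \<mu> (X \<times> UNIV)) (snd -` Y \<inter> space (restrict_space \<mu> (X \<times> UNIV)))"
        unfolding \<mu>X_def by (rule emeasure_distr) (auto intro!: measurable_restrict_space1)
      also have "snd -` Y \<inter> space (restrict_space \<mu> (X \<times> UNIV)) = X \<times> Y"
        using X_sub by (auto simp: space_restrict_space space_\<mu>)
      finally show ?thesis by (subst (asm) emeasure_restrict_space) (auto intro!: sets.Int)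
    qed
    have e2: "emeasure KX Y = emeasure (kernel_product M borel K) (X \<times> Y)" if [measurable]: "Y \<in> sets borel" for Y
    proof -
      have "emeasure KX Y = emeasure (restrict_space (kernel_product M borel K) (X \<times> UNIV)) (snd -` Y \<inter> space (restrict_space (kernel_product M borel K) (X \<times> UNIV)))"
        unfolding KX_def by (rule emeasure_distr) (auto intro!: measurable_restrict_space1)
      also have "snd -` Y \<inter> space (restrict_space (kernel_product M borel K) (X \<times> UNIV)) = X \<times> Y"
        using X_sub sets_eq_imp_space_eq[OF sets_kp] by (auto simp: space_restrict_space space_pair_measure)
      finally show ?thesis by (subst (asm) emeasure_restrict_space) (auto intro!: sets.Int simp: sets_kp)
    qed
    have "\<mu>X = KX"
    proof (rule finite_measure_eqI_rat_atMost)
      show "finite_measure \<mu>X"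
        by (rule finite_measureI) (simp add: e1 \<mu>X_def[THEN arg_cong, of space])
      fix q :: rat
      have "emeasure \<mu>X {..of_rat q} = (\<integral>\<^sup>+x\<in>X. f q x \<partial>M)" by (simp add: e1 f_int)
      also have "\<dots> = (\<integral>\<^sup>+x\<in>X. emeasure (K x) {..of_rat q} \<partial>M)"
        using AE_not_in[OF Z] by (intro nn_integral_cong_AE) (auto simp: K_rat)
      also have "\<dots> = emeasure KX {..of_rat q}"
        by (simp add: e2 emeasure_kernel_product_Times[OF K' _ _ ne])
      finally show "emeasure \<mu>X {..of_rat q} = emeasure KX {..of_rat q}" .
    qed (simp_all add: \<mu>X_def KX_def)
    then show "emeasure \<mu> (X \<times> Y) = emeasure (kernel_product M borel K) (X \<times> Y)"
      using e1[OF Y] e2[OF Y] by simp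
  qed
  with K that show ?thesis by blast
qed

text \<open>Disintegrate the image of \<open>\<mu>\<close> on the line and push the kernel back along the retraction \<open>r\<close>.\<close>

lemma disintegration_retract:
  fixes \<mu> :: "('a \<times> 'b) measure" and i :: "'b \<Rightarrow> real"
  assumes M: "finite_measure M" and ne: "space M \<noteq> {}"
    and sets_\<mu>[measurable_cong, simp]: "sets \<mu> = sets (M \<Otimes>\<^sub>M N)" and marg: "distr \<mu> M fst = M"
    and i[measurable]: "i \<in> borel_measurable N" and r[measurable]: "r \<in> borel \<rightarrow>\<^sub>M N"
    and ri: "\<And>y. y \<in> space N \<Longrightarrow> r (i y) = y"
  obtains K where "K \<in> M \<rightarrow>\<^sub>M prob_algebra N" "\<mu> = kernel_product M N K"
proof -
  interpret finite_measure M by fact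
  have space_\<mu>: "space \<mu> = space M \<times> space N"
    using sets_eq_imp_space_eq[OF sets_\<mu>] by (simp add: space_pair_measure)
  have "emeasure \<mu> (space \<mu>) = emeasure (distr \<mu> M fst) (space M)"
    by (subst emeasure_distr) (auto intro!: arg_cong[where f="emeasure \<mu>"] simp: space_\<mu>)
  then have fin_\<mu>: "finite_measure \<mu>" by (intro finite_measureI) (simp add: marg)
  define \<mu>' where "\<mu>' = distr \<mu> (M \<Otimes>\<^sub>M borel) (\<lambda>(x, y). (x, i y))"
  have "distr \<mu>' M fst = distr \<mu> M (fst \<circ> (\<lambda>(x, y). (x, i y)))"
    unfolding \<mu>'_def by (rule distr_distr) measurable
  also have "fst \<circ> (\<lambda>(x, y). (x, i y)) = fst" by auto
  finally have "distr \<mu>' M fst = M" by (simp add: marg)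
  moreover have "sets \<mu>' = sets (M \<Otimes>\<^sub>M borel)" by (simp add: \<mu>'_def)
  ultimately obtain K where K: "K \<in> M \<rightarrow>\<^sub>M prob_algebra borel" and \<mu>': "\<mu>' = kernel_product M borel K"
    using disintegration_real[OF M ne] by blast
  have K'[measurable]: "K \<in> M \<rightarrow>\<^sub>M subprob_algebra borel" using K by (rule measurable_prob_algebraD)
  define Kr where "Kr x = distr (K x) N r" for x
  have Kr: "Kr \<in> M \<rightarrow>\<^sub>M prob_algebra N"
    unfolding Kr_def by (rule measurable_compose[OF K measurable_distr_prob_space[OF r]])
  then have Kr': "Kr \<in> M \<rightarrow>\<^sub>M subprob_algebra N" by (rule measurable_prob_algebraD)
  have "\<mu> = kernel_product M N Kr"
  proof (rule finite_measure_eqI_rectangles[OF fin_\<mu> sets_\<mu> sets_kernel_product[OF Kr' ne]])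
    fix X Y assume X[measurable]: "X \<in> sets M" and Y[measurable]: "Y \<in> sets N"
    have rY[measurable]: "r -` Y \<in> sets borel" using measurable_sets[OF r Y] by simp
    have "emeasure \<mu> (X \<times> Y) = emeasure \<mu>' (X \<times> (r -` Y))"
      unfolding \<mu>'_def using sets.sets_into_space[OF X] sets.sets_into_space[OF Y]
      by (subst emeasure_distr) (auto intro!: arg_cong[where f="emeasure \<mu>"] simp: space_\<mu> ri)
    also have "\<dots> = (\<integral>\<^sup>+x\<in>X. emeasure (K x) (r -` Y) \<partial>M)"
      unfolding \<mu>' by (rule emeasure_kernel_product_Times[OF K' X rY ne])
    also have "\<dots> = (\<integral>\<^sup>+x\<in>X. emeasure (Kr x) Y \<partial>M)"
    proof (rule nn_integral_cong)
      fix x assume "x \<in> space M"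
      then have s: "sets (K x) = sets borel" using sets_kernel[OF K'] by auto
      have "r \<in> K x \<rightarrow>\<^sub>M N" using r by (simp add: measurable_cong_sets[OF s refl])
      then have "emeasure (Kr x) Y = emeasure (K x) (r -` Y)"
        using sets_eq_imp_space_eq[OF s] by (simp add: Kr_def emeasure_distr)
      then show "emeasure (K x) (r -` Y) * indicator X x = emeasure (Kr x) Y * indicator X x" by simp
    qed
    also have "\<dots> = emeasure (kernel_product M N Kr) (X \<times> Y)"
      by (rule emeasure_kernel_product_Times[OF Kr' X Y ne, symmetric])
    finally show "emeasure \<mu> (X \<times> Y) = emeasure (kernel_product M N Kr) (X \<times> Y)" .
  qed
  with Kr that show ?thesis by blast
qed

lemma space_pos_borel[simp]: "space pos_borel = {0<..}"
  by (simp add: pos_borel_def space_restrict_space)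

lemma measurable_pos_borel_borel: "(\<lambda>x. x) \<in> borel_measurable pos_borel"
  unfolding pos_borel_def by (rule measurable_restrict_space1) simp

lemma measurable_ln_pos_borel: "ln \<in> borel_measurable pos_borel"
  unfolding pos_borel_def by (rule measurable_restrict_space1) simp

lemma measurable_exp_pos_borel: "exp \<in> borel \<rightarrow>\<^sub>M pos_borel"
  unfolding pos_borel_def by (rule measurable_restrict_space2) auto

lemma disintegration_pos_borel:
  assumes "finite_measure M" "space M \<noteq> {}" "sets \<mu> = sets (M \<Otimes>\<^sub>M pos_borel)" "distr \<mu> M fst = M"
  obtains K where "K \<in> M \<rightarrow>\<^sub>M prob_algebra pos_borel" "\<mu> = kernel_product M pos_borel K"
proof (rule disintegration_retract[OF assms measurable_ln_pos_borel measurable_exp_pos_borel])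
  show "exp (ln y) = y" if "y \<in> space pos_borel" for y :: real using that by simp
qed (rule that)

text \<open>The chain rule for conditional laws: first the law \<open>K1 b\<close> of \<open>x\<close> given \<open>b\<close>, then the law \<open>K2 (b, x)\<close> of \<open>s\<close>
given \<open>(b, x)\<close>.\<close>

lemma disintegration_real_pos_borel:
  fixes \<mu> :: "('a \<times> real \<times> real) measure"
  assumes M: "finite_measure M" and ne: "space M \<noteq> {}"
    and sets_\<mu>[measurable_cong, simp]: "sets \<mu> = sets (M \<Otimes>\<^sub>M borel \<Otimes>\<^sub>M pos_borel)" and marg: "distr \<mu> M fst = M"
  obtains K where "K \<in> M \<rightarrow>\<^sub>M prob_algebra (borel \<Otimes>\<^sub>M pos_borel)"
    "\<mu> = kernel_product M (borel \<Otimes>\<^sub>M pos_borel) K"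
proof -
  interpret finite_measure M by fact
  let ?N = "borel \<Otimes>\<^sub>M pos_borel :: (real \<times> real) measure"
  have space_\<mu>: "space \<mu> = space M \<times> space ?N"
    using sets_eq_imp_space_eq[OF sets_\<mu>] by (simp add: space_pair_measure)
  have "emeasure \<mu> (space \<mu>) = emeasure (distr \<mu> M fst) (space M)"
    by (subst emeasure_distr) (auto intro!: arg_cong[where f="emeasure \<mu>"] simp: space_\<mu>)
  then have fin_\<mu>: "finite_measure \<mu>" by (intro finite_measureI) (simp add: marg)
  then interpret \<mu>: finite_measure \<mu> .
  define \<mu>1 where "\<mu>1 = distr \<mu> (M \<Otimes>\<^sub>M borel) (\<lambda>(b, x, s). (b, x))"
  define \<mu>2 where "\<mu>2 = distr \<mu> ((M \<Otimes>\<^sub>M borel) \<Otimes>\<^sub>M pos_borel) (\<lambda>(b, x, s). ((b, x), s))"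
  have "distr \<mu>1 M fst = distr \<mu> M (fst \<circ> (\<lambda>(b, x, s). (b, x)))"
    unfolding \<mu>1_def by (rule distr_distr) measurable
  also have "fst \<circ> (\<lambda>(b, x, s). (b, x)) = fst" by auto
  finally have "distr \<mu>1 M fst = M" by (simp add: marg)
  moreover have sets_\<mu>1[measurable_cong, simp]: "sets \<mu>1 = sets (M \<Otimes>\<^sub>M borel)" by (simp add: \<mu>1_def)
  ultimately obtain K1 where K1: "K1 \<in> M \<rightarrow>\<^sub>M prob_algebra borel" and \<mu>1: "\<mu>1 = kernel_product M borel K1"
    using disintegration_real[OF M ne] by blast
  have K1'[measurable]: "K1 \<in> M \<rightarrow>\<^sub>M subprob_algebra borel" using K1 by (rule measurable_prob_algebraD)
  have "distr \<mu>2 \<mu>1 fst = distr \<mu> \<mu>1 (fst \<circ> (\<lambda>(b, x, s). ((b, x), s)))"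
    unfolding \<mu>2_def by (rule distr_distr) measurable
  also have "fst \<circ> (\<lambda>(b, x, s). ((b, x), s)) = (\<lambda>(b, x, s). (b, x))" by auto
  also have "distr \<mu> \<mu>1 (\<lambda>(b, x, s). (b, x)) = \<mu>1"
    unfolding \<mu>1_def by (rule distr_cong) auto
  finally have "distr \<mu>2 \<mu>1 fst = \<mu>1" .
  moreover have "sets \<mu>2 = sets (\<mu>1 \<Otimes>\<^sub>M pos_borel)"
    unfolding \<mu>2_def sets_distr by (rule sets_pair_measure_cong) auto
  moreover have "finite_measure \<mu>1"
    unfolding \<mu>1_def by (rule \<mu>.finite_measure_distr) measurable
  moreover have "space \<mu>1 \<noteq> {}" using ne by (simp add: \<mu>1_def space_pair_measure)
  ultimately obtain K2 where K2: "K2 \<in> \<mu>1 \<rightarrow>\<^sub>M prob_algebra pos_borel" and \<mu>2: "\<mu>2 = kernel_product \<mu>1 pos_borel K2"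
    using disintegration_pos_borel by blast
  have K2[measurable]: "K2 \<in> M \<Otimes>\<^sub>M borel \<rightarrow>\<^sub>M prob_algebra pos_borel"
    using K2 by (simp add: measurable_cong_sets[OF sets_\<mu>1 refl])
  have K2'[measurable]: "K2 \<in> M \<Otimes>\<^sub>M borel \<rightarrow>\<^sub>M subprob_algebra pos_borel" using K2 by (rule measurable_prob_algebraD)
  define g where "g b x = distr (K2 (b, x)) ?N (Pair x)" for b x
  have g: "case_prod g \<in> M \<Otimes>\<^sub>M borel \<rightarrow>\<^sub>M prob_algebra ?N"
    unfolding g_def case_prod_beta prod.collapse
    by (rule measurable_distr_prob_space2[OF K2]) measurable
  then have g'[measurable]: "case_prod g \<in> M \<Otimes>\<^sub>M borel \<rightarrow>\<^sub>M subprob_algebra ?N" by (rule measurable_prob_algebraD)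
  define K where "K b = K1 b \<bind> g b" for b
  have K: "K \<in> M \<rightarrow>\<^sub>M prob_algebra ?N"
    unfolding K_def by (rule measurable_bind_prob_space2[OF K1 g])
  then have K'[measurable]: "K \<in> M \<rightarrow>\<^sub>M subprob_algebra ?N" by (rule measurable_prob_algebraD)
  have K_int: "(\<integral>\<^sup>+z. f z \<partial>K b) = (\<integral>\<^sup>+x. \<integral>\<^sup>+s. f (x, s) \<partial>K2 (b, x) \<partial>K1 b)"
    if b: "b \<in> space M" and f[measurable]: "f \<in> borel_measurable ?N" for f b
  proof -
    have s1: "sets (K1 b) = sets borel" using b sets_kernel[OF K1'] by auto
    have "g b \<in> borel \<rightarrow>\<^sub>M subprob_algebra ?N" using b by measurable
    then have "g b \<in> K1 b \<rightarrow>\<^sub>M subprob_algebra ?N" by (simp add: measurable_cong_sets[OF s1 refl])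
    then have "(\<integral>\<^sup>+z. f z \<partial>K b) = (\<integral>\<^sup>+x. \<integral>\<^sup>+z. f z \<partial>g b x \<partial>K1 b)"
      unfolding K_def by (rule nn_integral_bind[OF f])
    also have "\<dots> = (\<integral>\<^sup>+x. \<integral>\<^sup>+s. f (x, s) \<partial>K2 (b, x) \<partial>K1 b)"
    proof (rule nn_integral_cong)
      fix x
      have s2: "sets (K2 (b, x)) = sets pos_borel" using b sets_kernel[OF K2'] by (auto simp: space_pair_measure)
      have "Pair x \<in> K2 (b, x) \<rightarrow>\<^sub>M ?N" by (simp add: measurable_cong_sets[OF s2 refl])
      then show "(\<integral>\<^sup>+z. f z \<partial>g b x) = (\<integral>\<^sup>+s. f (x, s) \<partial>K2 (b, x))"
        unfolding g_def by (rule nn_integral_distr) simp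
    qed
    finally show ?thesis .
  qed
  have "\<mu> = kernel_product M ?N K"
  proof (rule finite_measure_eqI_rectangles[OF fin_\<mu> sets_\<mu> sets_kernel_product[OF K' ne]])
    fix X Y assume X[measurable]: "X \<in> sets M" and Y[measurable]: "Y \<in> sets ?N"
    have K2_space: "K2 \<in> \<mu>1 \<rightarrow>\<^sub>M subprob_algebra pos_borel"
      using K2' by (simp add: measurable_cong_sets[OF sets_\<mu>1 refl])
    have "emeasure (kernel_product M ?N K) (X \<times> Y) = (\<integral>\<^sup>+b\<in>X. emeasure (K b) Y \<partial>M)"
      by (rule emeasure_kernel_product_Times[OF K' X Y ne])
    also have "\<dots> = (\<integral>\<^sup>+b. \<integral>\<^sup>+x. (\<integral>\<^sup>+s. indicator X b * indicator Y (x, s) \<partial>K2 (b, x)) \<partial>K1 b \<partial>M)"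
    proof (rule nn_integral_cong)
      fix b assume b: "b \<in> space M"
      have "emeasure (K b) Y = (\<integral>\<^sup>+z. indicator Y z \<partial>K b)"
        using sets_kernel[OF K' b] Y by simp
      also have "\<dots> = (\<integral>\<^sup>+x. \<integral>\<^sup>+s. indicator Y (x, s) \<partial>K2 (b, x) \<partial>K1 b)" by (rule K_int[OF b]) simp
      finally show "emeasure (K b) Y * indicator X b = (\<integral>\<^sup>+x. (\<integral>\<^sup>+s. indicator X b * indicator Y (x, s) \<partial>K2 (b, x)) \<partial>K1 b)"
        by (auto split: split_indicator)
    qed
    also have "\<dots> = (\<integral>\<^sup>+z. (\<integral>\<^sup>+s. indicator X (fst z) * indicator Y (snd z, s) \<partial>K2 z) \<partial>\<mu>1)"
      unfolding \<mu>1
      by (subst nn_integral_kernel_product[OF K1']) (auto intro!: nn_integral_measurable_subprob_algebra2[where N=pos_borel])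
    also have "\<dots> = (\<integral>\<^sup>+z. indicator X (fst (fst z)) * indicator Y (snd (fst z), snd z) \<partial>\<mu>2)"
      unfolding \<mu>2 by (subst nn_integral_kernel_product[OF K2_space]) auto
    also have "\<dots> = (\<integral>\<^sup>+z. indicator (X \<times> Y) z \<partial>\<mu>)"
      unfolding \<mu>2_def
      by (subst nn_integral_distr, measurable, rule nn_integral_cong) (auto split: split_indicator)
    also have "\<dots> = emeasure \<mu> (X \<times> Y)" by simp
    finally show "emeasure \<mu> (X \<times> Y) = emeasure (kernel_product M ?N K) (X \<times> Y)" ..
  qed
  with K that show ?thesis by blast
qed

section \<open>Coding a Lebesgue space by real numbers\<close>

text \<open>A segment and countably many atoms fit side by side into the line, and the isomorphism carries \<open>C\<close>
there. The decoding \<open>\<psi>\<close> can be measurable only for the completion of the code's law, since \<open>C\<close> may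
have as many measurable sets as the Lebesgue \<open>\<sigma>\<close>-algebra.\<close>

lemma lebesgue_space_coding:
  assumes "lebesgue_space C"
  obtains \<phi> :: "'c \<Rightarrow> real" and \<psi> where "\<phi> \<in> borel_measurable C"
    "\<psi> \<in> completion (distr C borel \<phi>) \<rightarrow>\<^sub>M C" "AE c in C. \<psi> (\<phi> c) = c"
proof -
  obtain l r :: real and J :: "nat set" and w where pos: "0 < emeasure C (space C)"
    and iso: "iso_mod_0 (completion C) (sum_measure (lebesgue_on {l..r}) (point_measure J w))"
    using assms unfolding lebesgue_space_def by blast
  define N where "N = sum_measure (lebesgue_on {l..r}) (point_measure J w)"
  obtain X Y f where X: "X \<in> null_sets (completion C)" and Y: "Y \<in> null_sets N"
    and iso': "let M' = restrict_space (completion C) (space (completion C) - X); N' = restrict_space N (space N - Y) in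
          bij_betw f (space M') (space N') \<and> f \<in> measurable M' N' \<and>
          the_inv_into (space M') f \<in> measurable N' M' \<and> distr M' N' f = N'"
    using iso unfolding iso_mod_0_def N_def by blast
  define M' where "M' = restrict_space (completion C) (space C - X)"
  define N' where "N' = restrict_space N (space N - Y)"
  define g where "g = the_inv_into (space M') f"
  have bij: "bij_betw f (space M') (space N')" and f[measurable]: "f \<in> M' \<rightarrow>\<^sub>M N'"
    and g[measurable]: "g \<in> N' \<rightarrow>\<^sub>M M'" and dist: "distr M' N' f = N'"
    using iso' by (simp_all add: Let_def M'_def N'_def g_def)
  have [measurable]: "X \<in> sets (completion C)" using X by auto
  have [measurable]: "Y \<in> sets N" using Y by auto
  have "space C - X \<in> sets (completion C)" using X sets.compl_sets[of X "completion C"] by auto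
  moreover have "(space C - X) \<inter> space C = space C - X" by auto
  ultimately have CX[simp]: "(space C - X) \<inter> space C \<in> sets (completion C)" by simp
  have space_M': "space M' = space C - X" by (auto simp: M'_def space_restrict_space)
  have space_N': "space N' = space N - Y" by (auto simp: N'_def space_restrict_space)
  have sets_N: "sets N = {E. E \<subseteq> {l..r} <+> J \<and> Inl -` E \<in> sets (lebesgue_on {l..r}) \<and> Inr -` E \<subseteq> J}"
    by (simp add: N_def sets_sum_measure sets_point_measure space_point_measure)
  have space_N: "space N = {l..r} <+> J"
  proof (rule equalityI)
    show "space N \<subseteq> {l..r} <+> J" using sets.top[of N] unfolding sets_N by blast
    have "Inl -` ({l..r} <+> J) = {l..r}" "Inr -` ({l..r} <+> J) = J" by auto
    then have "{l..r} <+> J \<in> sets N"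
      unfolding sets_N using sets.top[of "lebesgue_on {l..r}"] by simp
    then show "{l..r} <+> J \<subseteq> space N" by (rule sets.sets_into_space)
  qed
  \<comment> \<open>The atom with index n is placed at r + 1 + n, to the right of the segment; d undoes this.\<close>
  define e :: "real + nat \<Rightarrow> real" where "e = case_sum (\<lambda>x. x) (\<lambda>n. r + 1 + real n)"
  define d :: "real \<Rightarrow> real + nat" where "d y = (if y \<le> r then Inl y else Inr (nat \<lfloor>y - r - 1\<rfloor>))" for y
  have de: "d (e z) = z" if "z \<in> space N" for z
    using that by (auto simp: space_N e_def d_def)
  have e[measurable]: "e \<in> borel_measurable N"
  proof (rule measurableI)
    fix E :: "real set" assume E: "E \<in> sets borel"
    have "Inl -` (e -` E \<inter> space N) = E \<inter> {l..r}" "Inr -` (e -` E \<inter> space N) \<subseteq> J"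
      by (auto simp: e_def space_N)
    moreover have "E \<inter> {l..r} \<in> sets (lebesgue_on {l..r})"
      using E by (auto simp: sets_restrict_space)
    ultimately show "e -` E \<inter> space N \<in> sets N" unfolding sets_N using space_N by auto
  qed simp
  then have [measurable]: "e \<in> borel_measurable N'"
    unfolding N'_def by (rule measurable_restrict_space1)
  have [measurable]: "(\<lambda>c. e (f c)) \<in> borel_measurable M'" by measurable
  define \<phi>\<^sub>0 where "\<phi>\<^sub>0 c = indicator (space C - X) c *\<^sub>R e (f c)" for c
  have "\<phi>\<^sub>0 \<in> borel_measurable (completion C)"
    unfolding \<phi>\<^sub>0_def
    by (subst borel_measurable_restrict_space_iff[symmetric]) (auto simp: M'_def[symmetric])
  then obtain \<phi> where \<phi>[measurable]: "\<phi> \<in> borel_measurable C" and \<phi>\<phi>\<^sub>0: "AE c in C. \<phi>\<^sub>0 c = \<phi> c"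
    using completion_ex_borel_measurable_real by blast
  have AE_M': "AE c in C. c \<in> space M' \<and> \<phi> c = e (f c)"
  proof -
    have "AE c in C. c \<notin> X" using AE_not_in[OF X] by (simp add: AE_completion_iff)
    with \<phi>\<phi>\<^sub>0 AE_space show ?thesis
      by eventually_elim (auto simp: \<phi>\<^sub>0_def space_M')
  qed
  have "space C \<noteq> {}" using pos by auto
  then obtain c\<^sub>0 where c\<^sub>0: "c\<^sub>0 \<in> space C" by blast
  define \<psi> where "\<psi> y = (if d y \<in> space N' then g (d y) else c\<^sub>0)" for y
  define D where "D = distr C borel \<phi>"
  \<comment> \<open>The restriction to the segment matters: a Lebesgue null set may contain codes of atoms.\<close>
  have null_D: "Z \<in> null_sets D" if Z: "Z \<in> null_sets lborel" and Zlr: "Z \<subseteq> {l..r}" for Z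
  proof -
    have Z'[measurable]: "Z \<in> sets borel" using Z by auto
    have v: "Inl -` (Inl ` Z) = Z" "Inr -` (Inl ` Z :: (real + nat) set) = {}" by auto
    have Zl: "Z \<in> null_sets (lebesgue_on {l..r})"
      using Z Zlr by (simp add: null_sets_restrict_space null_sets_completionI)
    then have IZ: "Inl ` Z \<in> sets N" unfolding sets_N using Zlr by (auto simp: v)
    have "emeasure N (Inl ` Z) = 0"
      using IZ Zl unfolding N_def by (subst emeasure_sum_measure) (auto simp: v)
    with IZ have "Inl ` Z \<in> null_sets N" by auto
    then have "AE z in N. z \<notin> Inl ` Z" by (rule AE_not_in)
    then have "AE z in N'. z \<notin> Inl ` Z"
      unfolding N'_def by (subst AE_restrict_space_iff) auto
    then have "AE z in distr M' N' f. z \<notin> Inl ` Z" unfolding dist .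
    then have "AE c in M'. f c \<notin> Inl ` Z" by (rule AE_distrD[OF f])
    then have "AE c in completion C. c \<in> space C - X \<longrightarrow> f c \<notin> Inl ` Z"
      unfolding M'_def by (subst (asm) AE_restrict_space_iff) auto
    then have "AE c in C. c \<in> space C - X \<longrightarrow> f c \<notin> Inl ` Z" by (simp add: AE_completion_iff)
    with AE_M' have "AE c in C. \<phi> c \<notin> Z"
    proof eventually_elim
      case (elim c)
      then have "f c \<in> space N" using bij_betwE[OF bij] space_N' by auto
      with elim Zlr show ?case by (auto simp: space_N e_def space_M')
    qed
    then show ?thesis
      unfolding D_def null_sets_def by (auto simp: emeasure_distr AE_iff_measurable[OF _ refl] vimage_def Int_def conj_commute)
  qed
  have d_sets: "d -` L \<in> sets (completion D)" if L: "L \<in> sets N" for L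
  proof -
    have L1: "Inl -` L \<in> sets (lebesgue_on {l..r})" using L unfolding sets_N by auto
    then have L1_sub: "Inl -` L \<subseteq> {l..r}" using sets.sets_into_space[OF L1] by simp
    have "Inl -` L \<in> sets lebesgue" using L1 by (auto simp: sets_restrict_space intro!: sets.Int)
    then obtain S Z Z' where S: "Inl -` L = S \<union> Z" "Z \<subseteq> Z'" "Z' \<in> null_sets lborel" "S \<in> sets lborel"
      by (rule sets_completionE)
    have "Z' \<inter> {l..r} \<in> null_sets D"
      using S(3) by (intro null_D) (auto intro: null_set_Int2)
    then have "Inl -` L \<in> sets (completion D)"
      using S L1_sub by (intro sets_completionI[of _ S Z "Z' \<inter> {l..r}"]) (auto simp: D_def)
    moreover have "{y. r < y \<and> nat \<lfloor>y - r - 1\<rfloor> \<in> Inr -` L} \<in> sets (completion D)"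
      by (rule sets_completionI_sets) (simp add: D_def)
    moreover have "d -` L = Inl -` L \<union> {y. r < y \<and> nat \<lfloor>y - r - 1\<rfloor> \<in> Inr -` L}"
      using L1_sub by (auto simp: d_def split: if_splits)
    ultimately show ?thesis by auto
  qed
  have "\<psi> \<in> completion D \<rightarrow>\<^sub>M C"
  proof (rule measurableI)
    show "\<psi> y \<in> space C" for y
      using c\<^sub>0 measurable_space[OF g, of "d y"] by (auto simp: \<psi>_def space_M')
  next
    fix K assume K: "K \<in> sets C"
    have "K \<inter> space M' \<in> sets M'"
      using K unfolding M'_def by (auto simp: sets_restrict_space space_restrict_space)
    then have "g -` (K \<inter> space M') \<inter> space N' \<in> sets N'" by (rule measurable_sets[OF g])
    then have L: "g -` (K \<inter> space M') \<inter> space N' \<in> sets N"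
      unfolding N'_def by (auto simp: sets_restrict_space)
    have N'_N: "space N' \<in> sets N" unfolding space_N' by auto
    have "\<psi> -` K \<inter> space (completion D) = d -` (g -` (K \<inter> space M') \<inter> space N') \<union>
        (if c\<^sub>0 \<in> K then UNIV - d -` space N' else {})"
      using measurable_space[OF g] by (auto simp: \<psi>_def D_def split: if_splits)
    also have "\<dots> \<in> sets (completion D)"
      using d_sets[OF L] d_sets[OF N'_N] sets.compl_sets[OF d_sets[OF N'_N]] by (auto simp: D_def)
    finally show "\<psi> -` K \<inter> space (completion D) \<in> sets (completion D)" .
  qed
  moreover have "AE c in C. \<psi> (\<phi> c) = c"
    using AE_M'
  proof eventually_elim
    case (elim c)
    then have "f c \<in> space N'" using bij_betwE[OF bij] by auto
    moreover from this have "d (e (f c)) = f c" using space_N' by (intro de) auto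
    moreover have "g (f c) = c"
      unfolding g_def using elim bij by (intro the_inv_into_f_f) (auto simp: bij_betw_def)
    ultimately show ?case using elim by (simp add: \<psi>_def)
  qed
  ultimately show ?thesis using \<phi> that unfolding D_def by blast
qed

lemma measurable_pos_borelD: "f \<in> M \<rightarrow>\<^sub>M pos_borel \<Longrightarrow> f \<in> borel_measurable M"
  using measurable_compose[OF _ measurable_pos_borel_borel, of f M] by simp

section \<open>Polymorphisms and their blocks\<close>

lemma measurable_mult_pos_borel:
  assumes "f \<in> M \<rightarrow>\<^sub>M pos_borel" "g \<in> M \<rightarrow>\<^sub>M pos_borel"
  shows "(\<lambda>x. f x * g x) \<in> M \<rightarrow>\<^sub>M pos_borel"
  unfolding pos_borel_def
proof (rule measurable_restrict_space2)
  show "(\<lambda>x. f x * g x) \<in> space M \<rightarrow> {0<..}"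
    using measurable_space[OF assms(1)] measurable_space[OF assms(2)] by auto
  show "(\<lambda>x. f x * g x) \<in> borel_measurable M"
    using assms[THEN measurable_pos_borelD] by measurable
qed

lemma sets_Pol: "P \<in> Pol A B \<Longrightarrow> sets P = sets (A \<Otimes>\<^sub>M B \<Otimes>\<^sub>M pos_borel)"
  by (simp add: Pol_def)

lemma space_Pol: "P \<in> Pol A B \<Longrightarrow> space P = space A \<times> space B \<times> {0<..}"
  using sets_eq_imp_space_eq[OF sets_Pol] by (simp add: space_pair_measure)

lemma measurable_Pol:
  assumes "P \<in> Pol A B"
  shows "fst \<in> P \<rightarrow>\<^sub>M A" "(\<lambda>z. fst (snd z)) \<in> P \<rightarrow>\<^sub>M B" "(\<lambda>z. snd (snd z)) \<in> P \<rightarrow>\<^sub>M pos_borel"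
    "(\<lambda>z. snd (snd z)) \<in> borel_measurable P"
proof -
  show "fst \<in> P \<rightarrow>\<^sub>M A" "(\<lambda>z. fst (snd z)) \<in> P \<rightarrow>\<^sub>M B" and t: "(\<lambda>z. snd (snd z)) \<in> P \<rightarrow>\<^sub>M pos_borel"
    by (simp_all add: measurable_cong_sets[OF sets_Pol[OF assms] refl])
  show "(\<lambda>z. snd (snd z)) \<in> borel_measurable P" using t by (rule measurable_pos_borelD)
qed

lemma distr_Pol_fst: "P \<in> Pol A B \<Longrightarrow> distr P A fst = A"
proof -
  assume "P \<in> Pol A B"
  moreover have "(\<lambda>(a, b, t). a) = (fst :: 'a \<times> 'b \<times> real \<Rightarrow> 'a)" by auto
  ultimately show ?thesis by (simp add: Pol_def)
qed

lemma nn_integral_Pol_fst: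
  assumes "P \<in> Pol A B" "f \<in> borel_measurable A"
  shows "(\<integral>\<^sup>+z. f (fst z) \<partial>P) = (\<integral>\<^sup>+a. f a \<partial>A)"
  by (subst distr_Pol_fst[OF assms(1), symmetric], rule nn_integral_distr[symmetric])
     (use measurable_Pol[OF assms(1)] assms(2) in auto)

lemma nn_integral_Pol_snd:
  assumes P: "P \<in> Pol A B" and f[measurable]: "f \<in> borel_measurable B"
  shows "(\<integral>\<^sup>+z. ennreal (snd (snd z)) * f (fst (snd z)) \<partial>P) = (\<integral>\<^sup>+b. f b \<partial>B)"
proof -
  note [measurable] = measurable_Pol[OF P]
  have e: "(\<lambda>(a, b, t). b) = (\<lambda>z. fst (snd z) :: 'b)" "(\<lambda>(a, b, t). ennreal t) = (\<lambda>z. ennreal (snd (snd z)))"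
    by auto
  have "distr (density P (\<lambda>z. ennreal (snd (snd z)))) B (\<lambda>z. fst (snd z)) = B"
    using P by (simp add: Pol_def e)
  then have "(\<integral>\<^sup>+b. f b \<partial>B) = (\<integral>\<^sup>+b. f b \<partial>distr (density P (\<lambda>z. ennreal (snd (snd z)))) B (\<lambda>z. fst (snd z)))"
    by simp
  also have "\<dots> = (\<integral>\<^sup>+z. f (fst (snd z)) \<partial>density P (\<lambda>z. ennreal (snd (snd z))))"
    by (rule nn_integral_distr) auto
  also have "\<dots> = (\<integral>\<^sup>+z. ennreal (snd (snd z)) * f (fst (snd z)) \<partial>P)"
    by (rule nn_integral_density) auto
  finally show ?thesis ..
qed

lemma AE_Pol_fst:
  assumes "P \<in> Pol A B" "AE a in A. p a"
  shows "AE z in P. p (fst z)"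
proof (rule AE_distrD[OF measurable_Pol(1)[OF assms(1)]])
  show "AE a in distr P A fst. p a" using assms(2) unfolding distr_Pol_fst[OF assms(1)] .
qed

text \<open>The marginal condition on \<open>B\<close> concerns \<open>t \<cdot> P\<close>, but \<open>t > 0\<close>, so \<open>P\<close> and \<open>t \<cdot> P\<close> have the same null sets.\<close>

lemma AE_Pol_snd:
  assumes P: "P \<in> Pol A B" and ae: "AE b in B. p b"
  shows "AE z in P. p (fst (snd z))"
proof -
  note [measurable] = measurable_Pol[OF P]
  obtain X where X: "\<And>b. b \<in> space B - X \<Longrightarrow> p b" "X \<in> null_sets B" using AE_E3[OF ae] by metis
  then have [measurable]: "X \<in> sets B" by auto
  have "(\<integral>\<^sup>+z. ennreal (snd (snd z)) * indicator X (fst (snd z)) \<partial>P) = emeasure B X"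
    by (subst nn_integral_Pol_snd[OF P]) auto
  also have "\<dots> = 0" using X by auto
  finally have "AE z in P. ennreal (snd (snd z)) * indicator X (fst (snd z)) = 0"
    by (subst (asm) nn_integral_0_iff_AE) auto
  with AE_space show ?thesis
    by eventually_elim (use X(1) in \<open>auto simp: space_Pol[OF P] indicator_def ennreal_eq_0_iff split: if_splits\<close>)
qed

lemma finite_measure_Pol:
  assumes P: "P \<in> Pol A B" and "finite_measure A"
  shows "finite_measure P"
proof (rule finite_measureI)
  interpret finite_measure A by fact
  have "emeasure P (space P) = (\<integral>\<^sup>+z. 1 \<partial>P)" by simp
  also have "\<dots> = emeasure A (space A)" by (subst nn_integral_Pol_fst[OF P]) auto
  finally show "emeasure P (space P) \<noteq> \<infinity>" by simp
qed

lemma emeasure_pol_block: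
  assumes P: "P \<in> Pol A B" and M: "M \<in> sets A" and N: "N \<in> sets B" and S: "S \<in> sets pos_borel"
  shows "emeasure (pol_block P M N) S = (\<integral>\<^sup>+z. indicator M (fst z) * indicator N (fst (snd z)) * indicator S (snd (snd z)) \<partial>P)"
proof -
  note [measurable] = M N S measurable_Pol[OF P]
  have e: "(\<lambda>(a, b, t). t) = (\<lambda>z. snd (snd z) :: real)" by auto
  have "M \<times> N \<times> {0<..} \<in> sets P"
    unfolding sets_Pol[OF P] using M N sets.top[of pos_borel] by (intro pair_measureI) auto
  then have R: "M \<times> N \<times> {0<..} \<inter> space P \<in> sets P" by auto
  have S': "M \<times> N \<times> S \<in> sets P" unfolding sets_Pol[OF P] by (intro pair_measureI) auto
  have "emeasure (pol_block P M N) S = emeasure (restrict_space P (M \<times> N \<times> {0<..}))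
      ((\<lambda>z. snd (snd z)) -` S \<inter> space (restrict_space P (M \<times> N \<times> {0<..})))"
    unfolding pol_block_def e space_pos_borel by (rule emeasure_distr) (auto intro!: measurable_restrict_space1)
  also have "(\<lambda>z. snd (snd z)) -` S \<inter> space (restrict_space P (M \<times> N \<times> {0<..})) = M \<times> N \<times> S"
    using sets.sets_into_space[OF M] sets.sets_into_space[OF N] sets.sets_into_space[OF S]
    by (auto simp: space_restrict_space space_Pol[OF P])
  also have "emeasure (restrict_space P (M \<times> N \<times> {0<..})) (M \<times> N \<times> S) = emeasure P (M \<times> N \<times> S)"
    using R sets.sets_into_space[OF S] by (intro emeasure_restrict_space) auto
  also have "\<dots> = (\<integral>\<^sup>+z. indicator (M \<times> N \<times> S) z \<partial>P)" using S' by simp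
  also have "\<dots> = (\<integral>\<^sup>+z. indicator M (fst z) * indicator N (fst (snd z)) * indicator S (snd (snd z)) \<partial>P)"
    by (rule nn_integral_cong) (auto split: split_indicator)
  finally show ?thesis .
qed

text \<open>The products \<open>M \<times> N \<times> S\<close> form an intersection-stable generator, and blocks are the values on them.\<close>

lemma Pol_eqI:
  assumes P: "P \<in> Pol A B" and P': "P' \<in> Pol A B" and A: "finite_measure A"
    and eq: "\<And>M N S. M \<in> sets A \<Longrightarrow> N \<in> sets B \<Longrightarrow> S \<in> sets pos_borel \<Longrightarrow>
      emeasure (pol_block P M N) S = emeasure (pol_block P' M N) S"
  shows "P = P'"
proof -
  let ?E = "{M \<times> N \<times> S | M N S. M \<in> sets A \<and> N \<in> sets B \<and> S \<in> sets pos_borel}"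
  interpret P: finite_measure P by (rule finite_measure_Pol[OF P A])
  have Times: "emeasure R (M \<times> N \<times> S) = emeasure (pol_block R M N) S"
    if R: "R \<in> Pol A B" and [measurable]: "M \<in> sets A" "N \<in> sets B" "S \<in> sets pos_borel" for R M N S
  proof -
    have "M \<times> N \<times> S \<in> sets R" unfolding sets_Pol[OF R] by (intro pair_measureI) auto
    then have "emeasure R (M \<times> N \<times> S) = (\<integral>\<^sup>+z. indicator (M \<times> N \<times> S) z \<partial>R)" by simp
    also have "\<dots> = (\<integral>\<^sup>+z. indicator M (fst z) * indicator N (fst (snd z)) * indicator S (snd (snd z)) \<partial>R)"
      by (rule nn_integral_cong) (auto split: split_indicator)
    finally show ?thesis by (simp add: emeasure_pol_block[OF R])
  qed
  have gen: "sets R = sigma_sets (space A \<times> space B \<times> {0<..}) ?E" if R: "R \<in> Pol A B" for R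
  proof -
    have "sets R = sets (A \<Otimes>\<^sub>M B \<Otimes>\<^sub>M pos_borel)" by (rule sets_Pol[OF R])
    also have "\<dots> = sets (sigma (space A \<times> space (B \<Otimes>\<^sub>M pos_borel))
        {M \<times> T | M T. M \<in> sets A \<and> T \<in> {N \<times> S | N S. N \<in> sets B \<and> S \<in> sets pos_borel}})"
    proof (rule sets_pair_eq[where Ca="{space A}" and Cb="{space (B \<Otimes>\<^sub>M pos_borel)}"])
      show "sets A = sigma_sets (space A) (sets A)" by (simp add: sets.sigma_sets_eq)
      show "sets (B \<Otimes>\<^sub>M pos_borel) = sigma_sets (space (B \<Otimes>\<^sub>M pos_borel)) {N \<times> S |N S. N \<in> sets B \<and> S \<in> sets pos_borel}"
        by (simp add: sets_pair_measure space_pair_measure)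
      show "{space (B \<Otimes>\<^sub>M pos_borel)} \<subseteq> {N \<times> S |N S. N \<in> sets B \<and> S \<in> sets pos_borel}"
        unfolding space_pair_measure using sets.top by blast
      show "{N \<times> S |N S. N \<in> sets B \<and> S \<in> sets pos_borel} \<subseteq> Pow (space (B \<Otimes>\<^sub>M pos_borel))"
        by (auto simp: space_pair_measure dest: sets.sets_into_space[THEN subsetD])
    qed (auto dest: sets.sets_into_space)
    also have "{M \<times> T | M T. M \<in> sets A \<and> T \<in> {N \<times> S | N S. N \<in> sets B \<and> S \<in> sets pos_borel}} = ?E" by blast
    also have "sets (sigma (space A \<times> space (B \<Otimes>\<^sub>M pos_borel)) ?E) = sigma_sets (space A \<times> space B \<times> {0<..}) ?E"
    proof -
      have "?E \<subseteq> Pow (space A \<times> space B \<times> {0<..})"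
        by (auto dest: sets.sets_into_space[THEN subsetD])
      then show ?thesis by (simp add: space_pair_measure)
    qed
    finally show ?thesis .
  qed
  show ?thesis
  proof (rule measure_eqI_generator_eq[where E="?E" and \<Omega>="space A \<times> space B \<times> {0<..}" and A="\<lambda>_. space P"])
    show "Int_stable ?E"
    proof (rule Int_stableI, safe)
      fix M N S M' N' S' assume "M \<in> sets A" "N \<in> sets B" "S \<in> sets pos_borel" "M' \<in> sets A" "N' \<in> sets B" "S' \<in> sets pos_borel"
      then show "\<exists>M'' N'' S''. M \<times> N \<times> S \<inter> (M' \<times> N' \<times> S') = M'' \<times> N'' \<times> S'' \<and> M'' \<in> sets A \<and> N'' \<in> sets B \<and> S'' \<in> sets pos_borel"
        by (intro exI[of _ "M \<inter> M'"] exI[of _ "N \<inter> N'"] exI[of _ "S \<inter> S'"]) auto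
    qed
    show "?E \<subseteq> Pow (space A \<times> space B \<times> {0<..})"
      by (auto dest: sets.sets_into_space[THEN subsetD])
    show "range (\<lambda>_::nat. space P) \<subseteq> ?E"
      unfolding space_Pol[OF P] using sets.top[of A] sets.top[of B] sets.top[of pos_borel] by auto
    show "(\<Union>i::nat. space P) = space A \<times> space B \<times> {0<..}" by (simp add: space_Pol[OF P])
    show "emeasure P X = emeasure P' X" if "X \<in> ?E" for X
      using that eq by (auto simp: Times[OF P] Times[OF P'])
  qed (use gen[OF P] gen[OF P'] in auto)
qed

lemma M_tri_eqI_rat:
  assumes "\<mu> \<in> M_tri" "\<nu> \<in> M_tri"
    and eq: "\<And>q::rat. emeasure \<mu> {0<..of_rat q} = emeasure \<nu> {0<..of_rat q}"
  shows "\<mu> = \<nu>"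
proof -
  have s: "sets \<mu> = sets pos_borel" "sets \<nu> = sets pos_borel" and fin: "emeasure \<mu> (space \<mu>) < \<infinity>"
    using assms by (auto simp: M_tri_def)
  have id: "(\<lambda>x. x) \<in> borel_measurable \<rho>" and sp: "space \<rho> = {0<..}" if "sets \<rho> = sets pos_borel" for \<rho>
    using measurable_pos_borel_borel sets_eq_imp_space_eq[OF that]
    by (simp_all add: measurable_cong_sets[OF that refl])
  have em: "emeasure (distr \<rho> borel (\<lambda>x. x)) S = emeasure \<rho> (S \<inter> {0<..})"
    if "sets \<rho> = sets pos_borel" "S \<in> sets borel" for \<rho> S
    using id[OF that(1)] that(2) by (simp add: emeasure_distr sp[OF that(1)])
  have Ioc: "{..x} \<inter> {0<..} = {0<..x}" for x :: real by auto
  have "distr \<mu> borel (\<lambda>x. x) = distr \<nu> borel (\<lambda>x. x)"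
  proof (rule finite_measure_eqI_rat_atMost)
    show "finite_measure (distr \<mu> borel (\<lambda>x. x))"
      using fin sp[OF s(1)] by (intro finite_measureI) (auto simp: em[OF s(1)])
  qed (auto simp: em s Ioc eq)
  show ?thesis
  proof (rule measure_eqI)
    fix S assume "S \<in> sets \<mu>"
    then have S: "S \<in> sets borel" "S \<inter> {0<..} = S" by (auto simp: s pos_borel_def sets_restrict_space)
    have "emeasure \<mu> S = emeasure (distr \<mu> borel (\<lambda>x. x)) S" by (simp add: em[OF s(1)] S)
    also have "\<dots> = emeasure (distr \<nu> borel (\<lambda>x. x)) S" by (simp add: \<open>distr \<mu> borel (\<lambda>x. x) = _\<close>)
    also have "\<dots> = emeasure \<nu> S" by (simp add: em[OF s(2)] S)
    finally show "emeasure \<mu> S = emeasure \<nu> S" .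
  qed (simp add: s)
qed

lemma Ioc_sets_pos_borel: "{0<..x} \<in> sets pos_borel" for x :: real
  by (auto simp: pos_borel_def sets_restrict_space intro!: image_eqI[of _ _ "{..x}"])

lemma is_block_density_unique:
  assumes B: "finite_measure B" and k: "is_block_density B m k" and k': "is_block_density B m k'"
  shows "AE b in B. k b = k' b"
proof -
  interpret finite_measure B by fact
  have "AE b in B. \<forall>q::rat. emeasure (k b) {0<..of_rat q} = emeasure (k' b) {0<..of_rat q}"
    unfolding AE_all_countable
  proof
    fix q :: rat
    show "AE b in B. emeasure (k b) {0<..of_rat q} = emeasure (k' b) {0<..of_rat q}"
      using k k' Ioc_sets_pos_borel[of "of_rat q"] unfolding is_block_density_def
      by (intro density_unique_finite_measure) auto
  qed
  moreover have "AE b in B. k b \<in> M_tri" "AE b in B. k' b \<in> M_tri"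
    using k k' by (auto simp: is_block_density_def)
  ultimately show ?thesis by eventually_elim (rule M_tri_eqI_rat, auto)
qed

text \<open>The order of integration is the one needed later, where the inner integral over \<open>\<mu>\<close> becomes an
integral against the kernel of the second polymorphism.\<close>

lemma emeasure_mult_conv:
  assumes \<mu>: "\<mu> \<in> M_tri" and \<nu>: "\<nu> \<in> M_tri" and S[measurable]: "S \<in> sets pos_borel"
  shows "emeasure (mult_conv \<mu> \<nu>) S = (\<integral>\<^sup>+t. \<integral>\<^sup>+s. indicator S (s * t) \<partial>\<mu> \<partial>\<nu>)"
proof -
  have [measurable_cong]: "sets \<mu> = sets pos_borel" "sets \<nu> = sets pos_borel"
    using \<mu> \<nu> by (auto simp: M_tri_def)
  interpret \<mu>: finite_measure \<mu> using \<mu> by (intro finite_measureI) (auto simp: M_tri_def)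
  interpret \<nu>: finite_measure \<nu> using \<nu> by (intro finite_measureI) (auto simp: M_tri_def)
  interpret pair_sigma_finite \<mu> \<nu> ..
  have m[measurable]: "(\<lambda>z. fst z * snd z) \<in> \<mu> \<Otimes>\<^sub>M \<nu> \<rightarrow>\<^sub>M pos_borel"
    by (rule measurable_mult_pos_borel) measurable
  have "emeasure (mult_conv \<mu> \<nu>) S = (\<integral>\<^sup>+z. indicator S z \<partial>mult_conv \<mu> \<nu>)"
    by (simp add: mult_conv_def)
  also have "\<dots> = (\<integral>\<^sup>+z. indicator S (fst z * snd z) \<partial>(\<mu> \<Otimes>\<^sub>M \<nu>))"
    unfolding mult_conv_def case_prod_beta by (rule nn_integral_distr) auto
  also have "\<dots> = (\<integral>\<^sup>+t. \<integral>\<^sup>+s. indicator S (s * t) \<partial>\<mu> \<partial>\<nu>)"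
    by (subst nn_integral_snd[symmetric]) auto
  finally show ?thesis .
qed

section \<open>Block densities\<close>

text \<open>Disintegrate over the first marginal of \<open>\<nu>\<close>, which is absolutely continuous with density \<open>f\<close> with respect to \<open>B\<close>.\<close>

lemma density_kernel_pos_borel:
  assumes B: "finite_measure B" and ne: "space B \<noteq> {}"
    and fin: "finite_measure \<nu>" and sets_\<nu>[measurable_cong]: "sets \<nu> = sets (B \<Otimes>\<^sub>M pos_borel)"
    and ac: "\<And>X. X \<in> null_sets B \<Longrightarrow> AE z in \<nu>. fst z \<notin> X"
  obtains f K where "f \<in> borel_measurable B" "K \<in> B \<rightarrow>\<^sub>M prob_algebra pos_borel"
    "\<And>h. h \<in> borel_measurable (B \<Otimes>\<^sub>M pos_borel) \<Longrightarrow>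
      (\<integral>\<^sup>+z. h z \<partial>\<nu>) = (\<integral>\<^sup>+b. f b * (\<integral>\<^sup>+t. h (b, t) \<partial>K b) \<partial>B)"
proof -
  interpret \<nu>: finite_measure \<nu> by fact
  obtain f where f[measurable]: "f \<in> borel_measurable B" and "density B f = distr (density \<nu> (\<lambda>_. 1)) B fst"
    by (rule Radon_Nikodym_pushforward[OF B _ _ ac, where F="\<lambda>_. 1"]) auto
  then have f_eq: "density B f = distr \<nu> B fst" by (simp add: density_1)
  have "finite_measure (density B f)"
    unfolding f_eq by (rule \<nu>.finite_measure_distr) measurable
  moreover have "space (density B f) \<noteq> {}" using ne by simp
  moreover have "sets \<nu> = sets (density B f \<Otimes>\<^sub>M pos_borel)"
    unfolding sets_\<nu> by (rule sets_pair_measure_cong) auto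
  moreover have "distr \<nu> (density B f) fst = density B f"
  proof -
    have "distr \<nu> (density B f) fst = distr \<nu> B fst" by (rule distr_cong) auto
    then show ?thesis by (simp add: f_eq)
  qed
  ultimately obtain K where K: "K \<in> density B f \<rightarrow>\<^sub>M prob_algebra pos_borel"
    and \<nu>: "\<nu> = kernel_product (density B f) pos_borel K"
    by (rule disintegration_pos_borel)
  have K0: "K \<in> B \<rightarrow>\<^sub>M prob_algebra pos_borel"
    using K by (simp add: measurable_cong_sets[OF sets_density refl])
  note K' = measurable_prob_algebraD[OF K] and K0'[measurable] = measurable_prob_algebraD[OF K0]
  have "(\<integral>\<^sup>+z. h z \<partial>\<nu>) = (\<integral>\<^sup>+b. f b * (\<integral>\<^sup>+t. h (b, t) \<partial>K b) \<partial>B)"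
    if h[measurable]: "h \<in> borel_measurable (B \<Otimes>\<^sub>M pos_borel)" for h
  proof -
    have [measurable]: "(\<lambda>b. \<integral>\<^sup>+t. h (b, t) \<partial>K b) \<in> borel_measurable B"
      by (rule nn_integral_measurable_subprob_algebra2[OF _ K0']) simp
    have "h \<in> borel_measurable (density B f \<Otimes>\<^sub>M pos_borel)"
      using h by (simp add: measurable_cong_sets[OF sets_pair_measure_cong[OF sets_density refl] refl])
    then have "(\<integral>\<^sup>+z. h z \<partial>\<nu>) = (\<integral>\<^sup>+b. (\<integral>\<^sup>+t. h (b, t) \<partial>K b) \<partial>density B f)"
      unfolding \<nu> by (rule nn_integral_kernel_product[OF K'])
    then show ?thesis by (simp add: nn_integral_density)
  qed
  with f K0 that show ?thesis by blast
qed

text \<open>The densities are the kernel of the preceding lemma scaled by \<open>f\<close>. Almost all of them lie in \<open>M_tri\<close>, because their total masses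
and first moments have finite integrals over \<open>B\<close>.\<close>

lemma block_density_exists:
  assumes B: "finite_measure B" and ne: "space B \<noteq> {}"
    and fin: "finite_measure \<nu>" and sets_\<nu>[measurable_cong]: "sets \<nu> = sets (B \<Otimes>\<^sub>M pos_borel)"
    and ac: "\<And>X. X \<in> null_sets B \<Longrightarrow> AE z in \<nu>. fst z \<notin> X"
    and mom: "(\<integral>\<^sup>+z. ennreal (snd z) \<partial>\<nu>) < \<infinity>"
    and m: "\<And>N S. N \<in> sets B \<Longrightarrow> S \<in> sets pos_borel \<Longrightarrow>
      emeasure (m N) S = (\<integral>\<^sup>+z. indicator N (fst z) * indicator S (snd z) \<partial>\<nu>)"
  obtains k where "is_block_density B m k"
    "\<And>h. h \<in> borel_measurable (B \<Otimes>\<^sub>M pos_borel) \<Longrightarrow> (\<integral>\<^sup>+z. h z \<partial>\<nu>) = (\<integral>\<^sup>+b. \<integral>\<^sup>+t. h (b, t) \<partial>k b \<partial>B)"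
proof -
  interpret \<nu>: finite_measure \<nu> by fact
  obtain f K where f[measurable]: "f \<in> borel_measurable B" and K: "K \<in> B \<rightarrow>\<^sub>M prob_algebra pos_borel"
    and int: "\<And>h. h \<in> borel_measurable (B \<Otimes>\<^sub>M pos_borel) \<Longrightarrow>
      (\<integral>\<^sup>+z. h z \<partial>\<nu>) = (\<integral>\<^sup>+b. f b * (\<integral>\<^sup>+t. h (b, t) \<partial>K b) \<partial>B)"
    using density_kernel_pos_borel[OF B ne fin sets_\<nu> ac] by blast
  note K'[measurable] = measurable_prob_algebraD[OF K]
  define k where "k b = scale_measure (f b) (K b)" for b
  have sets_K: "sets (K b) = sets pos_borel" if "b \<in> space B" for b
    using sets_kernel[OF K' that] by simp
  have k_int: "(\<integral>\<^sup>+t. h t \<partial>k b) = f b * (\<integral>\<^sup>+t. h t \<partial>K b)" if "b \<in> space B" "h \<in> borel_measurable pos_borel" for b h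
    using that sets_K[OF that(1)] unfolding k_def
    by (subst nn_integral_scale_measure) (simp_all add: measurable_cong_sets[OF sets_K[OF that(1)] refl])
  have int_k: "(\<integral>\<^sup>+z. h z \<partial>\<nu>) = (\<integral>\<^sup>+b. \<integral>\<^sup>+t. h (b, t) \<partial>k b \<partial>B)"
    if h[measurable]: "h \<in> borel_measurable (B \<Otimes>\<^sub>M pos_borel)" for h
    unfolding int[OF h] by (intro nn_integral_cong k_int[symmetric]) auto
  have k_int_meas: "(\<lambda>b. \<integral>\<^sup>+t. h t \<partial>k b) \<in> borel_measurable B" if [measurable]: "h \<in> borel_measurable pos_borel" for h
  proof -
    have "(\<lambda>b. f b * (\<integral>\<^sup>+t. h t \<partial>K b)) \<in> borel_measurable B"
      using measurable_compose[OF K' nn_integral_measurable_subprob_algebra[OF that]] by measurable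
    then show ?thesis by (subst measurable_cong[OF k_int[OF _ that]])
  qed
  have k_em: "emeasure (k b) S = (\<integral>\<^sup>+t. indicator S t \<partial>k b)" if "b \<in> space B" "S \<in> sets pos_borel" for b S
    using that by (simp add: k_def sets_K)
  note [measurable] = measurable_pos_borel_borel
  have id_meas: "(\<lambda>t. ennreal t) \<in> borel_measurable pos_borel" by measurable
  have snd_meas: "(\<lambda>z. ennreal (snd z)) \<in> borel_measurable (B \<Otimes>\<^sub>M pos_borel)"
    by (rule measurable_compose[OF measurable_snd id_meas])
  have "is_block_density B m k"
    unfolding is_block_density_def
  proof (intro conjI ballI)
    have "(\<integral>\<^sup>+b. (\<integral>\<^sup>+t. 1 \<partial>k b) \<partial>B) = (\<integral>\<^sup>+z. 1 \<partial>\<nu>)" by (subst int_k) auto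
    also have "\<dots> < \<infinity>" by (simp add: less_top[symmetric])
    finally have "AE b in B. (\<integral>\<^sup>+t. 1 \<partial>k b) \<noteq> \<infinity>"
      by (intro nn_integral_PInf_AE k_int_meas) auto
    moreover have "(\<integral>\<^sup>+b. (\<integral>\<^sup>+t. ennreal t \<partial>k b) \<partial>B) < \<infinity>"
      using mom by (subst (asm) int_k) (auto simp: snd_meas)
    then have "AE b in B. (\<integral>\<^sup>+t. ennreal t \<partial>k b) \<noteq> \<infinity>"
      by (intro nn_integral_PInf_AE k_int_meas id_meas) auto
    ultimately show "AE b in B. k b \<in> M_tri"
      using AE_space
      by eventually_elim (auto simp: M_tri_def less_top k_def sets_K)
    fix S assume S[measurable]: "S \<in> sets pos_borel"
    show "(\<lambda>b. emeasure (k b) S) \<in> borel_measurable B"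
      by (subst measurable_cong[OF k_em[OF _ S]]) (auto intro: k_int_meas)
    fix N assume N[measurable]: "N \<in> sets B"
    have "emeasure (m N) S = (\<integral>\<^sup>+b. \<integral>\<^sup>+t. indicator N b * indicator S t \<partial>k b \<partial>B)"
      unfolding m[OF N S] by (subst int_k) auto
    also have "\<dots> = (\<integral>\<^sup>+b\<in>N. emeasure (k b) S \<partial>B)"
      by (rule nn_integral_cong) (auto simp: k_em S split: split_indicator)
    finally show "emeasure (m N) S = (\<integral>\<^sup>+b\<in>N. emeasure (k b) S \<partial>B)" .
  qed
  with int_k that show ?thesis by blast
qed

text \<open>The second property expresses that integrating against the densities is integrating over \<open>M \<times> B \<times> \<real>\<^sup>\<times>\<close>
against \<open>P\<close>; it turns integrals over \<open>B\<close> of convolutions into integrals over \<open>P\<close>.\<close>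

lemma pol_block_density_exists:
  assumes P: "P \<in> Pol A B" and A: "finite_measure A" and B: "finite_measure B" and ne: "space B \<noteq> {}"
    and M[measurable]: "M \<in> sets A"
  obtains p where "is_block_density B (\<lambda>N. pol_block P M N) p"
    "\<And>h. h \<in> borel_measurable (B \<Otimes>\<^sub>M pos_borel) \<Longrightarrow>
      (\<integral>\<^sup>+b. \<integral>\<^sup>+t. h (b, t) \<partial>p b \<partial>B) = (\<integral>\<^sup>+z. indicator M (fst z) * h (snd z) \<partial>P)"
proof -
  note [measurable] = measurable_Pol[OF P]
  interpret P: finite_measure P by (rule finite_measure_Pol[OF P A])
  interpret B: finite_measure B by fact
  have snd_P[measurable]: "snd \<in> P \<rightarrow>\<^sub>M B \<Otimes>\<^sub>M pos_borel"
    by (simp add: measurable_cong_sets[OF sets_Pol[OF P] refl])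
  define \<nu> where "\<nu> = distr (density P (\<lambda>z. indicator M (fst z))) (B \<Otimes>\<^sub>M pos_borel) snd"
  have \<nu>_int: "(\<integral>\<^sup>+y. h y \<partial>\<nu>) = (\<integral>\<^sup>+z. indicator M (fst z) * h (snd z) \<partial>P)"
    if [measurable]: "h \<in> borel_measurable (B \<Otimes>\<^sub>M pos_borel)" for h
    unfolding \<nu>_def by (simp add: nn_integral_distr nn_integral_density)
  have sets_\<nu>: "sets \<nu> = sets (B \<Otimes>\<^sub>M pos_borel)" by (simp add: \<nu>_def)
  note [measurable] = measurable_pos_borel_borel
  have id_meas: "(\<lambda>t. ennreal t) \<in> borel_measurable pos_borel" by measurable
  have snd_meas: "(\<lambda>z. ennreal (snd z)) \<in> borel_measurable (B \<Otimes>\<^sub>M pos_borel)"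
    by (rule measurable_compose[OF measurable_snd id_meas])
  show ?thesis
  proof (rule block_density_exists[OF B ne _ sets_\<nu>, of "\<lambda>N. pol_block P M N"])
    show "finite_measure \<nu>"
    proof (rule finite_measureI)
      have "emeasure \<nu> (space \<nu>) = (\<integral>\<^sup>+y. 1 \<partial>\<nu>)" by simp
      also have "\<dots> \<le> (\<integral>\<^sup>+z. 1 \<partial>P)"
        by (subst \<nu>_int, simp, rule nn_integral_mono) (auto split: split_indicator)
      also have "\<dots> < \<infinity>" by (simp add: less_top[symmetric])
      finally show "emeasure \<nu> (space \<nu>) \<noteq> \<infinity>" by simp
    qed
    show "AE z in \<nu>. fst z \<notin> X" if "X \<in> null_sets B" for X
    proof -
      have [measurable]: "X \<in> sets B" using that by auto
      have "AE z in P. fst (snd z) \<notin> X" by (rule AE_Pol_snd[OF P AE_not_in[OF that]])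
      then show ?thesis unfolding \<nu>_def by (subst AE_distr_iff) (auto simp: AE_density)
    qed
    have "(\<integral>\<^sup>+z. ennreal (snd z) \<partial>\<nu>) \<le> (\<integral>\<^sup>+z. ennreal (snd (snd z)) * 1 \<partial>P)"
      by (subst \<nu>_int[OF snd_meas]) (auto intro!: nn_integral_mono split: split_indicator)
    also have "\<dots> = emeasure B (space B)" by (subst nn_integral_Pol_snd[OF P]) auto
    also have "\<dots> < \<infinity>" by (simp add: less_top[symmetric])
    finally show "(\<integral>\<^sup>+z. ennreal (snd z) \<partial>\<nu>) < \<infinity>" .
    show "emeasure (pol_block P M N) S = (\<integral>\<^sup>+z. indicator N (fst z) * indicator S (snd z) \<partial>\<nu>)"
      if [measurable]: "N \<in> sets B" "S \<in> sets pos_borel" for N S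
      by (subst \<nu>_int) (auto simp: emeasure_pol_block[OF P] mult.assoc)
  qed (use that \<nu>_int in auto)
qed

text \<open>The block densities chosen for \<open>R\<close> and for \<open>R'\<close> agree almost everywhere, so the two polymorphisms have the same blocks.\<close>

lemma is_pol_comp_unique:
  assumes A: "finite_measure A" and B: "finite_measure B"
    and R: "is_pol_comp A B C Q P R" and R': "is_pol_comp A B C Q P R'"
  shows "R = R'"
proof (rule Pol_eqI[OF _ _ A])
  show "R \<in> Pol A C" "R' \<in> Pol A C" using R R' by (auto simp: is_pol_comp_def)
  fix M K S assume M: "M \<in> sets A" and K: "K \<in> sets C" and S: "S \<in> sets pos_borel"
  obtain p q where p: "is_block_density B (\<lambda>N. pol_block P M N) p"
    and q: "is_block_density B (\<lambda>N. pol_block Q N K) q"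
    and pq: "emeasure (pol_block R M K) S = (\<integral>\<^sup>+b. emeasure (mult_conv (q b) (p b)) S \<partial>B)"
    using R M K S unfolding is_pol_comp_def by meson
  obtain p' q' where p': "is_block_density B (\<lambda>N. pol_block P M N) p'"
    and q': "is_block_density B (\<lambda>N. pol_block Q N K) q'"
    and pq': "emeasure (pol_block R' M K) S = (\<integral>\<^sup>+b. emeasure (mult_conv (q' b) (p' b)) S \<partial>B)"
    using R' M K S unfolding is_pol_comp_def by meson
  show "emeasure (pol_block R M K) S = emeasure (pol_block R' M K) S"
    unfolding pq pq'
    using is_block_density_unique[OF B p p'] is_block_density_unique[OF B q q']
    by (intro nn_integral_cong_AE) auto
qed

section \<open>The composition as the law of a random product\<close>

text \<open>\<open>\<phi>\<close> codes the points of \<open>C\<close>, \<open>\<psi>\<close> decodes, and \<open>\<kappa> b\<close> is the conditional law under \<open>Q\<close> of the pair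
(code of \<open>c\<close>, \<open>s\<close>) given \<open>b\<close>.\<close>

locale coded_composition =
  fixes A :: "'a measure" and B :: "'b measure" and C :: "'c measure"
    and P :: "('a \<times> 'b \<times> real) measure" and Q :: "('b \<times> 'c \<times> real) measure"
    and \<phi> :: "'c \<Rightarrow> real" and \<psi> :: "real \<Rightarrow> 'c" and \<kappa> :: "'b \<Rightarrow> (real \<times> real) measure"
  assumes A: "finite_measure A" and B: "finite_measure B" and C: "finite_measure C"
    and A_ne: "space A \<noteq> {}" and B_ne: "space B \<noteq> {}"
    and P: "P \<in> Pol A B" and Q: "Q \<in> Pol B C"
    and \<phi>[measurable]: "\<phi> \<in> borel_measurable C"
    and \<psi>: "\<psi> \<in> completion (distr C borel \<phi>) \<rightarrow>\<^sub>M C"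
    and \<psi>\<phi>: "AE c in C. \<psi> (\<phi> c) = c"
    and \<kappa>: "\<kappa> \<in> B \<rightarrow>\<^sub>M prob_algebra (borel \<Otimes>\<^sub>M pos_borel)"
    and Q_\<kappa>: "distr Q (B \<Otimes>\<^sub>M borel \<Otimes>\<^sub>M pos_borel) (\<lambda>z. (fst z, \<phi> (fst (snd z)), snd (snd z)))
      = kernel_product B (borel \<Otimes>\<^sub>M pos_borel) \<kappa>"
begin

abbreviation "N \<equiv> (borel \<Otimes>\<^sub>M pos_borel :: (real \<times> real) measure)"
abbreviation "D \<equiv> distr C borel \<phi>"

text \<open>The joint law of \<open>(a, b, t)\<close> under \<open>P\<close> and of (code of \<open>c\<close>, \<open>s\<close>) under \<open>\<kappa> b\<close>.\<close>

definition W :: "(('a \<times> 'b \<times> real) \<times> real \<times> real) measure" where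
  "W = kernel_product P N (\<lambda>z. \<kappa> (fst (snd z)))"

definition Z :: "('a \<times> 'b \<times> real) \<times> real \<times> real \<Rightarrow> 'a \<times> 'c \<times> real" where
  "Z w = (fst (fst w), \<psi> (fst (snd w)), snd (snd w) * snd (snd (fst w)))"

text \<open>The completion is needed because \<open>\<psi>\<close>, hence \<open>Z\<close>, is measurable only up to null sets.\<close>

definition R :: "('a \<times> 'c \<times> real) measure" where
  "R = distr (completion W) (A \<Otimes>\<^sub>M C \<Otimes>\<^sub>M pos_borel) Z"

lemmas [measurable] = measurable_Pol[OF P] measurable_Pol[OF Q]

lemma \<kappa>'[measurable]: "\<kappa> \<in> B \<rightarrow>\<^sub>M subprob_algebra N"
  using \<kappa> by (rule measurable_prob_algebraD)

lemma snd_measurable_ennreal[measurable]: "(\<lambda>y. ennreal (snd y)) \<in> borel_measurable N"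
  by (rule measurable_compose[OF measurable_pos_borelD measurable_ennreal]) measurable

lemma P_ne: "space P \<noteq> {}"
  using A_ne B_ne by (auto simp: space_Pol[OF P] intro!: exI[of _ 1])

lemma \<kappa>_P[measurable]: "(\<lambda>z. \<kappa> (fst (snd z))) \<in> P \<rightarrow>\<^sub>M subprob_algebra N"
  by measurable

lemma sets_W[measurable_cong]: "sets W = sets (P \<Otimes>\<^sub>M N)"
  unfolding W_def by (rule sets_kernel_product[OF \<kappa>_P P_ne])

lemma space_W: "space W = space P \<times> space N"
  using sets_eq_imp_space_eq[OF sets_W] by (simp add: space_pair_measure)

lemma nn_integral_W:
  "F \<in> borel_measurable (P \<Otimes>\<^sub>M N) \<Longrightarrow> (\<integral>\<^sup>+w. F w \<partial>W) = (\<integral>\<^sup>+z. \<integral>\<^sup>+y. F (z, y) \<partial>\<kappa> (fst (snd z)) \<partial>P)"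
  unfolding W_def by (rule nn_integral_kernel_product[OF \<kappa>_P])

lemma nn_integral_Q:
  assumes G[measurable]: "G \<in> borel_measurable (B \<Otimes>\<^sub>M N)"
  shows "(\<integral>\<^sup>+z. G (fst z, \<phi> (fst (snd z)), snd (snd z)) \<partial>Q) = (\<integral>\<^sup>+b. \<integral>\<^sup>+y. G (b, y) \<partial>\<kappa> b \<partial>B)"
proof -
  have "(\<integral>\<^sup>+z. G (fst z, \<phi> (fst (snd z)), snd (snd z)) \<partial>Q)
      = (\<integral>\<^sup>+y. G y \<partial>distr Q (B \<Otimes>\<^sub>M N) (\<lambda>z. (fst z, \<phi> (fst (snd z)), snd (snd z))))"
    by (subst nn_integral_distr) auto
  then show ?thesis unfolding Q_\<kappa> by (simp add: nn_integral_kernel_product[OF \<kappa>' G])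
qed

lemma nn_integral_\<kappa>_measurable[measurable]:
  assumes [measurable]: "G \<in> borel_measurable (B \<Otimes>\<^sub>M N)"
  shows "(\<lambda>b. \<integral>\<^sup>+y. G (b, y) \<partial>\<kappa> b) \<in> borel_measurable B"
  by (rule nn_integral_measurable_subprob_algebra2[OF _ \<kappa>']) simp

lemma AE_Q_\<phi>: "AE x in D. p x \<Longrightarrow> AE z in Q. p (\<phi> (fst (snd z)))"
  by (rule AE_Pol_snd[OF Q AE_distrD[OF \<phi>]])

text \<open>The code has a law under \<open>W\<close> that is absolutely continuous with respect to its law under \<open>C\<close>. For a
null set \<open>E\<close> of codes, \<open>\<kappa> b\<close> gives \<open>E\<close> measure zero for almost all \<open>b\<close> by the disintegration of \<open>Q\<close>,
and null sets of \<open>B\<close> are null for \<open>P\<close>.\<close>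

lemma AE_W_coded:
  assumes "AE x in D. p x"
  shows "AE w in W. p (fst (snd w))"
proof -
  obtain E where E: "\<And>x. x \<in> space D - E \<Longrightarrow> p x" "E \<in> null_sets D" using AE_E3[OF assms] by metis
  then have [measurable]: "E \<in> sets borel" by auto
  have "AE z in Q. \<phi> (fst (snd z)) \<notin> E" by (rule AE_Q_\<phi>[OF AE_not_in[OF E(2)]])
  then have "(\<integral>\<^sup>+z. indicator E (\<phi> (fst (snd z))) \<partial>Q) = 0"
    by (subst nn_integral_0_iff_AE) (auto simp: indicator_eq_0_iff)
  then have "(\<integral>\<^sup>+b. \<integral>\<^sup>+y. indicator E (fst y) \<partial>\<kappa> b \<partial>B) = 0"
    using nn_integral_Q[of "\<lambda>w. indicator E (fst (snd w))"] by simp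
  then have "AE b in B. (\<integral>\<^sup>+y. indicator E (fst y) \<partial>\<kappa> b) = 0"
    by (subst (asm) nn_integral_0_iff_AE) auto
  then have "AE z in P. (\<integral>\<^sup>+y. indicator E (fst y) \<partial>\<kappa> (fst (snd z))) = 0" by (rule AE_Pol_snd[OF P])
  then have "(\<integral>\<^sup>+w. indicator E (fst (snd w)) \<partial>W) = 0"
    by (subst nn_integral_W, simp, subst nn_integral_cong_AE[where v="\<lambda>_. 0"]) auto
  then have "AE w in W. indicator E (fst (snd w)) = (0::ennreal)"
    by (subst (asm) nn_integral_0_iff_AE) auto
  then show ?thesis by eventually_elim (use E(1) in \<open>auto simp: indicator_eq_0_iff\<close>)
qed

text \<open>Passing from \<open>K\<close> to a Borel set of codes replaces decoded, merely completion-measurable events by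
measurable ones.\<close>

lemma coded_set:
  assumes "K \<in> sets C"
  obtains E where "E \<in> sets borel" "AE x in D. \<psi> x \<in> K \<longleftrightarrow> x \<in> E"
proof -
  have "\<psi> -` K \<inter> space (completion D) \<in> sets (completion D)" by (rule measurable_sets[OF \<psi> assms])
  then obtain S T T' where *: "\<psi> -` K = S \<union> T" "T \<subseteq> T'" "T' \<in> null_sets D" "S \<in> sets D"
    by (auto elim: sets_completionE)
  have "AE x in D. \<psi> x \<in> K \<longleftrightarrow> x \<in> S"
    using AE_not_in[OF *(3)] by eventually_elim (use * in auto)
  with * that show ?thesis by auto
qed

lemma AE_coded_set: "AE x in D. \<psi> x \<in> K \<longleftrightarrow> x \<in> E \<Longrightarrow> AE c in C. c \<in> K \<longleftrightarrow> \<phi> c \<in> E"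
  using AE_distrD[OF \<phi>, of "\<lambda>x. \<psi> x \<in> K \<longleftrightarrow> x \<in> E"] \<psi>\<phi> by (auto elim: eventually_elim2)

lemma \<psi>_W: "(\<lambda>w. \<psi> (fst (snd w))) \<in> completion W \<rightarrow>\<^sub>M C"
proof (rule measurableI)
  show "\<psi> (fst (snd w)) \<in> space C" for w using measurable_space[OF \<psi>] by simp
  fix K assume K: "K \<in> sets C"
  obtain E where [measurable]: "E \<in> sets borel" and E: "AE x in D. \<psi> x \<in> K \<longleftrightarrow> x \<in> E"
    using coded_set[OF K] by blast
  \<comment> \<open>The preimage of K differs from a measurable set by a null set, hence lies in the
    completion.\<close>
  have "AE w in W. \<not> ((\<psi> (fst (snd w)) \<in> K) = (fst (snd w) \<notin> E))"
    using AE_W_coded[OF E] by eventually_elim auto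
  from sets_completion_AE[OF this]
  have 1: "{w\<in>space W. \<psi> (fst (snd w)) \<in> K \<longleftrightarrow> fst (snd w) \<notin> E} \<in> sets (completion W)"
    by (simp add: pred_def)
  have 2: "{w\<in>space W. fst (snd w) \<in> E} \<in> sets (completion W)"
    by (rule sets_completionI_sets) measurable
  have "(\<lambda>w. \<psi> (fst (snd w))) -` K \<inter> space (completion W) =
      ({w\<in>space W. fst (snd w) \<in> E} - {w\<in>space W. \<psi> (fst (snd w)) \<in> K \<longleftrightarrow> fst (snd w) \<notin> E}) \<union>
      ({w\<in>space W. \<psi> (fst (snd w)) \<in> K \<longleftrightarrow> fst (snd w) \<notin> E} - {w\<in>space W. fst (snd w) \<in> E})"
    by auto
  then show "(\<lambda>w. \<psi> (fst (snd w))) -` K \<inter> space (completion W) \<in> sets (completion W)"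
    using sets.Un[OF sets.Diff[OF 2 1] sets.Diff[OF 1 2]] by simp
qed

lemma ts_W: "(\<lambda>w. snd (snd w) * snd (snd (fst w))) \<in> W \<rightarrow>\<^sub>M pos_borel"
  by (rule measurable_mult_pos_borel) measurable

lemmas ts_W'[measurable] = measurable_pos_borelD[OF ts_W]

lemma Z[measurable]: "Z \<in> completion W \<rightarrow>\<^sub>M A \<Otimes>\<^sub>M C \<Otimes>\<^sub>M pos_borel"
  unfolding Z_def
proof (intro measurable_Pair \<psi>_W measurable_completion ts_W)
  show "(\<lambda>w. fst (fst w)) \<in> W \<rightarrow>\<^sub>M A" by measurable
qed

lemma sets_R: "sets R = sets (A \<Otimes>\<^sub>M C \<Otimes>\<^sub>M pos_borel)"
  by (simp add: R_def)

lemma space_R: "space R = space A \<times> space C \<times> {0<..}"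
  using sets_eq_imp_space_eq[OF sets_R] by (simp add: space_pair_measure)

lemma nn_integral_R:
  assumes "F \<in> borel_measurable (A \<Otimes>\<^sub>M C \<Otimes>\<^sub>M pos_borel)"
  shows "(\<integral>\<^sup>+z. F z \<partial>R) = (\<integral>\<^sup>+w. F (Z w) \<partial>W)"
  unfolding R_def by (subst nn_integral_distr[OF Z]) (use assms in \<open>simp_all add: nn_integral_completion\<close>)

text \<open>Integrals over \<open>R\<close> become iterated integrals over \<open>P\<close> and \<open>\<kappa>\<close>, in which \<open>\<psi>\<close> no longer occurs. The marginals of
\<open>R\<close> and its blocks are special cases.\<close>

lemma nn_integral_R_coded:
  assumes [measurable]: "M \<in> sets A" "E \<in> sets borel" "K \<in> sets C" "h \<in> borel_measurable pos_borel"
    and E: "AE x in D. \<psi> x \<in> K \<longleftrightarrow> x \<in> E"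
  shows "(\<integral>\<^sup>+z. indicator M (fst z) * indicator K (fst (snd z)) * h (snd (snd z)) \<partial>R)
    = (\<integral>\<^sup>+z. indicator M (fst z) * (\<integral>\<^sup>+y. indicator E (fst y) * h (snd y * snd (snd z)) \<partial>\<kappa> (fst (snd z))) \<partial>P)"
proof -
  have [measurable]: "(\<lambda>w. h (snd (snd w) * snd (snd (fst w)))) \<in> borel_measurable (P \<Otimes>\<^sub>M N)"
    using measurable_compose[OF ts_W assms(4)] by (simp add: measurable_cong_sets[OF sets_W refl])
  have "(\<integral>\<^sup>+z. indicator M (fst z) * indicator K (fst (snd z)) * h (snd (snd z)) \<partial>R)
      = (\<integral>\<^sup>+w. indicator M (fst (fst w)) * indicator K (\<psi> (fst (snd w))) * h (snd (snd w) * snd (snd (fst w))) \<partial>W)"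
    by (subst nn_integral_R) (auto simp: Z_def)
  also have "\<dots> = (\<integral>\<^sup>+w. indicator M (fst (fst w)) * (indicator E (fst (snd w)) * h (snd (snd w) * snd (snd (fst w)))) \<partial>W)"
    using AE_W_coded[OF E] by (intro nn_integral_cong_AE) (auto elim!: eventually_mono simp: indicator_def mult.assoc)
  also have "\<dots> = (\<integral>\<^sup>+z. \<integral>\<^sup>+y. indicator M (fst z) * (indicator E (fst y) * h (snd y * snd (snd z))) \<partial>\<kappa> (fst (snd z)) \<partial>P)"
    by (subst nn_integral_W) auto
  also have "\<dots> = (\<integral>\<^sup>+z. indicator M (fst z) * (\<integral>\<^sup>+y. indicator E (fst y) * h (snd y * snd (snd z)) \<partial>\<kappa> (fst (snd z))) \<partial>P)"
    by (rule nn_integral_cong) (auto split: split_indicator)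
  finally show ?thesis .
qed

lemma emeasure_\<kappa>_space: "b \<in> space B \<Longrightarrow> (\<integral>\<^sup>+y. 1 \<partial>\<kappa> b) = 1"
proof -
  assume "b \<in> space B"
  then interpret prob_space "\<kappa> b" using measurable_space[OF \<kappa>] by (auto simp: space_prob_algebra)
  show ?thesis by (simp add: emeasure_space_1)
qed

text \<open>For the first marginal the kernels have mass one. For the second, \<open>t \<cdot> P\<close> projects to \<open>B\<close>, so the
factor \<open>t\<close> of \<open>s t\<close> is absorbed into integration over \<open>B\<close>, and what remains is the marginal of \<open>s \<cdot> Q\<close>.\<close>

lemma R_Pol: "R \<in> Pol A C"
proof -
  have e: "(\<lambda>(a, b, t). a) = (fst :: 'a \<times> 'c \<times> real \<Rightarrow> 'a)" "(\<lambda>(a, b, t). b) = (\<lambda>z. fst (snd z) :: 'c)"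
    "(\<lambda>(a, b, t). ennreal t) = (\<lambda>z::'a \<times> 'c \<times> real. ennreal (snd (snd z)))"
    by auto
  note [measurable_cong] = sets_R
  have [measurable]: "(\<lambda>z. ennreal (snd (snd z))) \<in> borel_measurable R"
    by (rule measurable_compose[OF measurable_pos_borelD measurable_ennreal]) measurable
  have top: "space C \<in> sets C" "AE x in D. \<psi> x \<in> space C \<longleftrightarrow> x \<in> UNIV"
    using measurable_space[OF \<psi>] by auto
  have "distr R A fst = A"
  proof (rule measure_eqI)
    fix M assume "M \<in> sets (distr R A fst)"
    then have M[measurable]: "M \<in> sets A" by simp
    have "emeasure (distr R A fst) M = (\<integral>\<^sup>+z. indicator M (fst z) \<partial>R)"
      using nn_integral_distr[of fst R A "indicator M"] by simp
    also have "\<dots> = (\<integral>\<^sup>+z. indicator M (fst z) * indicator (space C) (fst (snd z)) * 1 \<partial>R)"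
      by (rule nn_integral_cong) (auto simp: space_R split: split_indicator)
    also have "\<dots> = (\<integral>\<^sup>+z. indicator M (fst z) \<partial>P)"
      by (subst nn_integral_R_coded[OF M _ top(1) _ top(2)])
         (auto intro!: nn_integral_cong simp: emeasure_\<kappa>_space[simplified] space_Pol[OF P])
    also have "\<dots> = emeasure A M" by (subst nn_integral_Pol_fst[OF P]) auto
    finally show "emeasure (distr R A fst) M = emeasure A M" .
  qed simp
  moreover have "distr (density R (\<lambda>z. ennreal (snd (snd z)))) C (\<lambda>z. fst (snd z)) = C"
  proof (rule measure_eqI)
    fix K assume "K \<in> sets (distr (density R (\<lambda>z. ennreal (snd (snd z)))) C (\<lambda>z. fst (snd z)))"
    then have K[measurable]: "K \<in> sets C" by simp
    obtain E where E[measurable]: "E \<in> sets borel" and E': "AE x in D. \<psi> x \<in> K \<longleftrightarrow> x \<in> E"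
      using coded_set[OF K] by blast
    have id: "ennreal \<in> borel_measurable pos_borel"
      using measurable_compose[OF measurable_pos_borel_borel measurable_ennreal] by simp
    have "emeasure (distr (density R (\<lambda>z. ennreal (snd (snd z)))) C (\<lambda>z. fst (snd z))) K
        = (\<integral>\<^sup>+z. indicator K (fst (snd z)) \<partial>density R (\<lambda>z. ennreal (snd (snd z))))"
      using nn_integral_distr[of "\<lambda>z. fst (snd z)" "density R (\<lambda>z. ennreal (snd (snd z)))" C "indicator K"] by simp
    also have "\<dots> = (\<integral>\<^sup>+z. ennreal (snd (snd z)) * indicator K (fst (snd z)) \<partial>R)"
      by (rule nn_integral_density) auto
    also have "\<dots> = (\<integral>\<^sup>+z. indicator (space A) (fst z) * indicator K (fst (snd z)) * ennreal (snd (snd z)) \<partial>R)"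
      by (rule nn_integral_cong) (auto simp: space_R split: split_indicator)
    also have "\<dots> = (\<integral>\<^sup>+z. ennreal (snd (snd z)) * (\<integral>\<^sup>+y. indicator E (fst y) * ennreal (snd y) \<partial>\<kappa> (fst (snd z))) \<partial>P)"
    proof (subst nn_integral_R_coded[OF _ E K id E'], simp, rule nn_integral_cong)
      fix z assume z: "z \<in> space P"
      then have s: "sets (\<kappa> (fst (snd z))) = sets N"
        by (intro sets_kernel[OF \<kappa>']) (auto simp: space_Pol[OF P])
      then have sp: "space (\<kappa> (fst (snd z))) = space N" by (rule sets_eq_imp_space_eq)
      have "indicator (space A) (fst z) * (\<integral>\<^sup>+y. indicator E (fst y) * ennreal (snd y * snd (snd z)) \<partial>\<kappa> (fst (snd z)))
          = (\<integral>\<^sup>+y. ennreal (snd (snd z)) * (indicator E (fst y) * ennreal (snd y)) \<partial>\<kappa> (fst (snd z)))"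
      proof -
        have "ennreal (snd y * snd (snd z)) = ennreal (snd (snd z)) * ennreal (snd y)" if "y \<in> space (\<kappa> (fst (snd z)))" for y
          using that z by (subst mult.commute, intro ennreal_mult) (auto simp: sp space_Pol[OF P] space_pair_measure)
        moreover have "fst z \<in> space A" using z by (auto simp: space_Pol[OF P])
        ultimately show ?thesis
          by (simp, intro nn_integral_cong) (auto split: split_indicator)
      qed
      also have "\<dots> = ennreal (snd (snd z)) * (\<integral>\<^sup>+y. indicator E (fst y) * ennreal (snd y) \<partial>\<kappa> (fst (snd z)))"
        by (rule nn_integral_cmult) (simp add: measurable_cong_sets[OF s refl])
      finally show "indicator (space A) (fst z) * (\<integral>\<^sup>+y. indicator E (fst y) * ennreal (snd y * snd (snd z)) \<partial>\<kappa> (fst (snd z)))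
          = ennreal (snd (snd z)) * (\<integral>\<^sup>+y. indicator E (fst y) * ennreal (snd y) \<partial>\<kappa> (fst (snd z)))" .
    qed
    also have "\<dots> = (\<integral>\<^sup>+b. \<integral>\<^sup>+y. indicator E (fst y) * ennreal (snd y) \<partial>\<kappa> b \<partial>B)"
      using nn_integral_\<kappa>_measurable[of "\<lambda>w. indicator E (fst (snd w)) * ennreal (snd (snd w))"]
      by (subst nn_integral_Pol_snd[OF P]) auto
    also have "\<dots> = (\<integral>\<^sup>+z. indicator E (\<phi> (fst (snd z))) * ennreal (snd (snd z)) \<partial>Q)"
      using nn_integral_Q[of "\<lambda>w. indicator E (fst (snd w)) * ennreal (snd (snd w))"] by simp
    also have "\<dots> = (\<integral>\<^sup>+z. ennreal (snd (snd z)) * indicator K (fst (snd z)) \<partial>Q)"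
      using AE_Pol_snd[OF Q AE_coded_set[OF E']]
      by (intro nn_integral_cong_AE) (auto elim!: eventually_mono simp: indicator_def)
    also have "\<dots> = emeasure C K" by (subst nn_integral_Pol_snd[OF Q]) auto
    finally show "emeasure (distr (density R (\<lambda>z. ennreal (snd (snd z)))) C (\<lambda>z. fst (snd z))) K = emeasure C K" .
  qed simp
  ultimately show ?thesis unfolding Pol_def e by (simp add: sets_R)
qed

text \<open>A block density \<open>q b\<close> of \<open>Q\<close> is the law of \<open>s\<close> under \<open>\<kappa> b\<close> restricted to codes of points of \<open>K\<close>. With this choice
both sides are the integral over \<open>(a, b, t)\<close>, \<open>a \<in> M\<close>, of the \<open>\<kappa> b\<close>-measure of \<open>c \<in> K, s t \<in> S\<close>.\<close>

lemma R_is_pol_comp: "is_pol_comp A B C Q P R"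
  unfolding is_pol_comp_def
proof (intro conjI ballI R_Pol)
  fix M K assume M[measurable]: "M \<in> sets A" and K[measurable]: "K \<in> sets C"
  interpret B: finite_measure B by (rule B)
  obtain E where E[measurable]: "E \<in> sets borel" and E': "AE x in D. \<psi> x \<in> K \<longleftrightarrow> x \<in> E"
    using coded_set[OF K] by blast
  obtain p where p: "is_block_density B (\<lambda>N. pol_block P M N) p"
    and p_int: "\<And>h. h \<in> borel_measurable (B \<Otimes>\<^sub>M pos_borel) \<Longrightarrow>
      (\<integral>\<^sup>+b. \<integral>\<^sup>+t. h (b, t) \<partial>p b \<partial>B) = (\<integral>\<^sup>+z. indicator M (fst z) * h (snd z) \<partial>P)"
    using pol_block_density_exists[OF P A B B_ne M] by blast
  define q where "q b = distr (density (\<kappa> b) (\<lambda>y. indicator E (fst y))) pos_borel snd" for b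
  have s\<kappa>: "sets (\<kappa> b) = sets N" if "b \<in> space B" for b using sets_kernel[OF \<kappa>' that] .
  have q_int: "(\<integral>\<^sup>+s. h s \<partial>q b) = (\<integral>\<^sup>+y. indicator E (fst y) * h (snd y) \<partial>\<kappa> b)"
    if b: "b \<in> space B" and [measurable]: "h \<in> borel_measurable pos_borel" for b h
  proof -
    have [measurable]: "snd \<in> \<kappa> b \<rightarrow>\<^sub>M pos_borel" "fst \<in> borel_measurable (\<kappa> b)"
      by (simp_all add: measurable_cong_sets[OF s\<kappa>[OF b] refl])
    show ?thesis unfolding q_def by (simp add: nn_integral_distr nn_integral_density)
  qed
  have q_em: "emeasure (q b) S = (\<integral>\<^sup>+y. indicator E (fst y) * indicator S (snd y) \<partial>\<kappa> b)"
    if "b \<in> space B" "S \<in> sets pos_borel" for b S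
    using q_int[OF that(1), of "indicator S"] that(2) by (simp add: q_def)
  have q_tri: "AE b in B. q b \<in> M_tri"
  proof -
    have G: "(\<lambda>w. indicator E (fst (snd w)) * ennreal (snd (snd w))) \<in> borel_measurable (B \<Otimes>\<^sub>M N)"
      by measurable
    have "(\<integral>\<^sup>+b. \<integral>\<^sup>+y. indicator E (fst y) * ennreal (snd y) \<partial>\<kappa> b \<partial>B)
        = (\<integral>\<^sup>+z. indicator E (\<phi> (fst (snd z))) * ennreal (snd (snd z)) \<partial>Q)"
      using nn_integral_Q[OF G] by simp
    also have "\<dots> \<le> (\<integral>\<^sup>+z. ennreal (snd (snd z)) * 1 \<partial>Q)"
      by (rule nn_integral_mono) (auto split: split_indicator)
    also have "\<dots> = emeasure C (space C)" by (subst nn_integral_Pol_snd[OF Q]) auto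
    also have "\<dots> < \<infinity>" using finite_measure.emeasure_finite[OF C] by (simp add: less_top[symmetric])
    finally have "AE b in B. (\<integral>\<^sup>+y. indicator E (fst y) * ennreal (snd y) \<partial>\<kappa> b) \<noteq> \<infinity>"
      using nn_integral_\<kappa>_measurable[OF G] by (intro nn_integral_PInf_AE) auto
    with AE_space show ?thesis
    proof eventually_elim
      case (elim b)
      have id: "ennreal \<in> borel_measurable pos_borel"
        using measurable_compose[OF measurable_pos_borel_borel measurable_ennreal] by simp
      have "emeasure (q b) (space (q b)) = (\<integral>\<^sup>+s. 1 \<partial>q b)" by simp
      also have "\<dots> = (\<integral>\<^sup>+y. indicator E (fst y) * 1 \<partial>\<kappa> b)" by (rule q_int[OF elim(1)]) simp
      also have "\<dots> \<le> (\<integral>\<^sup>+y. 1 \<partial>\<kappa> b)" by (rule nn_integral_mono) (auto split: split_indicator)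
      also have "\<dots> < \<infinity>" by (subst emeasure_\<kappa>_space[OF elim(1)]) simp
      finally show ?case
        using elim q_int[OF elim(1) id] by (simp add: M_tri_def less_top) (simp add: q_def)
    qed
  qed
  have q: "is_block_density B (\<lambda>N. pol_block Q N K) q"
    unfolding is_block_density_def
  proof (intro conjI ballI q_tri)
    fix S assume S[measurable]: "S \<in> sets pos_borel"
    have "(\<lambda>b. \<integral>\<^sup>+y. indicator E (fst y) * indicator S (snd y) \<partial>\<kappa> b) \<in> borel_measurable B"
      using nn_integral_\<kappa>_measurable[of "\<lambda>w. indicator E (fst (snd w)) * indicator S (snd (snd w))"] by simp
    then show "(\<lambda>b. emeasure (q b) S) \<in> borel_measurable B"
      by (subst measurable_cong[OF q_em[OF _ S]])
    fix X assume X[measurable]: "X \<in> sets B"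
    have "emeasure (pol_block Q X K) S
        = (\<integral>\<^sup>+z. indicator X (fst z) * indicator K (fst (snd z)) * indicator S (snd (snd z)) \<partial>Q)"
      by (rule emeasure_pol_block[OF Q X K S])
    also have "\<dots> = (\<integral>\<^sup>+z. indicator X (fst z) * (indicator E (\<phi> (fst (snd z))) * indicator S (snd (snd z))) \<partial>Q)"
      using AE_Pol_snd[OF Q AE_coded_set[OF E']]
      by (intro nn_integral_cong_AE) (auto elim!: eventually_mono simp: indicator_def)
    also have "\<dots> = (\<integral>\<^sup>+b. \<integral>\<^sup>+y. indicator X b * (indicator E (fst y) * indicator S (snd y)) \<partial>\<kappa> b \<partial>B)"
      using nn_integral_Q[of "\<lambda>w. indicator X (fst w) * (indicator E (fst (snd w)) * indicator S (snd (snd w)))"] by simp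
    also have "\<dots> = (\<integral>\<^sup>+b\<in>X. emeasure (q b) S \<partial>B)"
      by (rule nn_integral_cong) (auto simp: q_em S split: split_indicator)
    finally show "emeasure (pol_block Q X K) S = (\<integral>\<^sup>+b\<in>X. emeasure (q b) S \<partial>B)" .
  qed
  show "\<exists>p q. is_block_density B (pol_block P M) p \<and> is_block_density B (\<lambda>N. pol_block Q N K) q \<and>
      (\<forall>S\<in>sets pos_borel. emeasure (pol_block R M K) S = (\<integral>\<^sup>+b. emeasure (mult_conv (q b) (p b)) S \<partial>B))"
  proof (intro exI conjI ballI)
    fix S assume S[measurable]: "S \<in> sets pos_borel"
    define G where "G w = (\<integral>\<^sup>+y. indicator E (fst y) * indicator S (snd y * snd w) \<partial>\<kappa> (fst w))" for w :: "'b \<times> real"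
    have ms: "(\<lambda>v. snd (snd v) * snd (fst v)) \<in> (B \<Otimes>\<^sub>M pos_borel) \<Otimes>\<^sub>M N \<rightarrow>\<^sub>M pos_borel"
      by (rule measurable_mult_pos_borel) measurable
    have \<kappa>_fst: "(\<lambda>w. \<kappa> (fst w)) \<in> B \<Otimes>\<^sub>M pos_borel \<rightarrow>\<^sub>M subprob_algebra N" by measurable
    have [measurable]: "(\<lambda>v. indicator S (snd (snd v) * snd (fst v)) :: ennreal) \<in> borel_measurable ((B \<Otimes>\<^sub>M pos_borel) \<Otimes>\<^sub>M N)"
      by (rule measurable_compose[OF ms]) simp
    have G_meas: "G \<in> borel_measurable (B \<Otimes>\<^sub>M pos_borel)"
      unfolding G_def
      by (rule nn_integral_measurable_subprob_algebra2[OF _ \<kappa>_fst]) (unfold case_prod_beta, measurable)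
    have "emeasure (pol_block R M K) S
        = (\<integral>\<^sup>+z. indicator M (fst z) * indicator K (fst (snd z)) * indicator S (snd (snd z)) \<partial>R)"
      by (rule emeasure_pol_block[OF R_Pol M K S])
    also have "\<dots> = (\<integral>\<^sup>+z. indicator M (fst z) * G (snd z) \<partial>P)"
      unfolding G_def by (rule nn_integral_R_coded[OF M E K _ E']) simp
    also have "\<dots> = (\<integral>\<^sup>+b. \<integral>\<^sup>+t. G (b, t) \<partial>p b \<partial>B)" by (rule p_int[OF G_meas, symmetric])
    also have "\<dots> = (\<integral>\<^sup>+b. emeasure (mult_conv (q b) (p b)) S \<partial>B)"
    proof (rule nn_integral_cong_AE)
      have "AE b in B. p b \<in> M_tri" using p by (auto simp: is_block_density_def)
      with q_tri AE_space show "AE b in B. (\<integral>\<^sup>+t. G (b, t) \<partial>p b) = emeasure (mult_conv (q b) (p b)) S"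
      proof eventually_elim
        case (elim b)
        have "space (p b) = {0<..}" using elim sets_eq_imp_space_eq[of "p b" pos_borel] by (simp add: M_tri_def)
        moreover have "G (b, t) = (\<integral>\<^sup>+s. indicator S (s * t) \<partial>q b)" if "0 < t" for t
        proof -
          have "(\<lambda>s. s * t) \<in> pos_borel \<rightarrow>\<^sub>M pos_borel"
            by (rule measurable_mult_pos_borel) (use that in auto)
          then have "(\<lambda>s. indicator S (s * t) :: ennreal) \<in> borel_measurable pos_borel"
            by measurable
          then show ?thesis unfolding G_def using q_int[OF elim(2)] by simp
        qed
        ultimately show ?case
          using elim by (subst emeasure_mult_conv) (auto intro!: nn_integral_cong)
      qed
    qed
    finally show "emeasure (pol_block R M K) S = (\<integral>\<^sup>+b. emeasure (mult_conv (q b) (p b)) S \<partial>B)" .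
  qed (use p q in auto)
qed

lemma pol_comp_eq_R: "pol_comp A B C Q P = R"
  unfolding pol_comp_def
  using R_is_pol_comp is_pol_comp_unique[OF A B] by (intro the_equality) blast+

end

section \<open>Densities of complex measures\<close>

text \<open>The four functions \<open>cpart 0, \<dots>, cpart 3\<close> are the positive and negative parts of the real and imaginary
parts, so that \<open>w\<close> is the sum of \<open>\<i>\<^sup>j cpart j w\<close>. They reduce complex densities to positive measures.\<close>

definition cpart :: "nat \<Rightarrow> complex \<Rightarrow> real" where
  "cpart j w = max 0 (Re (w * (- \<i>) ^ j))"

lemma cpart_nonneg: "0 \<le> cpart j w"
  by (simp add: cpart_def)

lemma cpart_le_norm: "cpart j w \<le> norm w"
proof -
  have "Re (w * (- \<i>) ^ j) \<le> norm (w * (- \<i>) ^ j)" by (rule complex_Re_le_cmod)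
  then show ?thesis by (simp add: cpart_def norm_mult norm_power)
qed

lemma cpart_sum: "(\<Sum>j<4. \<i> ^ j * complex_of_real (cpart j w)) = w"
  by (simp add: cpart_def numeral_eq_Suc complex_eq_iff max_def)

lemma measurable_cpart[measurable]: "cpart j \<in> borel_measurable borel"
  unfolding cpart_def by measurable

text \<open>If the density of each part of \<open>F\<close> pushed forward along \<open>\<pi>\<close> is \<open>h j\<close>, then the combination of the \<open>h j\<close> is the
conditional expectation of \<open>F\<close> given \<open>\<pi>\<close>. It may be tested against every \<open>f\<close> for which the product is
integrable, not only against bounded ones.\<close>

lemma integral_density_transfer:
  fixes F :: "'w \<Rightarrow> complex" and h :: "nat \<Rightarrow> 'p \<Rightarrow> real"
  assumes [measurable]: "\<pi> \<in> W \<rightarrow>\<^sub>M P" "F \<in> borel_measurable W" "\<And>j. h j \<in> borel_measurable P"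
    and h_nonneg: "\<And>j x. 0 \<le> h j x"
    and dens: "\<And>j. distr (density W (\<lambda>w. ennreal (cpart j (F w)))) P \<pi> = density P (\<lambda>x. ennreal (h j x))"
    and [measurable]: "f \<in> borel_measurable P" and int: "integrable W (\<lambda>w. f (\<pi> w) * F w)"
  shows "integrable P (\<lambda>x. f x * (\<Sum>j<4. \<i> ^ j * complex_of_real (h j x)))"
    and "(\<integral>x. f x * (\<Sum>j<4. \<i> ^ j * complex_of_real (h j x)) \<partial>P) = (\<integral>w. f (\<pi> w) * F w \<partial>W)"
proof -
  have intW: "integrable W (\<lambda>w. cpart j (F w) *\<^sub>R f (\<pi> w))" for j
  proof (rule Bochner_Integration.integrable_bound[OF int])
    show "AE w in W. norm (cpart j (F w) *\<^sub>R f (\<pi> w)) \<le> norm (f (\<pi> w) * F w)"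
      using cpart_le_norm[of j "F _"]
      by (auto simp: norm_mult cpart_nonneg mult.commute[of "norm (f _)"] intro!: mult_right_mono)
  qed simp
  have intP: "integrable P (\<lambda>x. h j x *\<^sub>R f x)" for j
  proof -
    have "integrable (density W (\<lambda>w. ennreal (cpart j (F w)))) (\<lambda>w. f (\<pi> w))"
      by (subst integrable_density) (auto simp: cpart_nonneg intW)
    then have "integrable (distr (density W (\<lambda>w. ennreal (cpart j (F w)))) P \<pi>) f"
      by (subst integrable_distr_eq) auto
    then show ?thesis
      unfolding dens by (subst (asm) integrable_density) (auto simp: h_nonneg)
  qed
  have eq: "(\<integral>x. h j x *\<^sub>R f x \<partial>P) = (\<integral>w. cpart j (F w) *\<^sub>R f (\<pi> w) \<partial>W)" for j
  proof -
    have "(\<integral>x. h j x *\<^sub>R f x \<partial>P) = (\<integral>x. f x \<partial>density P (\<lambda>x. ennreal (h j x)))"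
      by (rule integral_density[symmetric]) (auto simp: h_nonneg)
    also have "\<dots> = (\<integral>w. f (\<pi> w) \<partial>density W (\<lambda>w. ennreal (cpart j (F w))))"
      unfolding dens[symmetric] by (rule integral_distr) auto
    also have "\<dots> = (\<integral>w. cpart j (F w) *\<^sub>R f (\<pi> w) \<partial>W)"
      by (rule integral_density) (auto simp: cpart_nonneg)
    finally show ?thesis .
  qed
  have e1: "f x * (\<Sum>j<4. \<i> ^ j * complex_of_real (h j x)) = (\<Sum>j<4. \<i> ^ j * (h j x *\<^sub>R f x))" for x
    by (simp add: sum_distrib_left scaleR_conv_of_real mult_ac)
  have e2: "f (\<pi> w) * F w = (\<Sum>j<4. \<i> ^ j * (cpart j (F w) *\<^sub>R f (\<pi> w)))" for w
    by (subst cpart_sum[of "F w", symmetric]) (simp add: sum_distrib_left scaleR_conv_of_real mult_ac)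
  show "integrable P (\<lambda>x. f x * (\<Sum>j<4. \<i> ^ j * complex_of_real (h j x)))"
    unfolding e1 by (intro Bochner_Integration.integrable_sum integrable_mult_right intP)
  have "(\<integral>x. f x * (\<Sum>j<4. \<i> ^ j * complex_of_real (h j x)) \<partial>P) = (\<Sum>j<4. \<i> ^ j * (\<integral>x. h j x *\<^sub>R f x \<partial>P))"
    unfolding e1
    by (subst Bochner_Integration.integral_sum)
       (simp_all only: integral_mult_right_zero integrable_mult_right[OF intP])
  also have "\<dots> = (\<Sum>j<4. \<i> ^ j * (\<integral>w. cpart j (F w) *\<^sub>R f (\<pi> w) \<partial>W))" by (simp only: eq)
  also have "\<dots> = (\<integral>w. f (\<pi> w) * F w \<partial>W)"
    unfolding e2
    by (subst Bochner_Integration.integral_sum)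
       (simp_all only: integral_mult_right_zero integrable_mult_right[OF intW])
  finally show "(\<integral>x. f x * (\<Sum>j<4. \<i> ^ j * complex_of_real (h j x)) \<partial>P) = (\<integral>w. f (\<pi> w) * F w \<partial>W)" .
qed

lemma complex_pushforward_density:
  fixes F :: "'w \<Rightarrow> complex"
  assumes A: "finite_measure A" and \<pi>[measurable]: "\<pi> \<in> W \<rightarrow>\<^sub>M A"
    and ac: "\<And>X. X \<in> null_sets A \<Longrightarrow> AE w in W. \<pi> w \<notin> X" and F: "integrable W F"
  obtains h :: "nat \<Rightarrow> 'a \<Rightarrow> real" where "\<And>j. h j \<in> borel_measurable A" "\<And>j x. 0 \<le> h j x"
    "\<And>j. distr (density W (\<lambda>w. ennreal (cpart j (F w)))) A \<pi> = density A (\<lambda>x. ennreal (h j x))"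
proof -
  have [measurable]: "F \<in> borel_measurable W" using F by auto
  have "\<exists>h. h \<in> borel_measurable A \<and> (\<forall>x. 0 \<le> h x) \<and>
      distr (density W (\<lambda>w. ennreal (cpart j (F w)))) A \<pi> = density A (\<lambda>x. ennreal (h x))" for j
  proof -
    have m: "(\<lambda>w. ennreal (cpart j (F w))) \<in> borel_measurable W" by measurable
    obtain h0 where h0[measurable]: "h0 \<in> borel_measurable A"
      and eq: "density A h0 = distr (density W (\<lambda>w. ennreal (cpart j (F w)))) A \<pi>"
      using Radon_Nikodym_pushforward[OF A \<pi> m ac] by blast
    have "(\<integral>\<^sup>+x. h0 x \<partial>A) = emeasure (density A h0) (space A)"
      by (simp add: emeasure_density nn_integral_cong[of A "\<lambda>x. h0 x * indicator (space A) x" h0])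
    also have "\<dots> = emeasure (density W (\<lambda>w. ennreal (cpart j (F w)))) (space W)"
      unfolding eq using measurable_space[OF \<pi>]
      by (subst emeasure_distr) (auto intro!: arg_cong2[where f=emeasure])
    also have "\<dots> = (\<integral>\<^sup>+w. ennreal (cpart j (F w)) \<partial>W)"
      by (subst emeasure_density) (auto intro!: nn_integral_cong)
    also have "\<dots> \<le> (\<integral>\<^sup>+w. ennreal (norm (F w)) \<partial>W)"
      by (intro nn_integral_mono ennreal_leI cpart_le_norm)
    also have "\<dots> < \<infinity>" using F by (simp add: integrable_iff_bounded)
    finally have "AE x in A. h0 x \<noteq> \<infinity>" by (intro nn_integral_PInf_AE) auto
    then have "density A h0 = density A (\<lambda>x. ennreal (enn2real (h0 x)))"
      by (intro density_cong) (auto elim!: eventually_mono simp: less_top)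
    with eq show ?thesis by (intro exI[of _ "\<lambda>x. enn2real (h0 x)"]) auto
  qed
  then show ?thesis using that by metis
qed

section \<open>Duality between the function spaces\<close>

text \<open>\<open>Lv v M\<close> is \<open>L\<^bsup>1/v\<^esup>\<close>; the exponents \<open>1/v\<close> and \<open>1/(1-v)\<close> are conjugate.\<close>

abbreviation Lv :: "real \<Rightarrow> 'a measure \<Rightarrow> ('a \<Rightarrow> complex) set" where
  "Lv v M \<equiv> Lp_fun (1 / ennreal v) M"

lemma Lv_0: "f \<in> Lv 0 M \<longleftrightarrow> f \<in> borel_measurable M \<and> (\<exists>c. AE x in M. norm (f x) \<le> c)"
proof -
  have "(1::ennreal) / ennreal 0 = \<infinity>" by (simp add: ennreal_divide_zero)
  then show ?thesis by (simp add: Lp_fun_def)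
qed

lemma Lv_pos: "0 < v \<Longrightarrow> f \<in> Lv v M \<longleftrightarrow>
  f \<in> borel_measurable M \<and> (\<integral>\<^sup>+x. ennreal (norm (f x) powr (1 / v)) \<partial>M) < \<infinity>"
proof -
  assume "0 < v"
  then have "1 / ennreal v = ennreal (1 / v)"
    using divide_ennreal[of 1 v] by simp
  then show ?thesis using \<open>0 < v\<close> by (simp add: Lp_fun_def)
qed

lemma Lv_measurable: "f \<in> Lv v M \<Longrightarrow> f \<in> borel_measurable M"
  by (simp add: Lp_fun_def)

lemma Lv_bounded:
  assumes M: "finite_measure M" and v: "0 \<le> v" and f[measurable]: "f \<in> borel_measurable M"
    and c: "\<And>x. norm (f x) \<le> c"
  shows "f \<in> Lv v M"
proof (cases "v = 0")
  case True
  then show ?thesis using f c by (auto simp only: Lv_0 intro!: exI[of _ c] AE_I2)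
next
  case False
  interpret finite_measure M by fact
  have "(\<integral>\<^sup>+x. ennreal (norm (f x) powr (1 / v)) \<partial>M) \<le> (\<integral>\<^sup>+x. ennreal (c powr (1 / v)) \<partial>M)"
    using v by (intro nn_integral_mono ennreal_leI powr_mono2 c) auto
  also have "\<dots> < \<infinity>" by (simp add: less_top[symmetric] ennreal_mult_eq_top_iff)
  finally show ?thesis using False v by (simp add: Lv_pos f)
qed

lemma Lv_integrable:
  assumes M: "finite_measure M" and v: "0 \<le> v" "v \<le> 1" and f: "f \<in> Lv v M"
  shows "integrable M f"
proof (cases "v = 0")
  interpret finite_measure M by fact
  case True
  then show ?thesis using f Lv_0 integrable_const_bound by blast
next
  interpret finite_measure M by fact
  case False
  then have pos: "0 < v" using v by simp
  have [measurable]: "f \<in> borel_measurable M" using f by (rule Lv_measurable)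
  have "x \<le> 1 + x powr (1 / v)" if "0 \<le> x" for x :: real
  proof (cases "x \<le> 1")
    case False
    then have "x powr 1 \<le> x powr (1 / v)" using pos v by (intro powr_mono) auto
    then show ?thesis using False by simp
  qed (simp add: add_increasing2)
  then have "(\<integral>\<^sup>+x. ennreal (norm (f x)) \<partial>M) \<le> (\<integral>\<^sup>+x. 1 + ennreal (norm (f x) powr (1 / v)) \<partial>M)"
    by (intro nn_integral_mono) (simp add: ennreal_plus[symmetric] ennreal_1[symmetric] del: ennreal_plus ennreal_1)
  also have "\<dots> = emeasure M (space M) + (\<integral>\<^sup>+x. ennreal (norm (f x) powr (1 / v)) \<partial>M)"
    by (subst nn_integral_add) auto
  also have "\<dots> < \<infinity>" using f pos by (simp add: Lv_pos less_top[symmetric])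
  finally show ?thesis by (intro integrableI_bounded) auto
qed

lemma weighted_Young:
  fixes x y v :: real
  assumes "0 \<le> x" "0 \<le> y" "0 \<le> v" "v \<le> 1"
  shows "x powr (1 - v) * y powr v \<le> (1 - v) * x + v * y"
proof (cases "x = 0 \<or> y = 0")
  case True
  then show ?thesis using assms by auto
next
  case False
  then have "0 < x" "0 < y" using assms by auto
  then show ?thesis using assms Youngs_inequality_0[of "1 - v" v x y] by simp
qed

lemma Lp_rel_equiv: "equiv (Lp_fun p M) (Lp_rel p M)"
proof (rule equivI)
  show "Lp_rel p M \<subseteq> Lp_fun p M \<times> Lp_fun p M" by (auto simp: Lp_rel_def)
  show "refl_on (Lp_fun p M) (Lp_rel p M)" by (auto simp: Lp_rel_def refl_on_def)
  show "sym (Lp_rel p M)" by (auto simp: Lp_rel_def sym_def elim!: eventually_mono)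
  show "trans (Lp_rel p M)" by (auto simp: Lp_rel_def trans_def elim!: eventually_elim2)
qed

lemma norm_of_real_powr: "0 < t \<Longrightarrow> norm (complex_of_real t powr u) = t powr Re u"
  using norm_powr_real_powr[of "complex_of_real t" u] by simp

lemma measurable_powr_pos_borel:
  fixes u :: complex
  assumes f: "f \<in> M \<rightarrow>\<^sub>M pos_borel"
  shows "(\<lambda>x. complex_of_real (f x) powr u) \<in> borel_measurable M"
proof -
  note [measurable] = measurable_pos_borelD[OF f]
  have "complex_of_real (f x) powr u = exp (u * complex_of_real (ln (f x)))" if "x \<in> space M" for x
    using measurable_space[OF f that] by (simp add: powr_def Ln_of_real)
  then show ?thesis by (subst measurable_cong) auto
qed

text \<open>Young's inequality in the form
\<open>|f(a)| |g(b)| t\<^sup>v \<le> |f(a)|\<^bsup>1/(1-v)\<^esup> + t |g(b)|\<^bsup>1/v\<^esup>\<close> bounds the integrand by a function of \<open>a\<close> plus \<open>t\<close> times a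
function of \<open>b\<close>, and these integrate to the two marginals. At the end points \<open>v = 0\<close> and \<open>v = 1\<close> one of the functions is
essentially bounded and the bound is immediate.\<close>

lemma Pol_pairing_integrable:
  assumes P: "P \<in> Pol A B" and v: "0 \<le> Re u" "Re u \<le> 1"
    and f: "f \<in> Lv (1 - Re u) A" and g: "g \<in> Lv (Re u) B"
    and fin: "finite_measure A" "finite_measure B"
  shows "integrable P (\<lambda>z. f (fst z) * (g (fst (snd z)) * complex_of_real (snd (snd z)) powr u))"
proof -
  note [measurable] = measurable_Pol[OF P] Lv_measurable[OF f] Lv_measurable[OF g]
    measurable_powr_pos_borel[OF measurable_Pol(3)[OF P]]
  define v where "v = Re u"
  have v: "0 \<le> v" "v \<le> 1" using v by (simp_all add: v_def)
  have "\<exists>F G. F \<in> borel_measurable A \<and> G \<in> borel_measurable B \<and> (\<integral>\<^sup>+a. ennreal (F a) \<partial>A) < \<infinity> \<and> (\<integral>\<^sup>+b. ennreal (G b) \<partial>B) < \<infinity> \<and>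
    (\<forall>a. 0 \<le> F a) \<and> (\<forall>b. 0 \<le> G b) \<and>
    (AE z in P. norm (f (fst z)) * norm (g (fst (snd z))) * snd (snd z) powr v \<le> F (fst z) + snd (snd z) * G (fst (snd z)))"
  proof -
    consider "v = 0" | "v = 1" | "0 < v" "v < 1" using v by linarith
    then show ?thesis
    proof cases
      case 1
      then obtain c where c: "AE b in B. norm (g b) \<le> c" using g unfolding v_def by (auto simp only: Lv_0)
      have f1: "(\<integral>\<^sup>+a. ennreal (norm (f a)) \<partial>A) < \<infinity>"
        using f 1 unfolding v_def by (subst (asm) Lv_pos) auto
      have "(\<integral>\<^sup>+a. ennreal (\<bar>c\<bar> * norm (f a)) \<partial>A) = ennreal \<bar>c\<bar> * (\<integral>\<^sup>+a. ennreal (norm (f a)) \<partial>A)"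
        by (subst nn_integral_cmult[symmetric]) (auto simp: ennreal_mult)
      also have "\<dots> < \<infinity>" using f1 by (simp add: ennreal_mult_less_top)
      finally have F: "(\<integral>\<^sup>+a. ennreal (\<bar>c\<bar> * norm (f a)) \<partial>A) < \<infinity>" .
      have "AE z in P. norm (f (fst z)) * norm (g (fst (snd z))) * snd (snd z) powr v \<le> \<bar>c\<bar> * norm (f (fst z)) + snd (snd z) * 0"
        using AE_Pol_snd[OF P c] AE_space
      proof eventually_elim
        case (elim z)
        then have "norm (f (fst z)) * norm (g (fst (snd z))) \<le> norm (f (fst z)) * \<bar>c\<bar>"
          by (intro mult_left_mono) auto
        then show ?case using 1 elim by (auto simp: space_Pol[OF P] mult.commute)
      qed
      with F show ?thesis
        by (intro exI[of _ "\<lambda>a. \<bar>c\<bar> * norm (f a)"] exI[of _ "\<lambda>_. 0"]) auto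
    next
      case 2
      then obtain c where c: "AE a in A. norm (f a) \<le> c" using f unfolding v_def by (auto simp: Lv_0[simplified])
      have g1: "(\<integral>\<^sup>+b. ennreal (norm (g b)) \<partial>B) < \<infinity>"
        using g 2 unfolding v_def by (subst (asm) Lv_pos) auto
      have "(\<integral>\<^sup>+b. ennreal (\<bar>c\<bar> * norm (g b)) \<partial>B) = ennreal \<bar>c\<bar> * (\<integral>\<^sup>+b. ennreal (norm (g b)) \<partial>B)"
        by (subst nn_integral_cmult[symmetric]) (auto simp: ennreal_mult)
      also have "\<dots> < \<infinity>" using g1 by (simp add: ennreal_mult_less_top)
      finally have G: "(\<integral>\<^sup>+b. ennreal (\<bar>c\<bar> * norm (g b)) \<partial>B) < \<infinity>" .
      have "AE z in P. norm (f (fst z)) * norm (g (fst (snd z))) * snd (snd z) powr v \<le> 0 + snd (snd z) * (\<bar>c\<bar> * norm (g (fst (snd z))))"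
        using AE_Pol_fst[OF P c] AE_space
      proof eventually_elim
        case (elim z)
        then have "norm (f (fst z)) * (norm (g (fst (snd z))) * snd (snd z)) \<le> \<bar>c\<bar> * (norm (g (fst (snd z))) * snd (snd z))"
          by (intro mult_right_mono) (auto simp: space_Pol[OF P])
        then show ?case using 2 elim by (auto simp: space_Pol[OF P] mult_ac)
      qed
      with G show ?thesis
        by (intro exI[of _ "\<lambda>_. 0"] exI[of _ "\<lambda>b. \<bar>c\<bar> * norm (g b)"]) auto
    next
      case 3
      have f1: "(\<integral>\<^sup>+a. ennreal (norm (f a) powr (1 / (1 - v))) \<partial>A) < \<infinity>"
        using f 3 unfolding v_def by (subst (asm) Lv_pos) auto
      have g1: "(\<integral>\<^sup>+b. ennreal (norm (g b) powr (1 / v)) \<partial>B) < \<infinity>"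
        using g 3 unfolding v_def by (subst (asm) Lv_pos) auto
      have "AE z in P. norm (f (fst z)) * norm (g (fst (snd z))) * snd (snd z) powr v
        \<le> norm (f (fst z)) powr (1 / (1 - v)) + snd (snd z) * (norm (g (fst (snd z))) powr (1 / v))"
        using AE_space
      proof eventually_elim
        case (elim z)
        define x where "x = norm (f (fst z)) powr (1 / (1 - v))"
        define y where "y = norm (g (fst (snd z))) powr (1 / v) * snd (snd z)"
        have t: "0 < snd (snd z)" using elim by (auto simp: space_Pol[OF P])
        have "x powr (1 - v) = norm (f (fst z))" using 3 by (simp add: x_def powr_powr)
        moreover have "y powr v = norm (g (fst (snd z))) * snd (snd z) powr v"
          using 3 t by (simp add: y_def powr_powr powr_mult)
        ultimately have "norm (f (fst z)) * norm (g (fst (snd z))) * snd (snd z) powr v = x powr (1 - v) * y powr v"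
          by simp
        also have "\<dots> \<le> (1 - v) * x + v * y"
          using 3 t by (intro weighted_Young) (auto simp: x_def y_def)
        also have "\<dots> \<le> x + y"
          using 3 t by (intro add_mono mult_left_le_one_le) (auto simp: x_def y_def)
        finally show ?case by (simp add: x_def y_def mult.commute)
      qed
      with f1 g1 show ?thesis
        by (intro exI[of _ "\<lambda>a. norm (f a) powr (1 / (1 - v))"] exI[of _ "\<lambda>b. norm (g b) powr (1 / v)"]) auto
    qed
  qed
  then obtain F :: "'a \<Rightarrow> real" and G :: "'b \<Rightarrow> real" where
    FG: "F \<in> borel_measurable A" "G \<in> borel_measurable B"
    and F: "(\<integral>\<^sup>+a. ennreal (F a) \<partial>A) < \<infinity>" and G: "(\<integral>\<^sup>+b. ennreal (G b) \<partial>B) < \<infinity>"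
    and nn: "\<And>a. 0 \<le> F a" "\<And>b. 0 \<le> G b"
    and le: "AE z in P. norm (f (fst z)) * norm (g (fst (snd z))) * snd (snd z) powr v \<le> F (fst z) + snd (snd z) * G (fst (snd z))"
    by (elim exE conjE) (rule that, simp_all)
  note [measurable] = FG
  show ?thesis
  proof (rule integrableI_bounded)
    have "(\<integral>\<^sup>+z. ennreal (norm (f (fst z) * (g (fst (snd z)) * complex_of_real (snd (snd z)) powr u))) \<partial>P)
      \<le> (\<integral>\<^sup>+z. ennreal (F (fst z)) + ennreal (snd (snd z)) * ennreal (G (fst (snd z))) \<partial>P)"
    proof (rule nn_integral_mono_AE)
      show "AE z in P. ennreal (norm (f (fst z) * (g (fst (snd z)) * complex_of_real (snd (snd z)) powr u)))
          \<le> ennreal (F (fst z)) + ennreal (snd (snd z)) * ennreal (G (fst (snd z)))"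
        using le AE_space
      proof eventually_elim
        case (elim z)
        then have t: "0 < snd (snd z)" by (auto simp: space_Pol[OF P])
        then have "norm (f (fst z) * (g (fst (snd z)) * complex_of_real (snd (snd z)) powr u)) \<le> F (fst z) + snd (snd z) * G (fst (snd z))"
          using elim by (simp add: norm_mult norm_of_real_powr v_def mult.assoc)
        then have "ennreal (norm (f (fst z) * (g (fst (snd z)) * complex_of_real (snd (snd z)) powr u))) \<le> ennreal (F (fst z) + snd (snd z) * G (fst (snd z)))"
          by (rule ennreal_leI)
        also have "\<dots> = ennreal (F (fst z)) + ennreal (snd (snd z)) * ennreal (G (fst (snd z)))"
          using t nn by (simp add: ennreal_plus ennreal_mult)
        finally show ?case .
      qed
    qed
    also have "\<dots> = (\<integral>\<^sup>+z. ennreal (F (fst z)) \<partial>P) + (\<integral>\<^sup>+z. ennreal (snd (snd z)) * ennreal (G (fst (snd z))) \<partial>P)"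
      by (rule nn_integral_add) auto
    also have "\<dots> = (\<integral>\<^sup>+a. ennreal (F a) \<partial>A) + (\<integral>\<^sup>+b. ennreal (G b) \<partial>B)"
      by (subst nn_integral_Pol_fst[OF P], simp, subst nn_integral_Pol_snd[OF P]) auto
    also have "\<dots> < \<infinity>" using F G by simp
    finally show "(\<integral>\<^sup>+z. ennreal (norm (f (fst z) * (g (fst (snd z)) * complex_of_real (snd (snd z)) powr u))) \<partial>P) < \<infinity>" .
  qed measurable
qed

text \<open>For \<open>v > 0\<close> put \<open>p = 1/v\<close> and test with the conjugate phase of \<open>h\<close> times \<open>m\<^bsup>p-1\<^esup>\<close>, where \<open>m = min(|h|, n)\<close>.
Young's inequality bounds the integral \<open>X\<close> of \<open>m\<^sup>p\<close> by \<open>(1 - v) X + v Y\<close> with \<open>Y\<close> the integral of \<open>|g|\<^sup>p\<close>.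
The truncation makes \<open>X\<close> finite, so \<open>X \<le> Y\<close>, and \<open>n\<close> tends to infinity. For \<open>v = 0\<close>, where \<open>|g| \<le> c\<close> almost
everywhere, testing on \<open>{|h| > c}\<close> shows that this set is null.\<close>

lemma Pol_dual_in_Lv:
  assumes P: "P \<in> Pol A B" and v: "0 \<le> Re u" "Re u \<le> 1"
    and g: "g \<in> Lv (Re u) B" and A: "finite_measure A" and B: "finite_measure B"
    and h: "integrable A h"
    and dual: "\<And>f c. f \<in> borel_measurable A \<Longrightarrow> (\<And>a. norm (f a) \<le> c) \<Longrightarrow>
      (\<integral>a. f a * h a \<partial>A) = (\<integral>z. f (fst z) * (g (fst (snd z)) * complex_of_real (snd (snd z)) powr u) \<partial>P)"
  shows "h \<in> Lv (Re u) A"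
proof -
  interpret A: finite_measure A by fact
  interpret P: finite_measure P by (rule finite_measure_Pol[OF P A])
  have [measurable]: "h \<in> borel_measurable A" using h by auto
  note [measurable] = measurable_Pol[OF P] Lv_measurable[OF g]
    measurable_powr_pos_borel[OF measurable_Pol(3)[OF P]]
  define v where "v = Re u"
  have v: "0 \<le> v" "v \<le> 1" using v by (simp_all add: v_def)
  have [measurable]: "cnj \<in> borel_measurable borel"
    by (intro borel_measurable_continuous_onI continuous_intros)
  have sgn_m: "(\<lambda>a. cnj (sgn (h a))) \<in> borel_measurable A" unfolding sgn_div_norm by measurable
  note [measurable] = sgn_m
  have sgn_h: "cnj (sgn z) * z = complex_of_real (norm z)" for z :: complex
  proof -
    have "cnj (sgn z) * z = (z * cnj z) / norm z" by (simp add: sgn_eq)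
    also have "\<dots> = norm z" by (simp add: complex_norm_square[symmetric] power2_eq_square)
    finally show ?thesis .
  qed
  \<comment> \<open>The test function is m times the conjugate phase of h.\<close>
  have test: "(\<integral>a. m a * norm (h a) \<partial>A) \<le> (\<integral>z. G z \<partial>P)"
    if m[measurable]: "m \<in> borel_measurable A" and m0: "\<And>a. 0 \<le> m a" and mc: "\<And>a. m a \<le> c"
      and G: "integrable P G"
      and le: "AE z in P. m (fst z) * norm (g (fst (snd z))) * snd (snd z) powr v \<le> G z" for m c G
  proof -
    define f where "f a = m a * cnj (sgn (h a))" for a
    have nf: "norm (f a) \<le> m a" for a
      using m0[of a] by (simp add: f_def norm_mult norm_sgn)
    have f: "f \<in> borel_measurable A" unfolding f_def by measurable
    note [measurable] = f
    have "(\<integral>a. m a * norm (h a) \<partial>A) = (\<integral>a. Re (f a * h a) \<partial>A)"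
      by (rule Bochner_Integration.integral_cong) (auto simp: f_def mult.assoc sgn_h)
    also have "\<dots> = Re (\<integral>a. f a * h a \<partial>A)"
    proof (rule integral_Re)
      show "integrable A (\<lambda>a. f a * h a)"
      proof (rule Bochner_Integration.integrable_bound[of _ "\<lambda>a. c * norm (h a)"])
        show "AE a in A. norm (f a * h a) \<le> norm (c * norm (h a))"
          using nf mc m0 by (auto simp: norm_mult abs_mult intro!: AE_I2 mult_right_mono order_trans[OF nf] order_trans[OF mc])
      qed (use h in auto)
    qed
    also have "\<dots> = Re (\<integral>z. f (fst z) * (g (fst (snd z)) * complex_of_real (snd (snd z)) powr u) \<partial>P)"
      by (subst dual[OF f]) (auto intro: order_trans[OF nf mc])
    also have "\<dots> \<le> norm (\<integral>z. f (fst z) * (g (fst (snd z)) * complex_of_real (snd (snd z)) powr u) \<partial>P)"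
      by (rule complex_Re_le_cmod)
    also have "\<dots> \<le> (\<integral>z. G z \<partial>P)"
    proof -
      have bd: "AE z in P. norm (f (fst z) * (g (fst (snd z)) * complex_of_real (snd (snd z)) powr u)) \<le> G z"
        using le AE_space
      proof eventually_elim
        case (elim z)
        then have t: "0 < snd (snd z)" by (auto simp: space_Pol[OF P])
        have "norm (f (fst z) * (g (fst (snd z)) * complex_of_real (snd (snd z)) powr u))
            = norm (f (fst z)) * (norm (g (fst (snd z))) * snd (snd z) powr v)"
          using t by (simp add: norm_mult norm_of_real_powr v_def)
        also have "\<dots> \<le> m (fst z) * (norm (g (fst (snd z))) * snd (snd z) powr v)"
          by (intro mult_right_mono nf) auto
        also have "\<dots> \<le> G z" using elim by (simp add: mult.assoc)
        finally show ?case .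
      qed
      have "integrable P (\<lambda>z. f (fst z) * (g (fst (snd z)) * complex_of_real (snd (snd z)) powr u))"
        by (rule Bochner_Integration.integrable_bound[OF G]) (use bd in \<open>auto elim!: eventually_mono\<close>)
      then have "(\<integral>z. norm (f (fst z) * (g (fst (snd z)) * complex_of_real (snd (snd z)) powr u)) \<partial>P) \<le> (\<integral>z. G z \<partial>P)"
        by (intro integral_mono_AE G bd integrable_norm)
      then show ?thesis by (rule order_trans[OF integral_norm_bound])
    qed
    finally show ?thesis .
  qed
  show ?thesis
  proof (cases "v = 0")
    case True
    then obtain c where c: "AE b in B. norm (g b) \<le> c" using g unfolding v_def by (auto simp only: Lv_0)
    define X where "X = {a \<in> space A. c < norm (h a)}"
    have X[measurable]: "X \<in> sets A" unfolding X_def by measurable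
    have Xh: "integrable A (\<lambda>a. indicator X a * norm (h a))"
      by (rule Bochner_Integration.integrable_bound[of _ "\<lambda>a. norm (h a)"])
         (use h in \<open>auto split: split_indicator\<close>)
    have Xc: "integrable A (\<lambda>a. c * indicator X a)"
      by (rule A.integrable_const_bound[where B="\<bar>c\<bar>"]) (auto split: split_indicator)
    have "(\<integral>a. indicator X a * norm (h a) \<partial>A) \<le> (\<integral>z. c * indicator X (fst z) \<partial>P)"
    proof (rule test[where c=1])
      show "integrable P (\<lambda>z. c * indicator X (fst z))"
        by (rule P.integrable_const_bound[where B="\<bar>c\<bar>"]) (auto split: split_indicator)
      show "AE z in P. indicator X (fst z) * norm (g (fst (snd z))) * snd (snd z) powr v \<le> c * indicator X (fst z)"
        using AE_Pol_snd[OF P c] AE_space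
        by eventually_elim (auto simp: True space_Pol[OF P] split: split_indicator)
    qed (auto split: split_indicator)
    also have "(\<integral>z. c * indicator X (fst z) \<partial>P) = (\<integral>a. c * indicator X a \<partial>distr P A fst)"
      by (rule integral_distr[symmetric]) auto
    also have "\<dots> = (\<integral>a. c * indicator X a \<partial>A)" by (simp only: distr_Pol_fst[OF P])
    finally have "(\<integral>a. indicator X a * norm (h a) - c * indicator X a \<partial>A) \<le> 0"
      by (subst Bochner_Integration.integral_diff[OF Xh Xc]) simp
    moreover have nn: "AE a in A. 0 \<le> indicator X a * norm (h a) - c * indicator X a"
      by (auto simp: X_def split: split_indicator)
    moreover have intd: "integrable A (\<lambda>a. indicator X a * norm (h a) - c * indicator X a)"
      by (rule Bochner_Integration.integrable_diff[OF Xh Xc])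
    ultimately have "(\<integral>a. indicator X a * norm (h a) - c * indicator X a \<partial>A) = 0"
      using integral_nonneg_AE[OF nn] by linarith
    then have "AE a in A. indicator X a * norm (h a) - c * indicator X a = 0"
      using integral_nonneg_eq_0_iff_AE[OF intd nn] by simp
    with AE_space have "AE a in A. norm (h a) \<le> c"
    proof eventually_elim
      case (elim a)
      then show ?case by (cases "a \<in> X") (auto simp: X_def)
    qed
    then show ?thesis using True unfolding v_def[symmetric] by (auto simp only: Lv_0 intro!: exI[of _ c]) measurable
  next
    case False
    then have pos: "0 < v" using v by simp
    define p where "p = 1 / v"
    have p1: "1 \<le> p" using pos v by (simp add: p_def)
    have pv: "p * v = 1" using pos by (simp add: p_def)
    have g1: "(\<integral>\<^sup>+b. ennreal (norm (g b) powr p) \<partial>B) < \<infinity>"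
      using g pos unfolding v_def p_def by (subst (asm) Lv_pos) auto
    define Y where "Y = (\<integral>z. snd (snd z) * norm (g (fst (snd z))) powr p \<partial>P)"
    have Y_int: "integrable P (\<lambda>z. snd (snd z) * norm (g (fst (snd z))) powr p)"
    proof (rule integrableI_bounded)
      have "(\<integral>\<^sup>+z. ennreal (norm (snd (snd z) * norm (g (fst (snd z))) powr p)) \<partial>P)
          = (\<integral>\<^sup>+z. ennreal (snd (snd z)) * ennreal (norm (g (fst (snd z))) powr p) \<partial>P)"
        by (rule nn_integral_cong) (auto simp: space_Pol[OF P] ennreal_mult)
      also have "\<dots> = (\<integral>\<^sup>+b. ennreal (norm (g b) powr p) \<partial>B)"
        by (subst nn_integral_Pol_snd[OF P]) auto
      finally show "(\<integral>\<^sup>+z. ennreal (norm (snd (snd z) * norm (g (fst (snd z))) powr p)) \<partial>P) < \<infinity>"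
        using g1 by simp
    qed measurable
    define m where "m n a = min (norm (h a)) (real n)" for n :: nat and a
    have m_meas[measurable]: "m n \<in> borel_measurable A" for n unfolding m_def by measurable
    have m0: "0 \<le> m n a" and mn: "m n a \<le> real n" and mh: "m n a \<le> norm (h a)" for n a by (auto simp: m_def)
    have mp_int: "integrable A (\<lambda>a. m n a powr p)" for n
      by (rule A.integrable_const_bound[where B="real n powr p"])
         (use m0 mn p1 in \<open>auto intro!: powr_mono2\<close>)
    have X_le: "(\<integral>a. m n a powr p \<partial>A) \<le> Y" for n
    proof -
      define X where "X = (\<integral>a. m n a powr p \<partial>A)"
      have XP: "(\<integral>z. m n (fst z) powr p \<partial>P) = X"
      proof -
        have "(\<integral>z. m n (fst z) powr p \<partial>P) = (\<integral>a. m n a powr p \<partial>distr P A fst)"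
          by (rule integral_distr[symmetric]) auto
        then show ?thesis by (simp only: distr_Pol_fst[OF P] X_def)
      qed
      have XP_int: "integrable P (\<lambda>z. m n (fst z) powr p)"
        by (rule P.integrable_const_bound[where B="real n powr p"])
           (use m0 mn p1 in \<open>auto intro!: powr_mono2\<close>)
      have "X \<le> (\<integral>a. m n a powr (p - 1) * norm (h a) \<partial>A)"
        unfolding X_def
      proof (rule integral_mono[OF mp_int])
        show "integrable A (\<lambda>a. m n a powr (p - 1) * norm (h a))"
        proof (rule Bochner_Integration.integrable_bound[of _ "\<lambda>a. real n powr (p - 1) * norm (h a)"])
          show "AE a in A. norm (m n a powr (p - 1) * norm (h a)) \<le> norm (real n powr (p - 1) * norm (h a))"
            using m0 mn p1 by (auto simp: abs_mult intro!: mult_right_mono powr_mono2)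
        qed (use h in auto)
        fix a
        have "m n a powr p = m n a powr (p - 1) * m n a"
          using m0[of n a] by (cases "m n a = 0") (auto simp: powr_diff)
        also have "\<dots> \<le> m n a powr (p - 1) * norm (h a)"
          by (intro mult_left_mono mh) auto
        finally show "m n a powr p \<le> m n a powr (p - 1) * norm (h a)" .
      qed
      also have "\<dots> \<le> (\<integral>z. (1 - v) * m n (fst z) powr p + v * (snd (snd z) * norm (g (fst (snd z))) powr p) \<partial>P)"
      proof (rule test[where c="real n powr (p - 1)"])
        show "m n a powr (p - 1) \<le> real n powr (p - 1)" for a
          using m0 mn p1 by (intro powr_mono2) auto
        show "integrable P (\<lambda>z. (1 - v) * m n (fst z) powr p + v * (snd (snd z) * norm (g (fst (snd z))) powr p))"
          using XP_int Y_int by auto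
        show "AE z in P. m n (fst z) powr (p - 1) * norm (g (fst (snd z))) * snd (snd z) powr v
            \<le> (1 - v) * m n (fst z) powr p + v * (snd (snd z) * norm (g (fst (snd z))) powr p)"
          using AE_space
        proof eventually_elim
          case (elim z)
          have t: "0 < snd (snd z)" using elim by (auto simp: space_Pol[OF P])
          have "(m n (fst z) powr p) powr (1 - v) = m n (fst z) powr (p - 1)"
            using pv by (simp add: powr_powr right_diff_distrib)
          moreover have "(snd (snd z) * norm (g (fst (snd z))) powr p) powr v = norm (g (fst (snd z))) * snd (snd z) powr v"
            using t pv by (simp add: powr_powr powr_mult)
          ultimately show ?case
            using weighted_Young[of "m n (fst z) powr p" "snd (snd z) * norm (g (fst (snd z))) powr p" v] t v
            by (simp add: mult.assoc)
        qed
      qed auto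
      also have "\<dots> = (1 - v) * X + v * Y"
        using XP_int Y_int by (simp add: XP Y_def)
      finally have "v * X \<le> v * Y" by (simp add: algebra_simps)
      then show ?thesis using pos by (simp add: X_def)
    qed
    have "(\<integral>\<^sup>+a. ennreal (norm (h a) powr p) \<partial>A) = (\<integral>\<^sup>+a. (SUP n. ennreal (m n a powr p)) \<partial>A)"
    proof (rule nn_integral_cong)
      fix a
      obtain n :: nat where n: "norm (h a) \<le> real n" using real_arch_simple by blast
      show "ennreal (norm (h a) powr p) = (SUP n. ennreal (m n a powr p))"
      proof (rule antisym)
        have "norm (h a) = m n a" using n by (simp add: m_def)
        then show "ennreal (norm (h a) powr p) \<le> (SUP n. ennreal (m n a powr p))"
          by (metis SUP_upper UNIV_I)
        show "(SUP n. ennreal (m n a powr p)) \<le> ennreal (norm (h a) powr p)"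
          using m0 mh p1 by (intro SUP_least ennreal_leI powr_mono2) auto
      qed
    qed
    also have "\<dots> = (SUP n. \<integral>\<^sup>+a. ennreal (m n a powr p) \<partial>A)"
    proof (rule nn_integral_monotone_convergence_SUP)
      show "incseq (\<lambda>n a. ennreal (m n a powr p))"
        using m0 p1 by (auto simp: incseq_def le_fun_def m_def intro!: ennreal_leI powr_mono2)
    qed auto
    also have "\<dots> \<le> ennreal Y"
      using X_le by (intro SUP_least) (subst nn_integral_eq_integral[OF mp_int], auto intro: ennreal_leI)
    also have "\<dots> < \<infinity>" by simp
    finally show ?thesis
      using pos unfolding v_def p_def by (subst Lv_pos) auto
  qed
qed

section \<open>The operators of a polymorphism\<close>

text \<open>\<open>h\<close> is a version of \<open>T\<^sub>u P g\<close>.\<close>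

definition represents ::
  "complex \<Rightarrow> 'a measure \<Rightarrow> ('a \<times> 'b \<times> real) measure \<Rightarrow> ('b \<Rightarrow> complex) \<Rightarrow> ('a \<Rightarrow> complex) \<Rightarrow> bool" where
  "represents u A P g h \<longleftrightarrow> h \<in> Lv (Re u) A \<and> (\<forall>f\<in>Lv (1 - Re u) A.
     (\<integral>a. f a * h a \<partial>A) = (\<integral>z. f (fst z) * (g (fst (snd z)) * complex_of_real (snd (snd z)) powr u) \<partial>P))"

text \<open>The representative comes with the densities of its four parts, because the composition compares
these parts with conditional expectations.\<close>

lemma represents_exists:
  assumes P: "P \<in> Pol A B" and v: "0 \<le> Re u" "Re u \<le> 1"
    and g: "g \<in> Lv (Re u) B" and A: "finite_measure A" and B: "finite_measure B"
  obtains h :: "nat \<Rightarrow> 'a \<Rightarrow> real" where "\<And>j. h j \<in> borel_measurable A" "\<And>j a. 0 \<le> h j a"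
    "\<And>j. distr (density P (\<lambda>z. ennreal (cpart j (g (fst (snd z)) * complex_of_real (snd (snd z)) powr u)))) A fst
      = density A (\<lambda>a. ennreal (h j a))"
    "represents u A P g (\<lambda>a. \<Sum>j<4. \<i> ^ j * complex_of_real (h j a))"
proof -
  note [measurable] = measurable_Pol[OF P] Lv_measurable[OF g] measurable_powr_pos_borel[OF measurable_Pol(3)[OF P]]
  let ?F = "\<lambda>z. g (fst (snd z)) * complex_of_real (snd (snd z)) powr u"
  have pair: "integrable P (\<lambda>z. f (fst z) * ?F z)" if "f \<in> Lv (1 - Re u) A" for f
    by (rule Pol_pairing_integrable[OF P v that g A B])
  have bdd: "f \<in> Lv (1 - Re u) A" if "f \<in> borel_measurable A" "\<And>a. norm (f a) \<le> c" for f c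
    by (rule Lv_bounded[OF A _ that]) (use v in simp)
  have one: "(\<lambda>_. 1) \<in> Lv (1 - Re u) A" by (rule bdd[of _ 1]) auto
  have F: "integrable P ?F" using pair[OF one] by simp
  then have F_meas: "?F \<in> borel_measurable P" by auto
  obtain h where h[measurable]: "\<And>j. h j \<in> borel_measurable A" and h0: "\<And>j a. 0 \<le> h j a"
    and dens: "\<And>j. distr (density P (\<lambda>z. ennreal (cpart j (?F z)))) A fst = density A (\<lambda>a. ennreal (h j a))"
    using complex_pushforward_density[OF A measurable_Pol(1)[OF P] AE_Pol_fst[OF P AE_not_in] F] by blast
  define H where "H a = (\<Sum>j<4. \<i> ^ j * complex_of_real (h j a))" for a
  have trans: "integrable A (\<lambda>a. f a * H a)" "(\<integral>a. f a * H a \<partial>A) = (\<integral>z. f (fst z) * ?F z \<partial>P)"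
    if "f \<in> Lv (1 - Re u) A" for f
    unfolding H_def
    using integral_density_transfer[OF measurable_Pol(1)[OF P] F_meas h h0 dens Lv_measurable[OF that] pair[OF that]]
    by auto
  have "integrable A H" using trans(1)[OF one] by simp
  then have "H \<in> Lv (Re u) A"
    by (rule Pol_dual_in_Lv[OF P v g A B]) (rule trans(2), rule bdd)
  then have "represents u A P g H" using trans(2) by (auto simp: represents_def)
  then show ?thesis using that[OF h h0 dens] by (simp add: H_def[abs_def])
qed

lemma represents_AE_unique:
  assumes A: "finite_measure A" and v: "0 \<le> Re u" "Re u \<le> 1"
    and h: "represents u A P g h" and h': "represents u A P g h'"
  shows "AE a in A. h a = h' a"
proof -
  have i: "integrable A h" "integrable A h'"
    using h h' v by (auto simp: represents_def intro!: Lv_integrable[OF A])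
  interpret finite_measure A by fact
  show ?thesis
  proof (rule density_unique_banach[OF i])
    fix X assume [measurable]: "X \<in> sets A"
    have "(\<lambda>a. indicator X a :: complex) \<in> Lv (1 - Re u) A"
      by (rule Lv_bounded[OF A, where c=1]) (use v in \<open>auto split: split_indicator\<close>)
    then have "(\<integral>a. indicator X a * h a \<partial>A) = (\<integral>a. indicator X a * h' a \<partial>A)"
      using h h' by (simp add: represents_def)
    moreover have "indicator X a *\<^sub>R k = indicator X a * k" for a and k :: complex
      by (simp split: split_indicator)
    ultimately show "set_lebesgue_integral A X h = set_lebesgue_integral A X h'"
      unfolding set_lebesgue_integral_def by simp
  qed
qed

lemma represents_cong_AE:
  assumes P: "P \<in> Pol A B" and h: "represents u A P g h"
    and g': "(g, g') \<in> Lp_rel (1 / ennreal (Re u)) B" and h': "(h, h') \<in> Lp_rel (1 / ennreal (Re u)) A"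
  shows "represents u A P g' h'"
  unfolding represents_def
proof (intro conjI ballI)
  have g'm: "g \<in> borel_measurable B" "g' \<in> borel_measurable B" "h \<in> borel_measurable A" "h' \<in> borel_measurable A"
    and ae: "AE b in B. g b = g' b" "AE a in A. h a = h' a"
    using g' h' by (auto simp: Lp_rel_def intro: Lv_measurable)
  note [measurable] = g'm measurable_Pol[OF P] measurable_powr_pos_borel[OF measurable_Pol(3)[OF P]]
  show "h' \<in> Lv (Re u) A" using h' by (simp add: Lp_rel_def)
  fix f assume f: "f \<in> Lv (1 - Re u) A"
  note [measurable] = Lv_measurable[OF f]
  have "(\<integral>a. f a * h' a \<partial>A) = (\<integral>a. f a * h a \<partial>A)"
    by (rule integral_cong_AE) (use ae(2) in \<open>auto elim!: eventually_mono\<close>)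
  also have "\<dots> = (\<integral>z. f (fst z) * (g (fst (snd z)) * complex_of_real (snd (snd z)) powr u) \<partial>P)"
    using h f by (simp add: represents_def)
  also have "\<dots> = (\<integral>z. f (fst z) * (g' (fst (snd z)) * complex_of_real (snd (snd z)) powr u) \<partial>P)"
  proof (rule integral_cong_AE)
    show "AE z in P. f (fst z) * (g (fst (snd z)) * complex_of_real (snd (snd z)) powr u)
        = f (fst z) * (g' (fst (snd z)) * complex_of_real (snd (snd z)) powr u)"
      using AE_Pol_snd[OF P ae(1)] by eventually_elim simp
  qed measurable
  finally show "(\<integral>a. f a * h' a \<partial>A) = (\<integral>z. f (fst z) * (g' (fst (snd z)) * complex_of_real (snd (snd z)) powr u) \<partial>P)" .
qed

text \<open>A representative determines the value of the operator, since any two representatives agree almost everywhere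
and the duality relation depends only on the classes.\<close>

lemma T_op_eq_class:
  assumes P: "P \<in> Pol A B" and A: "finite_measure A" and v: "0 \<le> Re u" "Re u \<le> 1"
    and G: "G \<in> Lp_space (1 / ennreal (Re u)) B" and g: "g \<in> G" and h: "represents u A P g h"
  shows "T_op u A B P G = Lp_rel (1 / ennreal (Re u)) A `` {h}"
proof -
  let ?r = "Lp_rel (1 / ennreal (Re u)) A" and ?s = "Lp_rel (1 / ennreal (Re u)) B"
  have h_Lv: "h \<in> Lv (Re u) A" using h by (simp add: represents_def)
  have G_rel: "(g, g') \<in> ?s" if "g' \<in> G" for g'
    using quotient_eq_iff[OF Lp_rel_equiv G[unfolded Lp_space_def] G[unfolded Lp_space_def] g that] by simp
  have char: "(\<forall>g\<in>G. \<forall>h\<in>H. \<forall>f\<in>Lv (1 - Re u) A. (\<integral>a. h a * f a \<partial>A) =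
      (\<integral>(a, b, t). f a * g b * (complex_of_real t powr u) \<partial>P)) \<longleftrightarrow> (\<forall>g\<in>G. \<forall>h\<in>H. represents u A P g h)"
    if "H \<in> Lp_space (1 / ennreal (Re u)) A" for H
  proof -
    have "H \<subseteq> Lv (Re u) A" using that Lp_rel_equiv in_quotient_imp_subset unfolding Lp_space_def by blast
    then show ?thesis
      unfolding represents_def case_prod_beta by (auto simp: mult.commute mult.left_commute mult.assoc)
  qed
  have "T_op u A B P G = (THE H. H \<in> Lp_space (1 / ennreal (Re u)) A \<and>
      (\<forall>g\<in>G. \<forall>h\<in>H. represents u A P g h))"
    unfolding T_op_def using G char by (simp cong: conj_cong)
  also have "\<dots> = ?r `` {h}"
  proof (rule the_equality)
    have "?r `` {h} \<in> Lp_space (1 / ennreal (Re u)) A"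
      unfolding Lp_space_def using h_Lv by (rule quotientI)
    moreover have "represents u A P g' h'" if "g' \<in> G" "h' \<in> ?r `` {h}" for g' h'
      by (rule represents_cong_AE[OF P h G_rel[OF that(1)]]) (use that in auto)
    ultimately show "?r `` {h} \<in> Lp_space (1 / ennreal (Re u)) A \<and> (\<forall>g\<in>G. \<forall>h'\<in>?r `` {h}. represents u A P g h')"
      by blast
  next
    fix H assume H: "H \<in> Lp_space (1 / ennreal (Re u)) A \<and> (\<forall>g\<in>G. \<forall>h\<in>H. represents u A P g h)"
    then have HQ: "H \<in> Lv (Re u) A // ?r" by (simp add: Lp_space_def)
    then obtain h' where h': "h' \<in> H" using in_quotient_imp_non_empty[OF Lp_rel_equiv] by blast
    then have "represents u A P g h'" using H g by blast
    then have "(h', h) \<in> ?r"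
      using represents_AE_unique[OF A v _ h] h_Lv by (auto simp: Lp_rel_def represents_def)
    moreover have "h \<in> ?r `` {h}" using h_Lv by (auto simp: Lp_rel_def)
    ultimately show "H = ?r `` {h}"
      using quotient_eqI[OF Lp_rel_equiv HQ quotientI[OF h_Lv] h'] by blast
  qed
  finally show ?thesis .
qed

context coded_composition
begin

text \<open>The decoded function is measurable for the completion, so it agrees almost everywhere with a Borel function of the code.\<close>

lemma coded_function:
  fixes g :: "'c \<Rightarrow> complex"
  assumes [measurable]: "g \<in> borel_measurable C"
  obtains g' :: "real \<Rightarrow> complex" where "g' \<in> borel_measurable borel" "AE x in D. g (\<psi> x) = g' x"
    "AE c in C. g c = g' (\<phi> c)"
proof -
  have gm: "(\<lambda>x. g (\<psi> x)) \<in> borel_measurable (completion D)"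
    by (rule measurable_compose[OF \<psi> assms])
  obtain g1 where m1: "g1 \<in> borel_measurable D" and ae1: "AE x in D. Re (g (\<psi> x)) = g1 x"
    using completion_ex_borel_measurable_real[OF measurable_compose[OF gm borel_measurable_Re]] by blast
  obtain g2 where m2: "g2 \<in> borel_measurable D" and ae2: "AE x in D. Im (g (\<psi> x)) = g2 x"
    using completion_ex_borel_measurable_real[OF measurable_compose[OF gm borel_measurable_Im]] by blast
  have [measurable]: "g1 \<in> borel_measurable borel" "g2 \<in> borel_measurable borel" using m1 m2 by simp_all
  define g' where "g' x = complex_of_real (g1 x) + \<i> * complex_of_real (g2 x)" for x
  have g': "g' \<in> borel_measurable borel" unfolding g'_def by measurable
  have ae': "AE x in D. g (\<psi> x) = g' x"
    using ae1 ae2 by eventually_elim (simp add: g'_def complex_eq_iff)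
  have "AE c in C. g (\<psi> (\<phi> c)) = g' (\<phi> c)"
    by (rule AE_distrD[OF \<phi> ae'])
  then have "AE c in C. g c = g' (\<phi> c)" using \<psi>\<phi> by eventually_elim simp
  with g' ae' that show ?thesis by blast
qed

text \<open>The function \<open>h\<close> is the conditional expectation of \<open>G = g(c) s\<^sup>u\<close> given \<open>b\<close>, both under \<open>Q\<close> and, since
\<open>(c, s)\<close> depends on \<open>(a, b, t)\<close> through \<open>b\<close> only, under \<open>W\<close> given \<open>(a, b, t)\<close>. Testing the latter against
\<open>f(a) t\<^sup>u\<close> gives the duality relation for \<open>R\<close>.\<close>

lemma represents_R:
  assumes v: "0 \<le> Re u" "Re u \<le> 1" and g: "g \<in> Lv (Re u) C"
  obtains h k where "represents u B Q g h" "represents u A P h k" "represents u A R g k"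
proof -
  interpret B: finite_measure B by (rule B)
  note [measurable] = Lv_measurable[OF g] measurable_powr_pos_borel[OF measurable_Pol(3)[OF P]]
    measurable_powr_pos_borel[OF measurable_Pol(3)[OF Q]]
  let ?FQ = "\<lambda>z. g (fst (snd z)) * complex_of_real (snd (snd z)) powr u"
  obtain hh where hh[measurable]: "\<And>j. hh j \<in> borel_measurable B" and hh0: "\<And>j b. 0 \<le> hh j b"
    and dens: "\<And>j. distr (density Q (\<lambda>z. ennreal (cpart j (?FQ z)))) B fst = density B (\<lambda>b. ennreal (hh j b))"
    and h_rep: "represents u B Q g (\<lambda>b. \<Sum>j<4. \<i> ^ j * complex_of_real (hh j b))"
    by (rule represents_exists[OF Q v g B C]) (rule that, simp_all)
  define h where "h b = (\<Sum>j<4. \<i> ^ j * complex_of_real (hh j b))" for b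
  have h: "represents u B Q g h" using h_rep by (simp add: h_def[abs_def])
  then have h_Lv: "h \<in> Lv (Re u) B" by (simp add: represents_def)
  obtain kk where k_rep: "represents u A P h (\<lambda>a. \<Sum>j<4. \<i> ^ j * complex_of_real (kk j a))"
    by (rule represents_exists[OF P v h_Lv A B])
  define k where "k a = (\<Sum>j<4. \<i> ^ j * complex_of_real (kk j a))" for a :: 'a
  have k: "represents u A P h k" using k_rep by (simp add: k_def[abs_def])
  obtain g' where g'[measurable]: "g' \<in> borel_measurable borel" and g'D: "AE x in D. g (\<psi> x) = g' x"
    and g'C: "AE c in C. g c = g' (\<phi> c)"
    using coded_function[OF Lv_measurable[OF g]] by blast
  define G where "G y = g' (fst y) * complex_of_real (snd y) powr u" for y
  have G[measurable]: "G \<in> borel_measurable N"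
  proof -
    have [measurable]: "(\<lambda>y. complex_of_real (snd y) powr u) \<in> borel_measurable N"
      by (rule measurable_powr_pos_borel) measurable
    show ?thesis unfolding G_def by measurable
  qed
  \<comment> \<open>The kernel computes the densities of the parts of the integrand over Q.\<close>
  have H: "AE b in B. (\<integral>\<^sup>+y. ennreal (cpart j (G y)) \<partial>\<kappa> b) = ennreal (hh j b)" for j
  proof (rule B.density_unique_finite_measure)
    show "(\<lambda>b. \<integral>\<^sup>+y. ennreal (cpart j (G y)) \<partial>\<kappa> b) \<in> borel_measurable B"
      using nn_integral_\<kappa>_measurable[of "\<lambda>w. ennreal (cpart j (G (snd w)))"] by simp
    fix X assume X[measurable]: "X \<in> sets B"
    have s\<kappa>: "sets (\<kappa> b) = sets N" if "b \<in> space B" for b using sets_kernel[OF \<kappa>' that] .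
    have "(\<integral>\<^sup>+b. (\<integral>\<^sup>+y. ennreal (cpart j (G y)) \<partial>\<kappa> b) * indicator X b \<partial>B)
        = (\<integral>\<^sup>+b. \<integral>\<^sup>+y. ennreal (cpart j (G y)) * indicator X b \<partial>\<kappa> b \<partial>B)"
      by (rule nn_integral_cong) (auto split: split_indicator)
    also have "\<dots> = (\<integral>\<^sup>+z. ennreal (cpart j (G (\<phi> (fst (snd z)), snd (snd z)))) * indicator X (fst z) \<partial>Q)"
      using nn_integral_Q[of "\<lambda>w. ennreal (cpart j (G (snd w))) * indicator X (fst w)"] by simp
    also have "\<dots> = (\<integral>\<^sup>+z. ennreal (cpart j (?FQ z)) * indicator X (fst z) \<partial>Q)"
      using AE_Pol_snd[OF Q g'C] by (intro nn_integral_cong_AE) (auto elim!: eventually_mono simp: G_def)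
    also have "\<dots> = (\<integral>\<^sup>+b. indicator X b \<partial>distr (density Q (\<lambda>z. ennreal (cpart j (?FQ z)))) B fst)"
      by (subst nn_integral_distr, simp, simp, subst nn_integral_density) auto
    also have "\<dots> = (\<integral>\<^sup>+b. ennreal (hh j b) * indicator X b \<partial>B)"
      unfolding dens by (subst nn_integral_density) auto
    finally show "(\<integral>\<^sup>+b. (\<integral>\<^sup>+y. ennreal (cpart j (G y)) \<partial>\<kappa> b) * indicator X b \<partial>B)
        = (\<integral>\<^sup>+b. ennreal (hh j b) * indicator X b \<partial>B)" .
  qed auto
  have W_fst[measurable]: "fst \<in> W \<rightarrow>\<^sub>M P" by measurable
  have GW: "(\<lambda>w. G (snd w)) \<in> borel_measurable W" by measurable
  have hhP: "(\<lambda>z. hh j (fst (snd z))) \<in> borel_measurable P" for j by measurable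
  \<comment> \<open>Hence the same densities, viewed as functions on P, belong to W.\<close>
  have densW: "distr (density W (\<lambda>w. ennreal (cpart j (G (snd w))))) P fst = density P (\<lambda>z. ennreal (hh j (fst (snd z))))" for j
  proof (rule measure_eqI)
    fix X assume "X \<in> sets (distr (density W (\<lambda>w. ennreal (cpart j (G (snd w))))) P fst)"
    then have X[measurable]: "X \<in> sets P" by simp
    have "emeasure (distr (density W (\<lambda>w. ennreal (cpart j (G (snd w))))) P fst) X
        = (\<integral>\<^sup>+z. indicator X z \<partial>distr (density W (\<lambda>w. ennreal (cpart j (G (snd w))))) P fst)" by simp
    also have "\<dots> = (\<integral>\<^sup>+w. ennreal (cpart j (G (snd w))) * indicator X (fst w) \<partial>W)"
      by (subst nn_integral_distr, simp, simp, subst nn_integral_density) auto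
    also have "\<dots> = (\<integral>\<^sup>+z. \<integral>\<^sup>+y. ennreal (cpart j (G y)) * indicator X z \<partial>\<kappa> (fst (snd z)) \<partial>P)"
      by (subst nn_integral_W) auto
    also have "\<dots> = (\<integral>\<^sup>+z. (\<integral>\<^sup>+y. ennreal (cpart j (G y)) \<partial>\<kappa> (fst (snd z))) * indicator X z \<partial>P)"
      by (rule nn_integral_cong) (auto split: split_indicator)
    also have "\<dots> = (\<integral>\<^sup>+z. ennreal (hh j (fst (snd z))) * indicator X z \<partial>P)"
      using AE_Pol_snd[OF P H[of j]] by (intro nn_integral_cong_AE) (auto elim!: eventually_mono)
    also have "\<dots> = emeasure (density P (\<lambda>z. ennreal (hh j (fst (snd z))))) X"
      by (subst emeasure_density) auto
    finally show "emeasure (distr (density W (\<lambda>w. ennreal (cpart j (G (snd w))))) P fst) X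
        = emeasure (density P (\<lambda>z. ennreal (hh j (fst (snd z))))) X" .
  qed simp
  have "represents u A R g k"
    unfolding represents_def
  proof (intro conjI ballI)
    show "k \<in> Lv (Re u) A" using k by (simp add: represents_def)
    fix f assume f: "f \<in> Lv (1 - Re u) A"
    note [measurable] = Lv_measurable[OF f]
    let ?I = "\<lambda>z. f (fst z) * (g (fst (snd z)) * complex_of_real (snd (snd z)) powr u)"
    let ?J = "\<lambda>w. f (fst (fst w)) * complex_of_real (snd (snd (fst w))) powr u * G (snd w)"
    have I_int: "integrable R ?I" by (rule Pol_pairing_integrable[OF R_Pol v f g A C])
    then have I_meas: "?I \<in> borel_measurable (A \<Otimes>\<^sub>M C \<Otimes>\<^sub>M pos_borel)"
      by (simp add: measurable_cong_sets[OF sets_R refl, symmetric] borel_measurable_integrable)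
    have J_meas: "?J \<in> borel_measurable W" by measurable
    have IZ_meas: "(\<lambda>w. ?I (Z w)) \<in> borel_measurable (completion W)"
      by (rule measurable_compose[OF Z I_meas])
    have J_eq: "AE w in completion W. ?I (Z w) = ?J w"
      unfolding AE_completion_iff using AE_W_coded[OF g'D] AE_space
    proof eventually_elim
      case (elim w)
      then have pos: "0 < snd (snd w)" "0 < snd (snd (fst w))"
        by (auto simp: space_W space_Pol[OF P] space_pair_measure)
      have "complex_of_real (snd (snd w) * snd (snd (fst w))) powr u
          = complex_of_real (snd (snd w)) powr u * complex_of_real (snd (snd (fst w))) powr u"
        using pos powr_times_real[of "complex_of_real (snd (snd w))" "complex_of_real (snd (snd (fst w)))" u] by simp
      then show ?case using elim by (simp add: Z_def G_def mult_ac)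
    qed
    have "integrable (completion W) (\<lambda>w. ?I (Z w))"
      using I_int unfolding R_def by (subst (asm) integrable_distr_eq[OF Z I_meas])
    then have "integrable (completion W) ?J"
      using integrable_cong_AE[OF IZ_meas measurable_completion[OF J_meas] J_eq] by simp
    then have J_int: "integrable W ?J" by (simp only: integrable_completion[OF J_meas])
    have "(\<integral>a. f a * k a \<partial>A) = (\<integral>z. f (fst z) * (h (fst (snd z)) * complex_of_real (snd (snd z)) powr u) \<partial>P)"
      using k f by (simp add: represents_def)
    also have "\<dots> = (\<integral>z. (f (fst z) * complex_of_real (snd (snd z)) powr u) * (\<Sum>j<4. \<i> ^ j * complex_of_real (hh j (fst (snd z)))) \<partial>P)"
      by (simp add: h_def mult_ac)
    also have "\<dots> = (\<integral>w. ?J w \<partial>W)"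
      by (rule integral_density_transfer(2)[OF W_fst GW hhP hh0 densW _ J_int]) measurable
    also have "\<dots> = (\<integral>w. ?J w \<partial>completion W)"
      by (rule integral_completion[OF J_meas, symmetric])
    also have "\<dots> = (\<integral>w. ?I (Z w) \<partial>completion W)"
      using J_eq by (intro integral_cong_AE measurable_completion[OF J_meas] IZ_meas) (auto elim!: eventually_mono)
    also have "\<dots> = (\<integral>z. ?I z \<partial>R)"
      unfolding R_def by (rule integral_distr[OF Z I_meas, symmetric])
    finally show "(\<integral>a. f a * k a \<partial>A) = (\<integral>z. ?I z \<partial>R)" .
  qed
  with h k that show ?thesis by blast
qed

end

theorem theorem6p14:
  fixes A :: "'a measure" and B :: "'b measure" and C :: "'c measure"
    and P :: "('a \<times> 'b \<times> real) measure" and Q :: "('b \<times> 'c \<times> real) measure"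
    and u :: complex
  assumes "lebesgue_space A" and "lebesgue_space B" and "lebesgue_space C"
    and "P \<in> Pol A B" and "Q \<in> Pol B C"
    and "0 \<le> Re u" and "Re u \<le> 1"
  shows "compose (Lp_space (1 / ennreal (Re u)) C) (T_op u A B P) (T_op u B C Q)
           = T_op u A C (pol_comp A B C Q P)"
proof -
  note P = \<open>P \<in> Pol A B\<close> and Q = \<open>Q \<in> Pol B C\<close> and v = \<open>0 \<le> Re u\<close> \<open>Re u \<le> 1\<close>
  have fin: "finite_measure A" "finite_measure B" "finite_measure C"
    and ne: "space A \<noteq> {}" "space B \<noteq> {}"
    using assms(1-3) by (auto simp: lebesgue_space_def)
  obtain \<phi> :: "'c \<Rightarrow> real" and \<psi> where \<phi>[measurable]: "\<phi> \<in> borel_measurable C"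
    and \<psi>: "\<psi> \<in> completion (distr C borel \<phi>) \<rightarrow>\<^sub>M C" and \<psi>\<phi>: "AE c in C. \<psi> (\<phi> c) = c"
    using lebesgue_space_coding[OF assms(3)] by blast
  note [measurable] = measurable_Pol[OF Q]
  define Q' where "Q' = distr Q (B \<Otimes>\<^sub>M borel \<Otimes>\<^sub>M pos_borel) (\<lambda>z. (fst z, \<phi> (fst (snd z)), snd (snd z)))"
  have "distr Q' B fst = distr Q B (fst \<circ> (\<lambda>z. (fst z, \<phi> (fst (snd z)), snd (snd z))))"
    unfolding Q'_def by (rule distr_distr) measurable
  also have "fst \<circ> (\<lambda>z. (fst z, \<phi> (fst (snd z)), snd (snd z))) = fst" by auto
  finally have marg: "distr Q' B fst = B" by (simp add: distr_Pol_fst[OF Q])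
  have sets_Q': "sets Q' = sets (B \<Otimes>\<^sub>M borel \<Otimes>\<^sub>M pos_borel)" by (simp add: Q'_def)
  obtain \<kappa> where \<kappa>: "\<kappa> \<in> B \<rightarrow>\<^sub>M prob_algebra (borel \<Otimes>\<^sub>M pos_borel)"
    and Q_\<kappa>: "Q' = kernel_product B (borel \<Otimes>\<^sub>M pos_borel) \<kappa>"
    by (rule disintegration_real_pos_borel[OF fin(2) ne(2) sets_Q' marg])
  interpret coded_composition A B C P Q \<phi> \<psi> \<kappa>
    by (intro coded_composition.intro fin ne P Q \<phi> \<psi> \<psi>\<phi> \<kappa> Q_\<kappa>[unfolded Q'_def])
  let ?p = "1 / ennreal (Re u)"
  show ?thesis
    unfolding pol_comp_eq_R
  proof
    fix G
    show "compose (Lp_space ?p C) (T_op u A B P) (T_op u B C Q) G = T_op u A C R G"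
    proof (cases "G \<in> Lp_space ?p C")
      case False
      then show ?thesis by (simp add: compose_def T_op_def)
    next
      case G: True
      then obtain g where g: "g \<in> Lv (Re u) C" and G_eq: "G = Lp_rel ?p C `` {g}"
        unfolding Lp_space_def by (rule quotientE)
      have gG: "g \<in> G" using g unfolding G_eq by (auto simp: Lp_rel_def)
      obtain h k where h: "represents u B Q g h" and k: "represents u A P h k" and R: "represents u A R g k"
        using represents_R[OF v g] by blast
      have h_Lv: "h \<in> Lv (Re u) B" using h by (simp add: represents_def)
      have "compose (Lp_space ?p C) (T_op u A B P) (T_op u B C Q) G = T_op u A B P (T_op u B C Q G)"
        using G by (simp add: compose_def)
      also have "\<dots> = T_op u A B P (Lp_rel ?p B `` {h})"
        by (simp only: T_op_eq_class[OF Q fin(2) v G gG h])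
      also have "\<dots> = Lp_rel ?p A `` {k}"
      proof (rule T_op_eq_class[OF P fin(1) v _ _ k])
        show "Lp_rel ?p B `` {h} \<in> Lp_space ?p B"
          unfolding Lp_space_def using h_Lv by (rule quotientI)
        show "h \<in> Lp_rel ?p B `` {h}" using h_Lv by (auto simp: Lp_rel_def)
      qed
      also have "\<dots> = T_op u A C R G"
        by (rule T_op_eq_class[OF R_Pol fin(1) v G gG R, symmetric])
      finally show ?thesis .
    qed
  qed
qed

end
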